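(* Let $\mathfrak g$ be a Kac--Moody algebra. For $\lambda\in\mathfrak h^*$ such that the stabilizer of $\lambda$ in $W_{I_\lambda}$ is finite, one has $$\sum_{\mu\in\mathfrak h^*:\,L(\lambda)_\mu\neq0}e^\mu=\sum_{w\in W_{I_\lambda}}w\,\frac{e^\lambda}{\prod_{i\in I}(1-e^{-\alpha_i})},$$ where in each summand on the right-hand side one takes the highest weight expansion $$w\frac1{1-e^{-\alpha_i}}:=\begin{cases}1+e^{-w\alpha_i}+e^{-2w\alpha_i}+\cdots,& w\alpha_i>0,\\ -e^{w\alpha_i}-e^{2w\alpha_i}-e^{3w\alpha_i}-\cdots,& w\alpha_i<0.\end{cases}$$
   Context: Let $I$ be a finite set, $A=(a_{ij})_{i,j\in I}$ a generalized Cartan matrix, and $(\mathfrak h,\{\alpha_i\},\{\check\alpha_i\})$ a realization over $\mathbb C$, i.e. $\dim\mathfrak h=2|I|-\operatorname{rk}A$, with linearly independent simple roots $\alpha_i\in\mathfrak h^*$ and linearly independent simple coroots $\check\alpha_i\in\mathfrak h$ with $\langle\check\alpha_i,\alpha_j\rangle=a_{ij}$. $\mathfrak g=\mathfrak g(A)$ is the Lie algebra generated by $\mathfrak h$ and $e_i,f_i$ ($i\in I$) with relations $[\mathfrak h,\mathfrak h]=0$, $[h,e_i]=\langle h,\alpha_i\rangle e_i$, $[h,f_i]=-\langle h,\alpha_i\rangle f_i$, $[e_i,f_j]=\delta_{ij}\check\alpha_i$ and the Serre relations $(\operatorname{ad}e_i)^{1-a_{ij}}e_j=0=(\operatorname{ad}f_i)^{1-a_{ij}}f_j$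 for $i\ne j$. $L(\lambda)$ is the simple highest weight $\mathfrak g$-module of highest weight $\lambda$, with weight spaces $L(\lambda)_\mu=\{v: hv=\langle h,\mu\rangle v\ \forall h\in\mathfrak h\}$. $I_\lambda=\{i\in I:\langle\check\alpha_i,\lambda\rangle\in\mathbb Z^{\geqslant0}\}$. $W_{I_\lambda}$ is the subgroup of the Weyl group generated by $s_i$, $i\in I_\lambda$, where $s_i\mu=\mu-\langle\check\alpha_i,\mu\rangle\alpha_i$, and $we^\mu=e^{w\mu}$. For a root $\alpha$, $\alpha>0$ (resp. $\alpha<0$) means $\alpha$ is a positive (resp. negative) root. The identity is one of formal (possibly infinite) sums of symbols $e^\mu$, $\mu\in\mathfrak h^*$. *)

theory Defs
  imports
    Complex_Main
    "HOL-Library.Function_Algebras"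
    "HOL-Library.FuncSet"
    "HOL-Analysis.Infinite_Sum"
    "HOL-Algebra.Bij"
    "HOL-Algebra.Generated_Groups"
begin

definition fun_scale :: "complex \<Rightarrow> ('x \<Rightarrow> complex) \<Rightarrow> 'x \<Rightarrow> complex"
  where "fun_scale c f = (\<lambda>x. c * f x)"

interpretation fun_space: vector_space fun_scale
  by unfold_locales (simp_all add: fun_scale_def fun_eq_iff algebra_simps)


section \<open>Lie algebras and presentations\<close>

locale lie_algebra = vector_space scale
  for scale :: "complex \<Rightarrow> 'g::ab_group_add \<Rightarrow> 'g" +
  fixes bracket :: "'g \<Rightarrow> 'g \<Rightarrow> 'g"
  assumes linear_right: "\<And>x. Vector_Spaces.linear scale scale (bracket x)"
    and linear_left: "\<And>y. Vector_Spaces.linear scale scale (\<lambda>x. bracket x y)"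
    and alternating: "\<And>x. bracket x x = 0"
    and jacobi: "\<And>x y z. bracket x (bracket y z) + bracket y (bracket z x)
                           + bracket z (bracket x y) = 0"

text \<open>Formal Lie algebra expressions in generators of type \<open>'x\<close>.\<close>

datatype (lie_gens: 'x) lie_term =
    LGen 'x
  | LZero
  | LAdd "'x lie_term" "'x lie_term"
  | LScale complex "'x lie_term"
  | LBr "'x lie_term" "'x lie_term"

primrec lie_eval ::
    "(complex \<Rightarrow> 'g::ab_group_add \<Rightarrow> 'g) \<Rightarrow> ('g \<Rightarrow> 'g \<Rightarrow> 'g) \<Rightarrow> ('x \<Rightarrow> 'g) \<Rightarrow> 'x lie_term \<Rightarrow> 'g"
where
  "lie_eval sc br \<phi> (LGen x) = \<phi> x"
| "lie_eval sc br \<phi> LZero = 0"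
| "lie_eval sc br \<phi> (LAdd s t) = lie_eval sc br \<phi> s + lie_eval sc br \<phi> t"
| "lie_eval sc br \<phi> (LScale c t) = sc c (lie_eval sc br \<phi> t)"
| "lie_eval sc br \<phi> (LBr s t) = br (lie_eval sc br \<phi> s) (lie_eval sc br \<phi> t)"

text \<open>
  The smallest congruence on expressions that contains the relations \<open>R\<close> and all instances
  of the axioms of a complex Lie algebra. The expressions modulo \<open>lie_cong R\<close> form the Lie
  algebra with the given generators and the relations \<open>R\<close>.
\<close>

inductive lie_cong :: "('x lie_term \<times> 'x lie_term) set \<Rightarrow> 'x lie_term \<Rightarrow> 'x lie_term \<Rightarrow> bool"
  for R
where
  rel: "(s, t) \<in> R \<Longrightarrow> lie_cong R s t"
| refl: "lie_cong R t t"
| sym: "lie_cong R s t \<Longrightarrow> lie_cong R t s"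
| trans: "lie_cong R s t \<Longrightarrow> lie_cong R t u \<Longrightarrow> lie_cong R s u"
| cong_add: "lie_cong R s s' \<Longrightarrow> lie_cong R t t' \<Longrightarrow> lie_cong R (LAdd s t) (LAdd s' t')"
| cong_scale: "lie_cong R t t' \<Longrightarrow> lie_cong R (LScale c t) (LScale c t')"
| cong_br: "lie_cong R s s' \<Longrightarrow> lie_cong R t t' \<Longrightarrow> lie_cong R (LBr s t) (LBr s' t')"
| add_assoc: "lie_cong R (LAdd (LAdd s t) u) (LAdd s (LAdd t u))"
| add_commute: "lie_cong R (LAdd s t) (LAdd t s)"
| add_zero: "lie_cong R (LAdd LZero t) t"
| add_neg: "lie_cong R (LAdd t (LScale (-1) t)) LZero"
| scale_right_distrib: "lie_cong R (LScale c (LAdd s t)) (LAdd (LScale c s) (LScale c t))"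
| scale_left_distrib: "lie_cong R (LScale (c + d) t) (LAdd (LScale c t) (LScale d t))"
| scale_scale: "lie_cong R (LScale c (LScale d t)) (LScale (c * d) t)"
| scale_one: "lie_cong R (LScale 1 t) t"
| br_add_left: "lie_cong R (LBr (LAdd s t) u) (LAdd (LBr s u) (LBr t u))"
| br_add_right: "lie_cong R (LBr u (LAdd s t)) (LAdd (LBr u s) (LBr u t))"
| br_scale_left: "lie_cong R (LBr (LScale c s) t) (LScale c (LBr s t))"
| br_scale_right: "lie_cong R (LBr s (LScale c t)) (LScale c (LBr s t))"
| br_self: "lie_cong R (LBr t t) LZero"
| jacobi: "lie_cong R (LAdd (LAdd (LBr s (LBr t u)) (LBr t (LBr u s))) (LBr u (LBr s t))) LZero"

text \<open>
  The Lie algebra on \<open>'g\<close> is generated by \<open>\<phi> ` X\<close>, and an equation between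
  expressions in the generators holds in it exactly if it follows from \<open>R\<close>; in other words,
  \<open>\<phi>\<close> induces an isomorphism from the Lie algebra generated by \<open>X\<close> with relations
  \<open>R\<close>.
\<close>

definition lie_presentation ::
    "(complex \<Rightarrow> 'g::ab_group_add \<Rightarrow> 'g) \<Rightarrow> ('g \<Rightarrow> 'g \<Rightarrow> 'g) \<Rightarrow>
     'x set \<Rightarrow> ('x lie_term \<times> 'x lie_term) set \<Rightarrow> ('x \<Rightarrow> 'g) \<Rightarrow> bool"
where
  "lie_presentation sc br X R \<phi> \<longleftrightarrow>
     lie_algebra sc br \<and>
     (\<forall>x. \<exists>t. lie_gens t \<subseteq> X \<and> lie_eval sc br \<phi> t = x) \<and>
     (\<forall>s t. lie_gens s \<subseteq> X \<longrightarrow> lie_gens t \<subseteq> X \<longrightarrow>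
        (lie_eval sc br \<phi> s = lie_eval sc br \<phi> t \<longleftrightarrow> lie_cong R s t))"


section \<open>Kac--Moody algebras\<close>

text \<open>
  The Cartan subalgebra is the whole type \<open>'h\<close>, the Lie algebra the whole type \<open>'g\<close>;
  the zero and the addition are those of the types, the scalar multiplications are record components.
  \<open>km_gen\<close> gives the images in the Lie algebra of the generators.
\<close>

datatype ('i, 'h) km_generator = GenH 'h | GenE 'i | GenF 'i

record ('i, 'h, 'g) kac_moody_data =
  idx :: "'i set"
  cartan :: "'i \<Rightarrow> 'i \<Rightarrow> int"
  hscale :: "complex \<Rightarrow> 'h \<Rightarrow> 'h"
  sroot :: "'i \<Rightarrow> 'h \<Rightarrow> complex"
  scoroot :: "'i \<Rightarrow> 'h"
  gscale :: "complex \<Rightarrow> 'g \<Rightarrow> 'g"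
  bracket :: "'g \<Rightarrow> 'g \<Rightarrow> 'g"
  km_gen :: "('i, 'h) km_generator \<Rightarrow> 'g"

definition generalized_cartan_matrix :: "'i set \<Rightarrow> ('i \<Rightarrow> 'i \<Rightarrow> int) \<Rightarrow> bool" where
  "generalized_cartan_matrix I a \<longleftrightarrow>
     (\<forall>i\<in>I. a i i = 2) \<and>
     (\<forall>i\<in>I. \<forall>j\<in>I. i \<noteq> j \<longrightarrow> a i j \<le> 0) \<and>
     (\<forall>i\<in>I. \<forall>j\<in>I. a i j = 0 \<longrightarrow> a j i = 0)"

text \<open>Rank of an \<open>I \<times> I\<close> matrix over \<open>\<complex>\<close>, as the dimension of its row space.\<close>

definition matrix_rank :: "'i set \<Rightarrow> ('i \<Rightarrow> 'i \<Rightarrow> int) \<Rightarrow> nat" where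
  "matrix_rank I a = fun_space.dim ((\<lambda>i j. if j \<in> I then of_int (a i j) else 0) ` I)"

definition hdual :: "('i, 'h::ab_group_add, 'g) kac_moody_data \<Rightarrow> ('h \<Rightarrow> complex) set" where
  "hdual K = {\<mu>. Vector_Spaces.linear (hscale K) (*) \<mu>}"

definition realization :: "('i, 'h::ab_group_add, 'g) kac_moody_data \<Rightarrow> bool" where
  "realization K \<longleftrightarrow>
     vector_space (hscale K) \<and>
     (\<exists>B. finite B \<and> module.span (hscale K) B = UNIV) \<and>
     vector_space.dim (hscale K) UNIV + matrix_rank (idx K) (cartan K) = 2 * card (idx K) \<and>
     sroot K ` idx K \<subseteq> hdual K \<and>
     inj_on (sroot K) (idx K) \<and> fun_space.independent (sroot K ` idx K) \<and>
     inj_on (scoroot K) (idx K) \<and> \<not> module.dependent (hscale K) (scoroot K ` idx K) \<and>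
     (\<forall>i\<in>idx K. \<forall>j\<in>idx K. sroot K j (scoroot K i) = of_int (cartan K i j))"

definition km_generators :: "('i, 'h, 'g) kac_moody_data \<Rightarrow> ('i, 'h) km_generator set" where
  "km_generators K = range GenH \<union> GenE ` idx K \<union> GenF ` idx K"

text \<open>
  The relations \<open>H_linear\<close> express that the generators \<open>GenH h\<close> form (an image of) the vector
  space \<open>'h\<close>, rather than being independent of each other.
\<close>

inductive_set km_relations ::
    "('i, 'h::ab_group_add, 'g) kac_moody_data \<Rightarrow>
     (('i, 'h) km_generator lie_term \<times> ('i, 'h) km_generator lie_term) set"
  for K
where
  H_linear: "(LGen (GenH (hscale K c h + h')),
              LAdd (LScale c (LGen (GenH h))) (LGen (GenH h'))) \<in> km_relations K"
| HH: "(LBr (LGen (GenH h)) (LGen (GenH h')), LZero) \<in> km_relations K"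
| HE: "i \<in> idx K \<Longrightarrow>
       (LBr (LGen (GenH h)) (LGen (GenE i)), LScale (sroot K i h) (LGen (GenE i)))
         \<in> km_relations K"
| HF: "i \<in> idx K \<Longrightarrow>
       (LBr (LGen (GenH h)) (LGen (GenF i)), LScale (- sroot K i h) (LGen (GenF i)))
         \<in> km_relations K"
| EF: "i \<in> idx K \<Longrightarrow> j \<in> idx K \<Longrightarrow>
       (LBr (LGen (GenE i)) (LGen (GenF j)),
        if i = j then LGen (GenH (scoroot K i)) else LZero) \<in> km_relations K"
| serre_E: "i \<in> idx K \<Longrightarrow> j \<in> idx K \<Longrightarrow> i \<noteq> j \<Longrightarrow>
       ((LBr (LGen (GenE i)) ^^ nat (1 - cartan K i j)) (LGen (GenE j)), LZero)
         \<in> km_relations K"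
| serre_F: "i \<in> idx K \<Longrightarrow> j \<in> idx K \<Longrightarrow> i \<noteq> j \<Longrightarrow>
       ((LBr (LGen (GenF i)) ^^ nat (1 - cartan K i j)) (LGen (GenF j)), LZero)
         \<in> km_relations K"

definition kac_moody_algebra ::
    "('i, 'h::ab_group_add, 'g::ab_group_add) kac_moody_data \<Rightarrow> bool"
where
  "kac_moody_algebra K \<longleftrightarrow>
     finite (idx K) \<and> generalized_cartan_matrix (idx K) (cartan K) \<and> realization K \<and>
     lie_presentation (gscale K) (bracket K) (km_generators K) (km_relations K) (km_gen K)"

definition root_space :: "('i, 'h, 'g::ab_group_add) kac_moody_data \<Rightarrow> ('h \<Rightarrow> complex) \<Rightarrow> 'g set"
where
  "root_space K \<beta> = {x. \<forall>h. bracket K (km_gen K (GenH h)) x = gscale K (\<beta> h) x}"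

definition is_root ::
    "('i, 'h::ab_group_add, 'g::ab_group_add) kac_moody_data \<Rightarrow> ('h \<Rightarrow> complex) \<Rightarrow> bool"
where
  "is_root K \<beta> \<longleftrightarrow> \<beta> \<in> hdual K \<and> \<beta> \<noteq> 0 \<and> root_space K \<beta> \<noteq> {0}"

definition positive_root ::
    "('i, 'h::ab_group_add, 'g::ab_group_add) kac_moody_data \<Rightarrow> ('h \<Rightarrow> complex) \<Rightarrow> bool"
where
  "positive_root K \<beta> \<longleftrightarrow> is_root K \<beta> \<and>
     (\<exists>n :: 'i \<Rightarrow> nat. \<beta> = (\<Sum>i\<in>idx K. fun_scale (of_nat (n i)) (sroot K i)))"

definition negative_root ::
    "('i, 'h::ab_group_add, 'g::ab_group_add) kac_moody_data \<Rightarrow> ('h \<Rightarrow> complex) \<Rightarrow> bool"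
where
  "negative_root K \<beta> \<longleftrightarrow> is_root K \<beta> \<and>
     (\<exists>n :: 'i \<Rightarrow> nat. \<beta> = - (\<Sum>i\<in>idx K. fun_scale (of_nat (n i)) (sroot K i)))"

definition simple_reflection ::
    "('i, 'h, 'g) kac_moody_data \<Rightarrow> 'i \<Rightarrow> ('h \<Rightarrow> complex) \<Rightarrow> 'h \<Rightarrow> complex"
where
  "simple_reflection K i \<mu> = \<mu> - fun_scale (\<mu> (scoroot K i)) (sroot K i)"

text \<open>
  The subgroup \<open>W\<^sub>J\<close> of the Weyl group, as a group of permutations of the dual space of
  \<open>'h\<close>. Elements of \<open>BijGroup S\<close> are extensional functions on \<open>S\<close>, hence the restriction.
\<close>

definition weyl_subgroup ::
    "('i, 'h::ab_group_add, 'g) kac_moody_data \<Rightarrow> 'i set \<Rightarrow> (('h \<Rightarrow> complex) \<Rightarrow> 'h \<Rightarrow> complex) set"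
where
  "weyl_subgroup K J =
     generate (BijGroup (hdual K)) ((\<lambda>i. restrict (simple_reflection K i) (hdual K)) ` J)"

definition integral_idx ::
    "('i, 'h, 'g) kac_moody_data \<Rightarrow> ('h \<Rightarrow> complex) \<Rightarrow> 'i set"
where
  "integral_idx K lam = {i \<in> idx K. lam (scoroot K i) \<in> \<nat>}"


section \<open>Modules\<close>

locale lie_module = L: lie_algebra scale bracket + V: vector_space vscale
  for scale :: "complex \<Rightarrow> 'g::ab_group_add \<Rightarrow> 'g" and bracket :: "'g \<Rightarrow> 'g \<Rightarrow> 'g"
    and vscale :: "complex \<Rightarrow> 'v::ab_group_add \<Rightarrow> 'v" +
  fixes act :: "'g \<Rightarrow> 'v \<Rightarrow> 'v"
  assumes act_linear_right: "\<And>x. Vector_Spaces.linear vscale vscale (act x)"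
    and act_linear_left: "\<And>v. Vector_Spaces.linear scale vscale (\<lambda>x. act x v)"
    and act_bracket: "\<And>x y v. act (bracket x y) v = act x (act y v) - act y (act x v)"

definition lie_submodule ::
    "(complex \<Rightarrow> 'v::ab_group_add \<Rightarrow> 'v) \<Rightarrow> ('g \<Rightarrow> 'v \<Rightarrow> 'v) \<Rightarrow> 'v set \<Rightarrow> bool"
where
  "lie_submodule vscale act N \<longleftrightarrow>
     module.subspace vscale N \<and> (\<forall>x. \<forall>v\<in>N. act x v \<in> N)"

definition simple_lie_module ::
    "(complex \<Rightarrow> 'v::ab_group_add \<Rightarrow> 'v) \<Rightarrow> ('g \<Rightarrow> 'v \<Rightarrow> 'v) \<Rightarrow> bool"
where
  "simple_lie_module vscale act \<longleftrightarrow>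
     (UNIV :: 'v set) \<noteq> {0} \<and>
     (\<forall>N. lie_submodule vscale act N \<longrightarrow> N = {0} \<or> N = UNIV)"

definition weight_space ::
    "('i, 'h, 'g) kac_moody_data \<Rightarrow> (complex \<Rightarrow> 'v \<Rightarrow> 'v) \<Rightarrow> ('g \<Rightarrow> 'v \<Rightarrow> 'v) \<Rightarrow>
     ('h \<Rightarrow> complex) \<Rightarrow> 'v set"
where
  "weight_space K vscale act \<mu> = {v. \<forall>h. act (km_gen K (GenH h)) v = vscale (\<mu> h) v}"

definition highest_weight_module ::
    "('i, 'h, 'g) kac_moody_data \<Rightarrow> (complex \<Rightarrow> 'v::ab_group_add \<Rightarrow> 'v) \<Rightarrow> ('g \<Rightarrow> 'v \<Rightarrow> 'v) \<Rightarrow>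
     ('h \<Rightarrow> complex) \<Rightarrow> bool"
where
  "highest_weight_module K vscale act lam \<longleftrightarrow>
     (\<exists>v. v \<noteq> 0 \<and> v \<in> weight_space K vscale act lam \<and>
        (\<forall>i\<in>idx K. act (km_gen K (GenE i)) v = 0) \<and>
        (\<forall>N. lie_submodule vscale act N \<longrightarrow> v \<in> N \<longrightarrow> N = UNIV))"

text \<open>\<open>vscale\<close> and \<open>act\<close> make \<open>'v\<close> a model of \<open>L(lam)\<close>.\<close>

definition simple_highest_weight_module ::
    "('i, 'h, 'g::ab_group_add) kac_moody_data \<Rightarrow> (complex \<Rightarrow> 'v::ab_group_add \<Rightarrow> 'v) \<Rightarrow>
     ('g \<Rightarrow> 'v \<Rightarrow> 'v) \<Rightarrow> ('h \<Rightarrow> complex) \<Rightarrow> bool"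
where
  "simple_highest_weight_module K vscale act lam \<longleftrightarrow>
     lie_module (gscale K) (bracket K) vscale act \<and>
     simple_lie_module vscale act \<and> highest_weight_module K vscale act lam"


section \<open>Formal sums\<close>

text \<open>
  A formal sum of symbols \<open>e\<^sup>\<mu>\<close> is given by its integer coefficients. As \<open>int\<close> carries the
  discrete topology, \<open>HAS_SUM\<close> on coefficients says that only finitely many summands are
  nonzero and that these add up to the given value.
\<close>

type_synonym 'm formal_sum = "'m \<Rightarrow> int"

definition fexp :: "'m \<Rightarrow> 'm formal_sum" where
  "fexp \<mu> = (\<lambda>\<nu>. of_bool (\<nu> = \<mu>))"

text \<open>
  The coefficient of \<open>e\<^sup>\<mu>\<close> in \<open>\<Prod>i\<in>I. g i\<close> is the sum, over all ways to write \<open>\<mu>\<close> as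
  \<open>\<Sum>i\<in>I. \<nu> i\<close>, of the products of the coefficients of \<open>e\<^sup>\<nu>\<^sup>i\<close> in \<open>g i\<close>.
  It is meaningful if that sum is finite.
\<close>

definition decompositions :: "'i set \<Rightarrow> 'm::comm_monoid_add \<Rightarrow> ('i \<Rightarrow> 'm) set" where
  "decompositions I \<mu> = {\<nu> \<in> I \<rightarrow>\<^sub>E UNIV. (\<Sum>i\<in>I. \<nu> i) = \<mu>}"

definition fprod_defined :: "'i set \<Rightarrow> ('i \<Rightarrow> 'm::comm_monoid_add formal_sum) \<Rightarrow> bool" where
  "fprod_defined I g \<longleftrightarrow> (\<forall>\<mu>. (\<lambda>\<nu>. \<Prod>i\<in>I. g i (\<nu> i)) summable_on decompositions I \<mu>)"

definition fprod :: "'i set \<Rightarrow> ('i \<Rightarrow> 'm::comm_monoid_add formal_sum) \<Rightarrow> 'm formal_sum" where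
  "fprod I g = (\<lambda>\<mu>. \<Sum>\<^sub>\<infinity>\<nu>\<in>decompositions I \<mu>. \<Prod>i\<in>I. g i (\<nu> i))"

text \<open>The highest weight expansion of \<open>1 / (1 - e\<^sup>-\<^sup>\<beta>)\<close> for a root \<open>\<beta>\<close>.\<close>

definition hw_expansion ::
    "('i, 'h::ab_group_add, 'g::ab_group_add) kac_moody_data \<Rightarrow> ('h \<Rightarrow> complex) \<Rightarrow>
     ('h \<Rightarrow> complex) formal_sum"
where
  "hw_expansion K \<beta> = (\<lambda>\<nu>.
     if positive_root K \<beta> then (\<Sum>\<^sub>\<infinity>n::nat. fexp (- fun_scale (of_nat n) \<beta>) \<nu>)
     else if negative_root K \<beta> then - (\<Sum>\<^sub>\<infinity>n\<in>{1::nat..}. fexp (fun_scale (of_nat n) \<beta>) \<nu>)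
     else undefined)"

text \<open>
  The expansion of \<open>w (e\<^sup>lam / (\<Prod>i. 1 - e\<^sup>-\<^sup>\<alpha>\<^sup>i))\<close>; multiplication by \<open>e\<^bsup>w lam\<^esup>\<close> shifts the
  coefficients by \<open>w lam\<close>.
\<close>

definition weyl_summand ::
    "('i, 'h::ab_group_add, 'g::ab_group_add) kac_moody_data \<Rightarrow> ('h \<Rightarrow> complex) \<Rightarrow>
     (('h \<Rightarrow> complex) \<Rightarrow> 'h \<Rightarrow> complex) \<Rightarrow> ('h \<Rightarrow> complex) formal_sum"
where
  "weyl_summand K lam w =
     (\<lambda>\<mu>. fprod (idx K) (\<lambda>i. hw_expansion K (w (sroot K i))) (\<mu> - w lam))"

end

theory Submission
  imports Defs
begin

text \<open>
  Let \<open>J\<close> be the index set of the simple coroots on which \<open>lam\<close> is natural. The set of weights is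
  invariant under \<open>W\<^sub>J\<close> by sl2 theory. So is the sum over \<open>W\<^sub>J\<close>: a reflection \<open>s\<^sub>i\<close> carries the expansion
  of the summand of \<open>w\<close> to that of \<open>s\<^sub>i w\<close> unless some \<open>w \<alpha>\<^sub>j\<close> is \<open>\<plusminus>\<alpha>\<^sub>i\<close>, and then the discrepancies for
  \<open>w\<close> and \<open>s\<^sub>i w\<close> cancel. As both sides are supported below \<open>lam\<close>, it suffices to compare them at
  \<open>J\<close>-dominant \<open>\<mu> \<le> lam\<close>. There only the summand of \<open>w = 1\<close> contributes, with coefficient 1: a
  contribution of another \<open>w\<close> would yield a positive combination \<open>v\<close> of the simple roots made
  negative by \<open>w\<close> such that \<open>-v\<close> is dominant, whence \<open>w v \<ge> v > 0\<close>, contrary to \<open>w v < 0\<close>. And every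
  such \<open>\<mu>\<close> is a weight: a lowest weight above \<open>\<mu>\<close> differs from \<open>\<mu>\<close> by an antidominant positive
  combination, part of which lives on simple roots orthogonal to \<open>lam\<close>; they generate a finite
  group, and its longest element leads to the same contradiction.
\<close>

section \<open>Representations of sl2\<close>

text \<open>Two points shape the development. First, the expansion of 1/(1 - e^(-\<beta>)) is
  \<open>undefined\<close> unless \<beta> is a root, so every w \<alpha>_i has to be shown to be a
  root of definite sign. In a Lie algebra given by generators and relations this includes that
  \<open>E i\<close> is nonzero, which takes a module on which it acts nontrivially; from there sl2
  theory in the adjoint module carries root spaces along reflections. Second, elements of
  \<open>W_J\<close> are handled as words in simple reflections, and the signs of the w \<alpha>_i
  do the work of the length function. All inequalities rest on one fact: if w s_i is reduced, then w
  \<alpha>_i > 0. Hence a reduced word moves dominant elements down and antidominant ones up.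
  Finiteness of the stabilizer enters three times: it bounds the number of w with a given w lam, so
  that the sum converges; it makes an element trivial that fixes all roots; and it provides the
  longest element for the simple roots orthogonal to lam.\<close>

locale sl2_triple = vector_space scale
  for scale :: "complex \<Rightarrow> 'v::ab_group_add \<Rightarrow> 'v" +
  fixes e f h :: "'v \<Rightarrow> 'v"
  assumes linear_e: "Vector_Spaces.linear scale scale e"
    and linear_f: "Vector_Spaces.linear scale scale f"
    and linear_h: "Vector_Spaces.linear scale scale h"
    and e_f: "\<And>x. e (f x) - f (e x) = h x"
    and h_e: "\<And>x. h (e x) - e (h x) = scale 2 (e x)"
    and h_f: "\<And>x. h (f x) - f (h x) = scale (- 2) (f x)"
begin

sublocale e: Vector_Spaces.linear scale scale e by (rule linear_e)
sublocale f: Vector_Spaces.linear scale scale f by (rule linear_f)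
sublocale h: Vector_Spaces.linear scale scale h by (rule linear_h)

text \<open>This symmetry turns a statement on highest weights into one on lowest weights;
  \<open>E_pow_nonzero\<close> is obtained from \<open>f_pow_injective\<close> in this way.\<close>

lemma swap: "sl2_triple scale f e (\<lambda>x. - h x)"
proof (rule sl2_triple.intro[OF vector_space_axioms], rule sl2_triple_axioms.intro)
  show "Vector_Spaces.linear scale scale (\<lambda>x. - h x)"
    by (simp add: Vector_Spaces.linear_iff h.add h.scale scale_minus_right vector_space_axioms)
  fix x
  show "f (e x) - e (f x) = - h x" using e_f[of x] by (simp add: algebra_simps)
  show "- h (f x) - f (- h x) = scale 2 (f x)"
    using h_f[of x] by (simp add: f.neg algebra_simps)
  show "- h (e x) - e (- h x) = scale (- 2) (e x)"
    using h_e[of x] by (simp add: e.neg algebra_simps)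
qed (simp_all add: linear_e linear_f)

lemma h_e_weight: "h x = scale c x \<Longrightarrow> h (e x) = scale (c + 2) (e x)"
  using h_e[of x] by (simp add: e.scale scale_left_distrib algebra_simps)

lemma h_f_weight: "h x = scale c x \<Longrightarrow> h (f x) = scale (c - 2) (f x)"
  using h_f[of x] by (simp add: f.scale scale_left_diff_distrib algebra_simps)

lemma h_f_pow: "h x = scale c x \<Longrightarrow> h ((f ^^ n) x) = scale (c - 2 * of_nat n) ((f ^^ n) x)"
proof (induction n)
  case (Suc n)
  then show ?case
    using h_f_weight[OF Suc.IH] by (simp add: algebra_simps)
qed simp

text \<open>Moving e past n + 1 factors f picks up the h-weights c, c - 2, ..., c - 2n, whose sum is
  the coefficient. The term with \<open>e x\<close> is what the induction in
  \<open>f_pow_injective\<close> runs on.\<close>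

lemma e_f_pow:
  assumes "h x = scale c x"
  shows "e ((f ^^ Suc n) x) = (f ^^ Suc n) (e x) + scale (of_nat (Suc n) * (c - of_nat n)) ((f ^^ n) x)"
proof (induction n)
  case 0
  then show ?case using e_f[of x] assms by (simp add: algebra_simps)
next
  case (Suc n)
  let ?y = "(f ^^ Suc n) x"
  have "e (f ?y) = f (e ?y) + h ?y" using e_f[of ?y] by (simp add: algebra_simps)
  also have "h ?y = scale (c - 2 * of_nat (Suc n)) ?y" by (rule h_f_pow[OF assms])
  also have "f (e ?y) = (f ^^ Suc (Suc n)) (e x) + scale (of_nat (Suc n) * (c - of_nat n)) ?y"
    unfolding Suc.IH by (simp add: f.add f.scale)
  finally have "e ((f ^^ Suc (Suc n)) x) = (f ^^ Suc (Suc n)) (e x)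
      + scale (of_nat (Suc n) * (c - of_nat n) + (c - 2 * of_nat (Suc n))) ?y"
    by (simp add: scale_left_distrib add.assoc)
  also have "of_nat (Suc n) * (c - of_nat n) + (c - 2 * of_nat (Suc n))
      = of_nat (Suc (Suc n)) * (c - of_nat (Suc n))" by (simp add: algebra_simps)
  finally show ?case .
qed

lemma f_pow_zero: "(f ^^ n) 0 = 0"
  by (induction n) simp_all

text \<open>Take the last nonzero (f ^^ k) x: applying e to the next power yields the factor (k +
  1)(c - k), which must vanish.\<close>

lemma highest_weight_nat:
  assumes "e x = 0" "h x = scale c x" "(f ^^ n) x = 0" "x \<noteq> 0"
  shows "\<exists>k<n. c = of_nat k"
  using assms(3)
proof (induction n)
  case (Suc n)
  show ?case
  proof (cases "(f ^^ n) x = 0")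
    case True
    then show ?thesis using Suc.IH less_Suc_eq by blast
  next
    case False
    have "scale (of_nat (Suc n) * (c - of_nat n)) ((f ^^ n) x) = 0"
      using e_f_pow[OF assms(2), of n] Suc.prems assms(1) f_pow_zero[of "Suc n"] by (simp del: funpow.simps)
    then have "c = of_nat n"
      using False by (simp del: of_nat_Suc)
    then show ?thesis by blast
  qed
qed (use assms(4) in simp)

text \<open>Induction on the nilpotency order of e at x: \<open>e x\<close> has weight m + 2 and is
  killed by f ^^ (m + 2), so it vanishes. A nonzero x would then be a highest weight vector of
  weight m killed by f ^^ m, while \<open>highest_weight_nat\<close> puts its weight below
  m.\<close>

lemma f_pow_injective:
  assumes "h x = scale (of_nat m) x" "(e ^^ n) x = 0" "(f ^^ m) x = 0"
  shows "x = 0"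
  using assms
proof (induction n arbitrary: m x)
  case (Suc n)
  have "(f ^^ Suc m) x = 0" using Suc.prems(3) by simp
  \<comment> \<open>The coefficient in \<open>e_f_pow\<close> contains the factor m - m, so only the
    term with \<open>e x\<close> survives.\<close>
  then have "(f ^^ Suc m) (e x) = 0"
    using e_f_pow[OF Suc.prems(1), of m] by (simp del: funpow.simps)
  then have "(f ^^ (m + 2)) (e x) = 0" by simp
  moreover have "h (e x) = scale (of_nat (m + 2)) (e x)"
    using h_e_weight[OF Suc.prems(1)] by (simp add: add.commute)
  moreover have "(e ^^ n) (e x) = 0" using Suc.prems(2) by (simp add: funpow_swap1)
  ultimately have "e x = 0" using Suc.IH by blast
  then show ?case using highest_weight_nat[OF _ Suc.prems(1,3)] by auto
qed simp

end

section \<open>Weight vectors\<close>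

text \<open>Choose h separating \<beta> from one weight \<gamma>0 of the sum. Then
  \<open>T h - \<gamma>0 h\<close> kills that summand and merely rescales the others and y, with a
  nonzero factor for y.\<close>

lemma sum_distinct_weights:
  fixes T :: "'h \<Rightarrow> 'v::ab_group_add \<Rightarrow> 'v" and scale :: "complex \<Rightarrow> 'v \<Rightarrow> 'v"
  assumes T: "\<And>h. Vector_Spaces.linear scale scale (T h)"
    and "finite S" "\<beta> \<notin> S"
    and "\<And>\<gamma> h. \<gamma> \<in> S \<Longrightarrow> T h (x \<gamma>) = scale (\<gamma> h) (x \<gamma>)"
    and "\<And>h. T h y = scale (\<beta> h) y" "y = (\<Sum>\<gamma>\<in>S. x \<gamma>)"
  shows "y = 0"
  using assms(2-)
proof (induction S arbitrary: x y rule: finite_induct)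
  case (insert \<gamma>0 S)
  interpret vector_space scale using T[unfolded Vector_Spaces.linear_iff] by simp
  from insert.prems(1) obtain h where h: "\<beta> h \<noteq> \<gamma>0 h" by (metis ext insertI1)
  interpret T: Vector_Spaces.linear scale scale "T h" by (rule T)
  define x' where "x' \<gamma> = scale (\<gamma> h - \<gamma>0 h) (x \<gamma>)" for \<gamma>
  have "scale (\<beta> h - \<gamma>0 h) y = T h y - scale (\<gamma>0 h) y"
    by (simp add: insert.prems(3) scale_left_diff_distrib)
  also have "\<dots> = (\<Sum>\<gamma>\<in>insert \<gamma>0 S. T h (x \<gamma>) - scale (\<gamma>0 h) (x \<gamma>))"
    unfolding insert.prems(4) by (simp only: T.sum scale_sum_right sum_subtractf)
  also have "\<dots> = (\<Sum>\<gamma>\<in>insert \<gamma>0 S. x' \<gamma>)"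
  proof (rule sum.cong[OF HOL.refl])
    fix \<gamma> assume "\<gamma> \<in> insert \<gamma>0 S"
    then have "T h (x \<gamma>) = scale (\<gamma> h) (x \<gamma>)" by (rule insert.prems(2))
    then show "T h (x \<gamma>) - scale (\<gamma>0 h) (x \<gamma>) = x' \<gamma>"
      by (simp add: x'_def scale_left_diff_distrib)
  qed
  also have "\<dots> = (\<Sum>\<gamma>\<in>S. x' \<gamma>)" using insert.hyps by (simp add: x'_def)
  finally have "scale (\<beta> h - \<gamma>0 h) y = (\<Sum>\<gamma>\<in>S. x' \<gamma>)" .
  moreover have "T k (x' \<gamma>) = scale (\<gamma> k) (x' \<gamma>)" if "\<gamma> \<in> S" for \<gamma> k
  proof -
    interpret Tk: Vector_Spaces.linear scale scale "T k" by (rule T)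
    show ?thesis using insert.prems(2)[of \<gamma> k] that by (simp add: x'_def Tk.scale mult.commute)
  qed
  moreover have "T k (scale (\<beta> h - \<gamma>0 h) y) = scale (\<beta> k) (scale (\<beta> h - \<gamma>0 h) y)" for k
  proof -
    interpret Tk: Vector_Spaces.linear scale scale "T k" by (rule T)
    show ?thesis using insert.prems(3)[of k] by (simp add: Tk.scale mult.commute)
  qed
  ultimately have "scale (\<beta> h - \<gamma>0 h) y = 0" using insert.IH insert.prems(1) by blast
  then show ?case using h by simp
qed simp

text \<open>This is how weights are bounded throughout: roots through iterated brackets, weights of
  a highest weight module through words in the \<open>F i\<close>. Terms of equal weight are
  collected, and \<open>sum_distinct_weights\<close> excludes any weight that does not occur among
  them.\<close>

lemma weight_in_spanning_set:
  fixes T :: "'h \<Rightarrow> 'v::ab_group_add \<Rightarrow> 'v" and scale :: "complex \<Rightarrow> 'v \<Rightarrow> 'v"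
  assumes T: "\<And>h. Vector_Spaces.linear scale scale (T h)"
    and gen: "\<And>b. b \<in> B \<Longrightarrow> \<exists>\<gamma>\<in>S. \<forall>h. T h b = scale (\<gamma> h) b"
    and x: "x \<in> module.span scale B" "x \<noteq> 0" "\<And>h. T h x = scale (\<beta> h) x"
  shows "\<beta> \<in> S"
proof (rule ccontr)
  assume \<beta>: "\<beta> \<notin> S"
  interpret vector_space scale using T[unfolded Vector_Spaces.linear_iff] by simp
  from x(1) obtain t r where t: "finite t" "t \<subseteq> B" and xt: "x = (\<Sum>b\<in>t. scale (r b) b)"
    unfolding span_explicit by blast
  from gen t(2) have "\<forall>b\<in>t. \<exists>\<gamma>. \<gamma> \<in> S \<and> (\<forall>h. T h b = scale (\<gamma> h) b)" by blast
  then obtain g where g: "\<And>b. b \<in> t \<Longrightarrow> g b \<in> S" "\<And>b h. b \<in> t \<Longrightarrow> T h b = scale (g b h) b"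
    by metis
  define X where "X \<gamma> = (\<Sum>b\<in>{b\<in>t. g b = \<gamma>}. scale (r b) b)" for \<gamma>
  have "x = 0"
  proof (rule sum_distinct_weights[OF T, where S = "g ` t" and x = X and \<beta> = \<beta>])
    show "x = (\<Sum>\<gamma>\<in>g ` t. X \<gamma>)"
      unfolding xt X_def using t(1) by (rule sum.image_gen)
    fix \<gamma> h
    interpret Th: Vector_Spaces.linear scale scale "T h" by (rule T)
    show "T h (X \<gamma>) = scale (\<gamma> h) (X \<gamma>)"
      unfolding X_def Th.sum scale_sum_right
      by (intro sum.cong HOL.refl) (auto simp: Th.scale g(2) mult.commute)
  qed (use t x \<beta> g in auto)
  with x(2) show False by simp
qed

section \<open>Lie algebras and their modules\<close>

context lie_algebra
begin

lemma bracket_simps [simp]: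
  "bracket x (y + z) = bracket x y + bracket x z"
  "bracket (x + y) z = bracket x z + bracket y z"
  "bracket x (y - z) = bracket x y - bracket x z"
  "bracket (x - y) z = bracket x z - bracket y z"
  "bracket x (- y) = - bracket x y"
  "bracket (- x) y = - bracket x y"
  "bracket x (scale c y) = scale c (bracket x y)"
  "bracket (scale c x) y = scale c (bracket x y)"
  "bracket x 0 = 0"
  "bracket 0 y = 0"
proof -
  interpret r: Vector_Spaces.linear scale scale "bracket x" by (rule linear_right)
  show "bracket x (y + z) = bracket x y + bracket x z" "bracket x (y - z) = bracket x y - bracket x z"
    "bracket x (- y) = - bracket x y" "bracket x (scale c y) = scale c (bracket x y)" "bracket x 0 = 0"
    by (simp_all add: r.add r.diff r.neg r.scale)
next
  interpret l: Vector_Spaces.linear scale scale "\<lambda>x. bracket x z" for z by (rule linear_left)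
  show "bracket (x + y) z = bracket x z + bracket y z" "bracket (x - y) z = bracket x z - bracket y z"
    "bracket (- x) y = - bracket x y" "bracket (scale c x) y = scale c (bracket x y)" "bracket 0 y = 0"
    using l.add l.diff l.neg l.scale l.zero by simp_all
qed

lemma bracket_commute: "bracket x y = - bracket y x"
  using alternating[of "x + y"] alternating[of x] alternating[of y]
  by (simp add: eq_neg_iff_add_eq_0 add.commute)

lemma bracket_bracket: "bracket (bracket x y) z = bracket x (bracket y z) - bracket y (bracket x z)"
  using local.jacobi[of x y z] bracket_commute[of z "bracket x y"] bracket_commute[of z x]
  by (simp add: algebra_simps add_eq_0_iff2)

lemma adjoint_module: "lie_module scale bracket scale bracket"
  by (intro lie_module.intro lie_module_axioms.intro lie_algebra_axioms vector_space_axioms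
      linear_left linear_right bracket_bracket)

end

context lie_module
begin

lemma act_simps [simp]:
  "act x (v + w) = act x v + act x w"
  "act (x + y) v = act x v + act y v"
  "act x (v - w) = act x v - act x w"
  "act (x - y) v = act x v - act y v"
  "act x (- v) = - act x v"
  "act (- x) v = - act x v"
  "act x (vscale c v) = vscale c (act x v)"
  "act (scale c x) v = vscale c (act x v)"
  "act x 0 = 0"
  "act 0 v = 0"
proof -
  interpret r: Vector_Spaces.linear vscale vscale "act x" by (rule act_linear_right)
  show "act x (v + w) = act x v + act x w" "act x (v - w) = act x v - act x w"
    "act x (- v) = - act x v" "act x (vscale c v) = vscale c (act x v)" "act x 0 = 0"
    by (simp_all add: r.add r.diff r.neg r.scale)
next
  interpret l: Vector_Spaces.linear scale vscale "\<lambda>x. act x v" by (rule act_linear_left)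
  show "act (x + y) v = act x v + act y v" "act (x - y) v = act x v - act y v"
    "act (- x) v = - act x v" "act (scale c x) v = vscale c (act x v)" "act 0 v = 0"
    using l.add l.diff l.neg l.scale l.zero by simp_all
qed

lemma act_commute: "act x (act y v) = act y (act x v) + act (bracket x y) v"
  by (simp add: act_bracket)

lemma act_pow_zero: "(act x ^^ n) 0 = 0"
  by (induction n) simp_all

lemma act_pow_add: "(act x ^^ n) (v + w) = (act x ^^ n) v + (act x ^^ n) w"
  by (induction n) simp_all

lemma act_pow_scale: "(act x ^^ n) (vscale c v) = vscale c ((act x ^^ n) v)"
  by (induction n) simp_all

lemma act_pow_mono: "(act x ^^ n) v = 0 \<Longrightarrow> n \<le> m \<Longrightarrow> (act x ^^ m) v = 0"
  by (metis act_pow_zero add.commute funpow_add le_add_diff_inverse comp_apply)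

text \<open>As x (y v) = [x, y] v + y (x v), each application of x uses up one unit of n or of m;
  induction on n + m replaces the binomial formula.\<close>

lemma act_pow_leibniz:
  "(bracket x ^^ n) y = 0 \<Longrightarrow> (act x ^^ m) v = 0 \<Longrightarrow> (act x ^^ (n + m)) (act y v) = 0"
proof (induction "n + m" arbitrary: n m y v)
  case (Suc k)
  show ?case
  proof (cases "n = 0 \<or> m = 0")
    case True
    then show ?thesis using Suc.prems act_pow_zero by auto
  next
    case False
    then obtain n' m' where nm: "n = Suc n'" "m = Suc m'" by (meson not0_implies_Suc)
    have "(act x ^^ k) (act (bracket x y) v) = 0"
      using Suc.hyps(1)[of n' m "bracket x y" v] Suc.prems Suc.hyps(2) nm by (simp add: funpow_swap1)
    moreover have "(act x ^^ k) (act y (act x v)) = 0"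
      using Suc.hyps(1)[of n m' y "act x v"] Suc.prems Suc.hyps(2) nm by (simp add: funpow_swap1)
    moreover have "(act x ^^ (n + m)) (act y v) = (act x ^^ k) (act x (act y v))"
      unfolding Suc.hyps(2)[symmetric] by (simp add: funpow_swap1)
    ultimately show ?thesis using act_commute[of x y v] act_pow_add by simp
  qed
qed simp

text \<open>In a simple module this submodule is zero or everything, so a single vector decides
  between injectivity and local nilpotency of x.\<close>

lemma nilpotent_submodule:
  assumes "\<And>y. \<exists>n. (bracket x ^^ n) y = 0"
  shows "lie_submodule vscale act {v. \<exists>n. (act x ^^ n) v = 0}"
  unfolding lie_submodule_def
proof
  show "V.subspace {v. \<exists>n. (act x ^^ n) v = 0}"
  proof (rule V.subspaceI)
    fix v w assume "v \<in> {v. \<exists>n. (act x ^^ n) v = 0}" "w \<in> {v. \<exists>n. (act x ^^ n) v = 0}"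
    then obtain n m where "(act x ^^ n) v = 0" "(act x ^^ m) w = 0" by blast
    then have "(act x ^^ (n + m)) (v + w) = 0"
      using act_pow_mono[of n x v "n + m"] act_pow_mono[of m x w "n + m"] by (simp add: act_pow_add)
    then show "v + w \<in> {v. \<exists>n. (act x ^^ n) v = 0}" by blast
  next
    fix c v assume "v \<in> {v. \<exists>n. (act x ^^ n) v = 0}"
    then obtain n where "(act x ^^ n) v = 0" by blast
    then have "(act x ^^ n) (vscale c v) = 0" by (simp add: act_pow_scale)
    then show "vscale c v \<in> {v. \<exists>n. (act x ^^ n) v = 0}" by blast
  qed (auto intro: exI[of _ 0])
  show "\<forall>y. \<forall>v\<in>{v. \<exists>n. (act x ^^ n) v = 0}. act y v \<in> {v. \<exists>n. (act x ^^ n) v = 0}"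
    using assms act_pow_leibniz by blast
qed

end

section \<open>The structure of Kac--Moody algebras\<close>

lemma lie_gens_bracket_pow: "lie_gens ((LBr t ^^ n) u) \<subseteq> lie_gens t \<union> lie_gens u"
  by (induction n) auto

lemma lie_eval_bracket_pow:
  "lie_eval sc br \<phi> ((LBr t ^^ n) u) = (br (lie_eval sc br \<phi> t) ^^ n) (lie_eval sc br \<phi> u)"
  by (induction n) auto

locale kac_moody =
  fixes K :: "('i, 'h::ab_group_add, 'g::ab_group_add) kac_moody_data"
  assumes kac_moody: "kac_moody_algebra K"
begin

abbreviation "I \<equiv> idx K"
abbreviation "a \<equiv> cartan K"
abbreviation "\<alpha> \<equiv> sroot K"
abbreviation "\<alpha>c \<equiv> scoroot K"
abbreviation "H h \<equiv> km_gen K (GenH h)"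
abbreviation "E i \<equiv> km_gen K (GenE i)"
abbreviation "F i \<equiv> km_gen K (GenF i)"
abbreviation "s \<equiv> simple_reflection K"

lemma finite_I [simp]: "finite I"
  and gcm: "generalized_cartan_matrix I a"
  and real: "realization K"
  and presentation: "lie_presentation (gscale K) (bracket K) (km_generators K) (km_relations K) (km_gen K)"
  using kac_moody by (simp_all add: kac_moody_algebra_def)

sublocale g: lie_algebra "gscale K" "bracket K"
  using presentation by (simp add: lie_presentation_def)

sublocale hspace: vector_space "hscale K"
  using real by (simp add: realization_def)

lemma cartan_diag: "i \<in> I \<Longrightarrow> a i i = 2"
  and cartan_nonpos: "i \<in> I \<Longrightarrow> j \<in> I \<Longrightarrow> i \<noteq> j \<Longrightarrow> a i j \<le> 0"
  and cartan_zero: "i \<in> I \<Longrightarrow> j \<in> I \<Longrightarrow> a i j = 0 \<Longrightarrow> a j i = 0"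
  using gcm by (auto simp: generalized_cartan_matrix_def)

lemma pairing: "i \<in> I \<Longrightarrow> j \<in> I \<Longrightarrow> \<alpha> j (\<alpha>c i) = of_int (a i j)"
  and root_hdual [simp]: "i \<in> I \<Longrightarrow> \<alpha> i \<in> hdual K"
  using real by (auto simp: realization_def)

lemma pairing_diag [simp]: "i \<in> I \<Longrightarrow> \<alpha> i (\<alpha>c i) = 2"
  by (simp add: pairing cartan_diag)

lemma relation_holds:
  assumes "(t, u) \<in> km_relations K" "lie_gens t \<subseteq> km_generators K" "lie_gens u \<subseteq> km_generators K"
  shows "lie_eval (gscale K) (bracket K) (km_gen K) t = lie_eval (gscale K) (bracket K) (km_gen K) u"
  using presentation assms lie_cong.rel[OF assms(1)] unfolding lie_presentation_def by blast

lemma H_linear: "H (hscale K c h + h') = gscale K c (H h) + H h'"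
  using relation_holds[OF km_relations.H_linear] by (simp add: km_generators_def)

lemma H_H: "bracket K (H h) (H h') = 0"
  using relation_holds[OF km_relations.HH] by (simp add: km_generators_def)

lemma H_E: "i \<in> I \<Longrightarrow> bracket K (H h) (E i) = gscale K (\<alpha> i h) (E i)"
  using relation_holds[OF km_relations.HE] by (simp add: km_generators_def)

lemma H_F: "i \<in> I \<Longrightarrow> bracket K (H h) (F i) = gscale K (- \<alpha> i h) (F i)"
  using relation_holds[OF km_relations.HF] by (simp add: km_generators_def)

lemma E_F: "i \<in> I \<Longrightarrow> j \<in> I \<Longrightarrow> bracket K (E i) (F j) = (if i = j then H (\<alpha>c i) else 0)"
  using relation_holds[OF km_relations.EF, of i j] by (simp add: km_generators_def split: if_splits)

lemma serre_E:
  assumes "i \<in> I" "j \<in> I" "i \<noteq> j"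
  shows "(bracket K (E i) ^^ nat (1 - a i j)) (E j) = 0"
  using relation_holds[OF km_relations.serre_E[OF assms]] assms
    lie_gens_bracket_pow[of "nat (1 - a i j)" "LGen (GenE i)" "LGen (GenE j)"]
  by (force simp: km_generators_def lie_eval_bracket_pow)

lemma serre_F:
  assumes "i \<in> I" "j \<in> I" "i \<noteq> j"
  shows "(bracket K (F i) ^^ nat (1 - a i j)) (F j) = 0"
  using relation_holds[OF km_relations.serre_F[OF assms]] assms
    lie_gens_bracket_pow[of "nat (1 - a i j)" "LGen (GenF i)" "LGen (GenF j)"]
  by (force simp: km_generators_def lie_eval_bracket_pow)

lemma H_0 [simp]: "H 0 = 0"
  using H_linear[of 1 0 0] by simp

lemma H_scale: "H (hscale K c h) = gscale K c (H h)"
  using H_linear[of c h 0] by simp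

lemma H_minus: "H (- h) = - H h"
  using H_scale[of "- 1" h] by simp

lemma g_induct [case_names H E F zero add scale bracket]:
  assumes "\<And>h. P (H h)" "\<And>i. i \<in> I \<Longrightarrow> P (E i)" "\<And>i. i \<in> I \<Longrightarrow> P (F i)" "P 0"
    and "\<And>x y. P x \<Longrightarrow> P y \<Longrightarrow> P (x + y)" "\<And>c x. P x \<Longrightarrow> P (gscale K c x)"
    and "\<And>x y. P x \<Longrightarrow> P y \<Longrightarrow> P (bracket K x y)"
  shows "P x"
proof -
  have "lie_gens t \<subseteq> km_generators K \<Longrightarrow> P (lie_eval (gscale K) (bracket K) (km_gen K) t)" for t
    by (induction t) (use assms in \<open>auto simp: km_generators_def\<close>)
  moreover obtain t where "lie_gens t \<subseteq> km_generators K" "lie_eval (gscale K) (bracket K) (km_gen K) t = x"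
    using presentation unfolding lie_presentation_def by blast
  ultimately show ?thesis by blast
qed

end

locale km_module = kac_moody K + lie_module "gscale K" "bracket K" vscale act
  for K :: "('i, 'h::ab_group_add, 'g::ab_group_add) kac_moody_data"
    and vscale :: "complex \<Rightarrow> 'v::ab_group_add \<Rightarrow> 'v" and act
begin

abbreviation "wt \<equiv> weight_space K vscale act"

lemma wt_iff: "v \<in> wt \<mu> \<longleftrightarrow> (\<forall>h. act (H h) v = vscale (\<mu> h) v)"
  by (simp add: weight_space_def)

lemma wt_E: "i \<in> I \<Longrightarrow> v \<in> wt \<mu> \<Longrightarrow> act (E i) v \<in> wt (\<mu> + \<alpha> i)"
  by (simp add: wt_iff act_commute[of "H _" "E i"] H_E V.scale_left_distrib)

lemma wt_F: "i \<in> I \<Longrightarrow> v \<in> wt \<mu> \<Longrightarrow> act (F i) v \<in> wt (\<mu> - \<alpha> i)"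
  by (simp add: wt_iff act_commute[of "H _" "F i"] H_F V.scale_left_diff_distrib)

lemma wt_E_pow: "i \<in> I \<Longrightarrow> v \<in> wt \<mu> \<Longrightarrow> (act (E i) ^^ n) v \<in> wt (\<mu> + fun_scale (of_nat n) (\<alpha> i))"
proof (induction n)
  case (Suc n)
  have "\<mu> + fun_scale (of_nat n) (\<alpha> i) + \<alpha> i = \<mu> + fun_scale (of_nat (Suc n)) (\<alpha> i)"
    by (simp add: fun_scale_def fun_eq_iff algebra_simps)
  then show ?case using wt_E[OF Suc.prems(1) Suc.IH[OF Suc.prems]] by (simp only: funpow.simps comp_apply)
qed (simp add: fun_scale_def plus_fun_def)

lemma wt_F_pow: "i \<in> I \<Longrightarrow> v \<in> wt \<mu> \<Longrightarrow> (act (F i) ^^ n) v \<in> wt (\<mu> - fun_scale (of_nat n) (\<alpha> i))"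
proof (induction n)
  case (Suc n)
  have "\<mu> - fun_scale (of_nat n) (\<alpha> i) - \<alpha> i = \<mu> - fun_scale (of_nat (Suc n)) (\<alpha> i)"
    by (simp add: fun_scale_def fun_eq_iff algebra_simps)
  then show ?case using wt_F[OF Suc.prems(1) Suc.IH[OF Suc.prems]] by (simp only: funpow.simps comp_apply)
qed (simp add: fun_scale_def fun_diff_def)

lemma zero_in_wt [simp]: "0 \<in> wt \<mu>"
  by (simp add: wt_iff)

lemma sl2: "i \<in> I \<Longrightarrow> sl2_triple vscale (act (E i)) (act (F i)) (act (H (\<alpha>c i)))"
proof (rule sl2_triple.intro[OF V.vector_space_axioms], rule sl2_triple_axioms.intro)
  fix v assume i: "i \<in> I"
  show "act (E i) (act (F i) v) - act (F i) (act (E i) v) = act (H (\<alpha>c i)) v"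
    using i by (simp add: act_commute[of "E i" "F i"] E_F)
  show "act (H (\<alpha>c i)) (act (E i) v) - act (E i) (act (H (\<alpha>c i)) v) = vscale 2 (act (E i) v)"
    using i by (simp add: act_commute[of "H _" "E i"] H_E)
  show "act (H (\<alpha>c i)) (act (F i) v) - act (F i) (act (H (\<alpha>c i)) v) = vscale (-2) (act (F i) v)"
    using i by (simp add: act_commute[of "H _" "F i"] H_F)
qed (rule act_linear_right)+

lemma F_pow_nonzero:
  assumes "i \<in> I" "v \<in> wt \<mu>" "v \<noteq> 0" "\<mu> (\<alpha>c i) = of_nat m" "(act (E i) ^^ n) v = 0"
  shows "(act (F i) ^^ m) v \<noteq> 0"
  using sl2_triple.f_pow_injective[OF sl2[OF assms(1)], where x = v and m = m and n = n] assms by (auto simp: wt_iff)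

lemma E_pow_nonzero:
  assumes "i \<in> I" "v \<in> wt \<mu>" "v \<noteq> 0" "\<mu> (\<alpha>c i) = - of_nat m" "(act (F i) ^^ n) v = 0"
  shows "(act (E i) ^^ m) v \<noteq> 0"
  using sl2_triple.f_pow_injective[OF sl2_triple.swap[OF sl2[OF assms(1)]], where x = v and m = m and n = n] assms
  by (auto simp: wt_iff)

text \<open>The pairing m with the coroot is the sl2 weight of v. The power F^m, or E^(-m) for
  negative m, leads to the weight \<open>s i \<mu>\<close> and does not kill v.\<close>

lemma wt_reflect:
  assumes i: "i \<in> I" and v: "v \<in> wt \<mu>" "v \<noteq> 0" and m: "\<mu> (\<alpha>c i) = of_int m"
    and nil: "(act (E i) ^^ n) v = 0" "(act (F i) ^^ k) v = 0"
  shows "wt (s i \<mu>) \<noteq> {0}"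
proof (cases "m \<ge> 0")
  case True
  then have "\<mu> (\<alpha>c i) = of_nat (nat m)" using m by simp
  then have "(act (F i) ^^ nat m) v \<noteq> 0" using F_pow_nonzero i v nil by blast
  moreover have "(act (F i) ^^ nat m) v \<in> wt (s i \<mu>)"
    using wt_F_pow[OF i v(1), of "nat m"] True m by (simp add: simple_reflection_def)
  ultimately show ?thesis by blast
next
  case False
  then have "\<mu> (\<alpha>c i) = - of_nat (nat (- m))" using m by simp
  then have "(act (E i) ^^ nat (- m)) v \<noteq> 0" using E_pow_nonzero i v nil by blast
  moreover have "\<mu> + fun_scale (of_nat (nat (- m))) (\<alpha> i) = s i \<mu>"
    using False m by (simp add: simple_reflection_def fun_scale_def fun_eq_iff)
  then have "(act (E i) ^^ nat (- m)) v \<in> wt (s i \<mu>)"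
    using wt_E_pow[OF i v(1), of "nat (- m)"] by simp
  ultimately show ?thesis by blast
qed

lemma submoduleI:
  assumes N: "V.subspace N"
    and "\<And>h v. v \<in> N \<Longrightarrow> act (H h) v \<in> N"
    and "\<And>i v. i \<in> I \<Longrightarrow> v \<in> N \<Longrightarrow> act (E i) v \<in> N"
    and "\<And>i v. i \<in> I \<Longrightarrow> v \<in> N \<Longrightarrow> act (F i) v \<in> N"
  shows "lie_submodule vscale act N"
proof -
  have "\<forall>v\<in>N. act x v \<in> N" for x
    by (induction x rule: g_induct)
      (use assms in \<open>auto simp: act_bracket intro: V.subspace_add V.subspace_scale V.subspace_diff V.subspace_0\<close>)
  with N show ?thesis by (simp add: lie_submodule_def)
qed

end

context kac_moody
begin

sublocale ad: km_module K "gscale K" "bracket K"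
  by (intro km_module.intro kac_moody_axioms g.adjoint_module)

lemma root_space_eq: "root_space K = ad.wt"
  by (auto simp: root_space_def weight_space_def fun_eq_iff)

text \<open>By the Leibniz rule the elements killed by a power of ad x form a subalgebra, so the
  generators decide.\<close>

lemma ad_nilpotent:
  assumes "\<And>h. \<exists>n. (bracket K x ^^ n) (H h) = 0"
    and "\<And>i. i \<in> I \<Longrightarrow> \<exists>n. (bracket K x ^^ n) (E i) = 0"
    and "\<And>i. i \<in> I \<Longrightarrow> \<exists>n. (bracket K x ^^ n) (F i) = 0"
  shows "\<exists>n. (bracket K x ^^ n) y = 0"
proof (induction y rule: g_induct)
  case (add y z)
  then obtain n m where "(bracket K x ^^ n) y = 0" "(bracket K x ^^ m) z = 0" by blast
  then have "(bracket K x ^^ (n + m)) (y + z) = 0"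
    using ad.act_pow_mono[of n x y "n + m"] ad.act_pow_mono[of m x z "n + m"]
    by (simp add: ad.act_pow_add)
  then show ?case by blast
next
  case (scale c y)
  then show ?case by (metis ad.act_pow_scale g.scale_zero_right)
next
  case (bracket y z)
  then show ?case using ad.act_pow_leibniz by blast
qed (use assms in \<open>auto intro: exI[of _ 0]\<close>)

lemma E_ad_nilpotent: "i \<in> I \<Longrightarrow> \<exists>n. (bracket K (E i) ^^ n) y = 0"
proof (rule ad_nilpotent)
  assume i: "i \<in> I"
  have *: "bracket K (E i) (H h) = gscale K (- \<alpha> i h) (E i)" for h
    using g.bracket_commute[of "E i" "H h"] H_E[OF i] by simp
  show "\<exists>n. (bracket K (E i) ^^ n) (H h) = 0" for h
    by (rule exI[of _ 2]) (simp add: numeral_2_eq_2 * g.alternating)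
  show "\<exists>n. (bracket K (E i) ^^ n) (E j) = 0" if "j \<in> I" for j
  proof (cases "i = j")
    case True
    then show ?thesis by (intro exI[of _ 1]) (simp add: g.alternating)
  qed (use serre_E i that in blast)
  \<comment> \<open>For i = j the string is \<open>F i\<close>, \<open>H (\<alpha>c i)\<close>, a
    multiple of \<open>E i\<close>, 0.\<close>
  show "\<exists>n. (bracket K (E i) ^^ n) (F j) = 0" if "j \<in> I" for j
    by (rule exI[of _ 3]) (use i that * in \<open>auto simp: numeral_3_eq_3 E_F g.alternating\<close>)
qed

lemma F_ad_nilpotent: "i \<in> I \<Longrightarrow> \<exists>n. (bracket K (F i) ^^ n) y = 0"
proof (rule ad_nilpotent)
  assume i: "i \<in> I"
  have *: "bracket K (F i) (H h) = gscale K (\<alpha> i h) (F i)" for h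
    using g.bracket_commute[of "F i" "H h"] H_F[OF i] by simp
  show "\<exists>n. (bracket K (F i) ^^ n) (H h) = 0" for h
    by (rule exI[of _ 2]) (simp add: numeral_2_eq_2 * g.alternating)
  show "\<exists>n. (bracket K (F i) ^^ n) (F j) = 0" if "j \<in> I" for j
  proof (cases "i = j")
    case True
    then show ?thesis by (intro exI[of _ 1]) (simp add: g.alternating)
  qed (use serre_F i that in blast)
  show "\<exists>n. (bracket K (F i) ^^ n) (E j) = 0" if "j \<in> I" for j
    by (rule exI[of _ 3])
      (use i that * g.bracket_commute[of "F i" "E j"] in \<open>auto simp: numeral_3_eq_3 E_F g.alternating\<close>)
qed

end

section \<open>The root lattice and roots\<close>

lemma sum_fun_apply: "(\<Sum>i\<in>A. f i) x = (\<Sum>i\<in>A. f i x)" for f :: "'b \<Rightarrow> 'c \<Rightarrow> 'd::comm_monoid_add"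
  by (induction A rule: infinite_finite_induct) auto

context kac_moody
begin

definition root_comb :: "('i \<Rightarrow> int) \<Rightarrow> 'h \<Rightarrow> complex" where
  "root_comb z = (\<Sum>i\<in>I. fun_scale (of_int (z i)) (\<alpha> i))"

text \<open>The positive part of the root lattice, zero included. The order \<mu> \<le> lam on
  weights always appears as \<open>lam - \<mu> \<in> pos_cone\<close>.\<close>

definition pos_cone :: "('h \<Rightarrow> complex) set" where
  "pos_cone = {root_comb z |z. \<forall>i\<in>I. z i \<ge> 0}"

lemma root_comb_apply: "root_comb z h = (\<Sum>i\<in>I. of_int (z i) * \<alpha> i h)"
  by (simp add: root_comb_def sum_fun_apply fun_scale_def)

lemma root_comb_add: "root_comb z + root_comb z' = root_comb (\<lambda>i. z i + z' i)"
  and root_comb_diff: "root_comb z - root_comb z' = root_comb (\<lambda>i. z i - z' i)"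
  and root_comb_minus: "- root_comb z = root_comb (\<lambda>i. - z i)"
  and root_comb_scale: "fun_scale (of_int c) (root_comb z) = root_comb (\<lambda>i. c * z i)"
  by (auto simp: fun_eq_iff root_comb_apply fun_scale_def algebra_simps sum.distrib sum_subtractf
      sum_negf sum_distrib_left)

lemma root_comb_0 [simp]: "root_comb (\<lambda>i. 0) = 0"
  by (simp add: fun_eq_iff root_comb_apply)

lemma root_comb_unit: "k \<in> I \<Longrightarrow> root_comb (\<lambda>i. of_bool (i = k)) = \<alpha> k"
  by (simp add: fun_eq_iff root_comb_apply if_distrib of_bool_def if_distribR cong: if_cong)

lemma root_comb_cong: "(\<And>i. i \<in> I \<Longrightarrow> z i = z' i) \<Longrightarrow> root_comb z = root_comb z'"
  unfolding root_comb_def by (rule sum.cong) auto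

lemma roots_independent:
  assumes "(\<Sum>i\<in>I. fun_scale (c i) (\<alpha> i)) = 0" "k \<in> I"
  shows "c k = 0"
proof -
  have inj: "inj_on \<alpha> I" and ind: "fun_space.independent (\<alpha> ` I)"
    using real by (auto simp: realization_def)
  have "(\<Sum>v\<in>\<alpha> ` I. fun_scale (c (inv_into I \<alpha> v)) v) = 0"
    using assms(1) inj by (simp add: sum.reindex)
  then have "c (inv_into I \<alpha> (\<alpha> k)) = 0"
    using fun_space.independentD[OF ind, of "\<alpha> ` I" "\<lambda>v. c (inv_into I \<alpha> v)"] assms(2) by simp
  then show ?thesis using inj assms(2) by simp
qed

lemma root_comb_inject: "root_comb z = root_comb z' \<longleftrightarrow> (\<forall>i\<in>I. z i = z' i)"
proof
  assume "root_comb z = root_comb z'"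
  then have "root_comb (\<lambda>i. z i - z' i) = 0" by (simp add: root_comb_diff[symmetric])
  then show "\<forall>i\<in>I. z i = z' i"
    using roots_independent[of "\<lambda>i. of_int (z i - z' i)"] by (auto simp: root_comb_def)
qed (auto intro: root_comb_cong)

lemma root_comb_eq_0: "root_comb z = 0 \<longleftrightarrow> (\<forall>i\<in>I. z i = 0)"
  using root_comb_inject[of z "\<lambda>i. 0"] by simp

lemma root_comb_in_pos_cone: "root_comb z \<in> pos_cone \<longleftrightarrow> (\<forall>i\<in>I. z i \<ge> 0)"
  by (auto simp: pos_cone_def root_comb_inject)

lemma minus_root_comb_in_pos_cone: "- root_comb z \<in> pos_cone \<longleftrightarrow> (\<forall>i\<in>I. z i \<le> 0)"
  by (auto simp: root_comb_minus root_comb_in_pos_cone)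

lemma zero_in_pos_cone [simp]: "0 \<in> pos_cone"
  using root_comb_in_pos_cone[of "\<lambda>i. 0"] by simp

lemma root_in_pos_cone: "i \<in> I \<Longrightarrow> \<alpha> i \<in> pos_cone"
  using root_comb_in_pos_cone[of "\<lambda>k. of_bool (k = i)"] by (simp add: root_comb_unit)

lemma pos_cone_add: "\<beta> \<in> pos_cone \<Longrightarrow> \<gamma> \<in> pos_cone \<Longrightarrow> \<beta> + \<gamma> \<in> pos_cone"
proof -
  assume "\<beta> \<in> pos_cone" "\<gamma> \<in> pos_cone"
  then obtain z z' where "\<beta> = root_comb z" "\<forall>i\<in>I. z i \<ge> 0" "\<gamma> = root_comb z'" "\<forall>i\<in>I. z' i \<ge> 0"
    unfolding pos_cone_def by blast
  then show ?thesis by (simp add: root_comb_add root_comb_in_pos_cone)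
qed

lemma pos_cone_scale: "\<beta> \<in> pos_cone \<Longrightarrow> fun_scale (of_nat n) \<beta> \<in> pos_cone"
proof -
  assume "\<beta> \<in> pos_cone"
  then obtain z where "\<beta> = root_comb z" "\<forall>i\<in>I. z i \<ge> 0" unfolding pos_cone_def by blast
  then show ?thesis using root_comb_scale[of "int n" z] by (simp add: root_comb_in_pos_cone)
qed

lemma pos_cone_sum: "(\<And>x. x \<in> A \<Longrightarrow> f x \<in> pos_cone) \<Longrightarrow> (\<Sum>x\<in>A. f x) \<in> pos_cone"
  by (induction A rule: infinite_finite_induct) (auto intro: pos_cone_add)

lemma pos_cone_diff_trans:
  "\<kappa> - \<mu> \<in> pos_cone \<Longrightarrow> \<mu> - \<nu> \<in> pos_cone \<Longrightarrow> \<kappa> - \<nu> \<in> pos_cone"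
  using pos_cone_add[of "\<kappa> - \<mu>" "\<mu> - \<nu>"] by simp

lemma pos_cone_antisym: "\<beta> \<in> pos_cone \<Longrightarrow> - \<beta> \<in> pos_cone \<Longrightarrow> \<beta> = 0"
proof -
  assume \<beta>: "\<beta> \<in> pos_cone" "- \<beta> \<in> pos_cone"
  then obtain z where z: "\<beta> = root_comb z" "\<forall>i\<in>I. z i \<ge> 0" unfolding pos_cone_def by blast
  with \<beta>(2) have "\<forall>i\<in>I. z i \<le> 0" by (simp add: minus_root_comb_in_pos_cone)
  with z have "\<forall>i\<in>I. z i = 0" by force
  with z(1) show ?thesis by (simp add: root_comb_eq_0)
qed

lemma root_comb_pairing: "j \<in> I \<Longrightarrow> root_comb z (\<alpha>c j) = of_int (\<Sum>i\<in>I. z i * a j i)"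
  by (simp add: root_comb_apply pairing)

lemma root_nonzero: "i \<in> I \<Longrightarrow> \<alpha> i \<noteq> 0"
  using pairing_diag[of i] by (metis zero_fun_apply zero_neq_numeral)

section \<open>Triangular decomposition and signs of roots\<close>

definition brackets :: "('i \<Rightarrow> 'g) \<Rightarrow> 'g set" where
  "brackets A = {foldr (\<lambda>i. bracket K (A i)) is (A j) |is j. set is \<subseteq> I \<and> j \<in> I}"

lemma bracketsI: "j \<in> I \<Longrightarrow> A j \<in> brackets A"
  unfolding brackets_def by (force intro: exI[of _ "[]"])

lemma brackets_step: "i \<in> I \<Longrightarrow> x \<in> brackets A \<Longrightarrow> bracket K (A i) x \<in> brackets A"
proof -
  assume i: "i \<in> I" and "x \<in> brackets A"
  then obtain is' j where "set is' \<subseteq> I" "j \<in> I" "x = foldr (\<lambda>i. bracket K (A i)) is' (A j)"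
    unfolding brackets_def by blast
  then show ?thesis unfolding brackets_def using i by (force intro: exI[of _ "i # is'"])
qed

lemma brackets_induct [consumes 1, case_names base step]:
  assumes "x \<in> brackets A" "\<And>j. j \<in> I \<Longrightarrow> P (A j)"
    and "\<And>i x. i \<in> I \<Longrightarrow> x \<in> brackets A \<Longrightarrow> P x \<Longrightarrow> P (bracket K (A i) x)"
  shows "P x"
proof -
  have "set is \<subseteq> I \<Longrightarrow> j \<in> I \<Longrightarrow>
      (let x = foldr (\<lambda>i. bracket K (A i)) is (A j) in x \<in> brackets A \<and> P x)" for "is" j
    by (induction "is") (use assms(2,3) bracketsI brackets_step in \<open>auto simp: Let_def\<close>)
  with assms(1) show ?thesis unfolding brackets_def by (auto simp: Let_def)
qed

lemma brackets_E_weight: "x \<in> brackets E \<Longrightarrow> \<exists>\<beta>\<in>pos_cone. x \<in> ad.wt \<beta>"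
proof (induction rule: brackets_induct)
  case (base j)
  then show ?case using root_in_pos_cone H_E by (force simp: ad.wt_iff)
next
  case (step i x)
  then show ?case by (metis ad.wt_E pos_cone_add root_in_pos_cone)
qed

lemma brackets_F_weight: "x \<in> brackets F \<Longrightarrow> \<exists>\<beta>\<in>pos_cone. x \<in> ad.wt (- \<beta>)"
proof (induction rule: brackets_induct)
  case (base j)
  then show ?case using root_in_pos_cone H_F by (force simp: ad.wt_iff)
next
  case (step i x)
  then obtain \<beta> where \<beta>: "\<beta> \<in> pos_cone" "x \<in> ad.wt (- \<beta>)" by blast
  have "- \<beta> - \<alpha> i = - (\<beta> + \<alpha> i)" by simp
  then show ?case
    using ad.wt_F[OF step.hyps(1) \<beta>(2)] pos_cone_add[OF \<beta>(1) root_in_pos_cone[OF step.hyps(1)]] by metis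
qed

lemma bracket_H_H_comm: "bracket K (H h) x = gscale K c x \<Longrightarrow> bracket K x (H h) = gscale K (- c) x"
  using g.bracket_commute[of x "H h"] by simp

text \<open>Abstract \<open>A\<close> and \<open>B\<close> let this serve for E against F and for F
  against E. In [B i, [A k, x]] = [A k, [B i, x]] + [[B i, A k], x] the inner bracket of the last
  term lies in the Cartan part and only rescales x, while \<open>A k\<close> preserves the
  span.\<close>

lemma bracket_opposite:
  assumes x: "x \<in> brackets A" and i: "i \<in> I"
    and BA: "\<And>j. j \<in> I \<Longrightarrow> \<exists>h. bracket K (B i) (A j) = H h"
    and H: "\<And>h j. j \<in> I \<Longrightarrow> \<exists>c. bracket K (H h) (A j) = gscale K c (A j)"
    and HA: "\<And>h x. x \<in> brackets A \<Longrightarrow> \<exists>c. bracket K (H h) x = gscale K c x"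
  shows "bracket K (B i) x \<in> g.span (brackets A \<union> range H)"
  using x
proof (induction rule: brackets_induct)
  case (base j)
  then show ?case using BA by (metis UnI2 g.span_base rangeI)
next
  case (step k x)
  obtain h where h: "bracket K (B i) (A k) = H h" using BA step.hyps(1) by blast
  obtain c where "bracket K (H h) x = gscale K c x" using HA step.hyps(2) by blast
  then have "bracket K (H h) x \<in> g.span (brackets A \<union> range H)"
    using step.hyps(2) by (simp add: g.span_base g.span_scale)
  moreover have "bracket K (A k) y \<in> g.span (brackets A \<union> range H)"
    if "y \<in> g.span (brackets A \<union> range H)" for y
    using that
  proof (induction rule: g.span_induct_alt)
    case (step c y z)
    have "bracket K (A k) y \<in> g.span (brackets A \<union> range H)"
    proof (cases "y \<in> brackets A")
      case True
      then show ?thesis by (simp add: brackets_step \<open>k \<in> I\<close> g.span_base)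
    next
      case False
      then obtain h' where y: "y = H h'" using step.hyps by blast
      obtain c where "bracket K (H h') (A k) = gscale K c (A k)" using H \<open>k \<in> I\<close> by blast
      then have "bracket K (A k) y = gscale K (- c) (A k)" unfolding y by (rule bracket_H_H_comm)
      then show ?thesis using bracketsI[OF \<open>k \<in> I\<close>, of A] by (metis UnI1 g.span_base g.span_scale)
    qed
    then show ?case using step.IH by (simp add: g.span_add g.span_scale)
  qed (simp add: g.span_zero)
  ultimately show ?case
    using step.IH h ad.act_commute[of "B i" "A k" x] by (simp add: g.span_add)
qed

lemma span_step:
  assumes "\<And>b. b \<in> B \<Longrightarrow> bracket K x b \<in> g.span B" "y \<in> g.span B"
  shows "bracket K x y \<in> g.span B"
  using assms(2)
  by (induction rule: g.span_induct_alt) (auto simp: assms(1) g.span_zero g.span_add g.span_scale)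

text \<open>The span is stable under the adjoint action of the generators, hence of all elements. So
  it is a subalgebra, and it contains the generators.\<close>

lemma triangular_decomposition: "x \<in> g.span (brackets E \<union> brackets F \<union> range H)" (is "x \<in> g.span ?B")
proof -
  have HE: "\<exists>c. bracket K (H h) x = gscale K c x" if "x \<in> brackets E" for h x
    using brackets_E_weight[OF that] by (auto simp: ad.wt_iff)
  have HF: "\<exists>c. bracket K (H h) x = gscale K c x" if "x \<in> brackets F" for h x
    using brackets_F_weight[OF that] ad.wt_iff by blast
  have stepE: "bracket K (E i) b \<in> g.span ?B" if i: "i \<in> I" and b: "b \<in> ?B" for i b
  proof -
    consider "b \<in> brackets E" | "b \<in> brackets F" | h where "b = H h" using b by blast
    then show ?thesis
    proof cases
      case 1
      then show ?thesis using brackets_step[OF i, of b E] by (simp add: g.span_base)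
    next
      case 2
      have EF: "\<exists>h. bracket K (E i) (F j) = H h" if "j \<in> I" for j
        using E_F[OF i that] H_0 by metis
      from 2 have "bracket K (E i) b \<in> g.span (brackets F \<union> range H)"
        by (rule bracket_opposite[OF _ i]) (use EF H_F HF in blast)+
      then show ?thesis using g.span_mono[of "brackets F \<union> range H" ?B] by blast
    next
      case 3
      then show ?thesis using bracket_H_H_comm[OF H_E[OF i]] bracketsI[OF i, of E]
        by (simp add: g.span_base g.span_neg g.span_scale)
    qed
  qed
  have stepF: "bracket K (F i) b \<in> g.span ?B" if i: "i \<in> I" and b: "b \<in> ?B" for i b
  proof -
    consider "b \<in> brackets E" | "b \<in> brackets F" | h where "b = H h" using b by blast
    then show ?thesis
    proof cases
      case 1
      have FE: "\<exists>h. bracket K (F i) (E j) = H h" if "j \<in> I" for j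
      proof (cases "i = j")
        case True
        then have "bracket K (F i) (E j) = H (- \<alpha>c i)"
          using E_F[OF that i] g.bracket_commute[of "F i" "E j"] by (simp add: H_minus)
        then show ?thesis by blast
      next
        case False
        then have "bracket K (F i) (E j) = H 0"
          using E_F[OF that i] g.bracket_commute[of "F i" "E j"] by simp
        then show ?thesis by blast
      qed
      from 1 have "bracket K (F i) b \<in> g.span (brackets E \<union> range H)"
        by (rule bracket_opposite[OF _ i]) (use FE H_E HE in blast)+
      then show ?thesis using g.span_mono[of "brackets E \<union> range H" ?B] by blast
    next
      case 2
      then show ?thesis using brackets_step[OF i, of b F] by (simp add: g.span_base)
    next
      case 3
      then show ?thesis using bracket_H_H_comm[OF H_F[OF i]] bracketsI[OF i, of F]
        by (simp add: g.span_base g.span_neg g.span_scale)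
    qed
  qed
  have Hb: "bracket K (H h) b \<in> g.span ?B" if "b \<in> ?B" for h b
  proof -
    from that have "\<exists>c. bracket K (H h) b = gscale K c b" using HE HF H_H by (auto intro: exI[of _ 0])
    with that show ?thesis by (metis g.span_base g.span_scale)
  qed
  have stable: "\<forall>y\<in>g.span ?B. bracket K x y \<in> g.span ?B" for x
  proof (induction x rule: g_induct)
    case (H h)
    then show ?case using span_step[OF Hb] by blast
  next
    case (E i)
    then show ?case using span_step[of ?B "km_gen K (GenE i)"] stepE[OF E] by blast
  next
    case (F i)
    then show ?case using span_step[of ?B "km_gen K (GenF i)"] stepF[OF F] by blast
  qed (auto simp: g.bracket_bracket g.span_zero g.span_add g.span_scale g.span_diff)
  show ?thesis
  proof (induction x rule: g_induct)
    case (E i)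
    then show ?case using bracketsI[of i E] by (simp add: g.span_base)
  next
    case (F i)
    then show ?case using bracketsI[of i F] by (simp add: g.span_base)
  qed (use stable in \<open>auto simp: g.span_zero g.span_add g.span_scale g.span_base\<close>)
qed

lemma root_pos_or_neg:
  assumes "is_root K \<beta>"
  shows "\<beta> \<in> pos_cone \<or> - \<beta> \<in> pos_cone"
proof -
  obtain x where x: "x \<in> ad.wt \<beta>" "x \<noteq> 0"
    using assms ad.zero_in_wt[of \<beta>] by (auto simp: is_root_def root_space_eq)
  have "\<beta> \<in> pos_cone \<union> uminus ` pos_cone"
  proof (rule weight_in_spanning_set[where T = "\<lambda>h. bracket K (H h)" and scale = "gscale K"
        and B = "brackets E \<union> brackets F \<union> range H"])
    show "Vector_Spaces.linear (gscale K) (gscale K) (bracket K (H h))" for h by (rule g.linear_right)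
    show "x \<in> g.span (brackets E \<union> brackets F \<union> range H)" by (rule triangular_decomposition)
    show "x \<noteq> 0" by fact
    show "bracket K (H h) x = gscale K (\<beta> h) x" for h using x(1) by (simp add: ad.wt_iff)
    fix b assume "b \<in> brackets E \<union> brackets F \<union> range H"
    then consider "b \<in> brackets E" | "b \<in> brackets F" | h where "b = H h" by blast
    then show "\<exists>\<gamma>\<in>pos_cone \<union> uminus ` pos_cone. \<forall>h. bracket K (H h) b = gscale K (\<gamma> h) b"
    proof cases
      case 1
      then show ?thesis using brackets_E_weight[of b] ad.wt_iff by blast
    next
      case 2
      then show ?thesis using brackets_F_weight[of b] ad.wt_iff by blast
    next
      case 3
      then show ?thesis by (intro bexI[of _ 0]) (simp_all add: H_H)
    qed
  qed
  then show ?thesis by auto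
qed

section \<open>Simple reflections on the dual space\<close>

lemma hdual_iff:
  "\<mu> \<in> hdual K \<longleftrightarrow> (\<forall>h h'. \<mu> (h + h') = \<mu> h + \<mu> h') \<and> (\<forall>c h. \<mu> (hscale K c h) = c * \<mu> h)"
proof -
  have "vector_space ((*) :: complex \<Rightarrow> complex \<Rightarrow> complex)"
    by unfold_locales (auto simp: algebra_simps)
  then show ?thesis by (auto simp: hdual_def Vector_Spaces.linear_iff hspace.vector_space_axioms)
qed

lemma hdual_diff: "\<mu> \<in> hdual K \<Longrightarrow> \<nu> \<in> hdual K \<Longrightarrow> \<mu> - \<nu> \<in> hdual K"
  and hdual_scale: "\<mu> \<in> hdual K \<Longrightarrow> fun_scale c \<mu> \<in> hdual K"
  by (auto simp: hdual_iff fun_scale_def algebra_simps)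

lemma s_hdual: "i \<in> I \<Longrightarrow> \<mu> \<in> hdual K \<Longrightarrow> s i \<mu> \<in> hdual K"
  unfolding simple_reflection_def by (intro hdual_diff hdual_scale root_hdual)

lemma s_add: "s i (\<mu> + \<nu>) = s i \<mu> + s i \<nu>"
  and s_diff: "s i (\<mu> - \<nu>) = s i \<mu> - s i \<nu>"
  and s_scale: "s i (fun_scale c \<mu>) = fun_scale c (s i \<mu>)"
  by (auto simp: simple_reflection_def fun_scale_def fun_eq_iff algebra_simps)

lemma s_s [simp]: "i \<in> I \<Longrightarrow> s i (s i \<mu>) = \<mu>"
  by (auto simp: simple_reflection_def fun_scale_def fun_eq_iff algebra_simps)

text \<open>Root spaces are weight spaces of the adjoint module, where \<open>E i\<close> and
  \<open>F i\<close> are locally nilpotent. The lattice hypothesis makes the pairing of \<beta> with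
  the coroot an integer.\<close>

lemma root_reflect:
  assumes "is_root K \<beta>" "\<beta> = root_comb z" "i \<in> I"
  shows "is_root K (s i \<beta>)"
proof -
  obtain x where x: "x \<in> ad.wt \<beta>" "x \<noteq> 0"
    using assms ad.zero_in_wt[of \<beta>] by (auto simp: is_root_def root_space_eq)
  have "ad.wt (s i \<beta>) \<noteq> {0}"
    using E_ad_nilpotent[of i x] F_ad_nilpotent[of i x] ad.wt_reflect[OF assms(3) x]
      root_comb_pairing[OF assms(3), of z] assms by blast
  moreover have "s i \<beta> \<noteq> 0"
    using s_s[OF assms(3), of \<beta>] assms(1) s_scale[of i 0 0]
    by (auto simp: is_root_def fun_scale_def zero_fun_def)
  ultimately show ?thesis
    using assms s_hdual by (simp add: is_root_def root_space_eq)
qed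

end

section \<open>A module on which the simple root vectors act nontrivially\<close>

text \<open>The module constructed below is a subspace of a function space, and the Serre relations
  are proved on that subspace only. Operators are therefore defined on all functions, and identities
  are restricted to the subspace where necessary.\<close>

type_synonym 'x operator = "('x \<Rightarrow> complex) \<Rightarrow> 'x \<Rightarrow> complex"

definition linear_operator :: "'x operator \<Rightarrow> bool" where
  "linear_operator A \<longleftrightarrow> (\<forall>\<phi> \<psi>. A (\<phi> + \<psi>) = A \<phi> + A \<psi>) \<and> (\<forall>c \<phi>. A (fun_scale c \<phi>) = fun_scale c (A \<phi>))"

definition commutator :: "'x operator \<Rightarrow> 'x operator \<Rightarrow> 'x operator" where
  "commutator A B = (\<lambda>\<phi>. A (B \<phi>) - B (A \<phi>))"

definition operator_scale :: "complex \<Rightarrow> 'x operator \<Rightarrow> 'x operator" where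
  "operator_scale c A = (\<lambda>\<phi>. fun_scale c (A \<phi>))"

lemma commutator_apply: "commutator A B \<phi> = A (B \<phi>) - B (A \<phi>)"
  by (simp add: commutator_def)

lemma linear_operator_simps:
  assumes "linear_operator A"
  shows "A (\<phi> + \<psi>) = A \<phi> + A \<psi>" "A (fun_scale c \<phi>) = fun_scale c (A \<phi>)"
    "A 0 = 0" "A (\<phi> - \<psi>) = A \<phi> - A \<psi>" "A (- \<phi>) = - A \<phi>"
proof -
  show add: "A (\<phi> + \<psi>) = A \<phi> + A \<psi>" for \<phi> \<psi> using assms by (simp add: linear_operator_def)
  show scale: "A (fun_scale c \<phi>) = fun_scale c (A \<phi>)" for c \<phi>
    using assms by (simp add: linear_operator_def)
  show zero: "A 0 = 0" using add[of 0 0] by simp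
  show minus: "A (- \<phi>) = - A \<phi>" for \<phi> using add[of "- \<phi>" \<phi>] zero by (simp add: eq_neg_iff_add_eq_0)
  show "A (\<phi> - \<psi>) = A \<phi> - A \<psi>" using add[of \<phi> "- \<psi>"] minus by simp
qed

lemma linear_operator_commutator:
  assumes "linear_operator A" "linear_operator B"
  shows "linear_operator (commutator A B)"
  unfolding linear_operator_def[of "commutator A B"]
  by (auto simp: commutator_def linear_operator_simps[OF assms(1)] linear_operator_simps[OF assms(2)]
      fun_space.scale_right_diff_distrib)

lemma linear_operator_scale:
  assumes "linear_operator A"
  shows "linear_operator (operator_scale c A)"
  unfolding linear_operator_def[of "operator_scale c A"]
  by (auto simp: operator_scale_def linear_operator_simps[OF assms] fun_space.scale_right_distrib mult.commute)

lemma linear_operator_add: "linear_operator A \<Longrightarrow> linear_operator B \<Longrightarrow> linear_operator (A + B)"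
  unfolding linear_operator_def[of "A + B"]
  by (auto simp: linear_operator_simps fun_space.scale_right_distrib)

lemma linear_operator_zero: "linear_operator 0"
  by (simp add: linear_operator_def)

lemma commutator_commutator:
  assumes "linear_operator A" "linear_operator B" "linear_operator C"
  shows "commutator A (commutator B C) = commutator B (commutator A C) + commutator (commutator A B) C"
  using assms by (auto simp: commutator_def fun_eq_iff linear_operator_simps)

lemma commutator_pow_linear:
  "linear_operator X \<Longrightarrow> linear_operator Y \<Longrightarrow> linear_operator ((commutator X ^^ n) Y)"
  by (induction n) (auto intro: linear_operator_commutator)

lemma commutator_scale_right:
  "linear_operator A \<Longrightarrow> commutator A (operator_scale c B) = operator_scale c (commutator A B)"
  by (auto simp: commutator_def operator_scale_def linear_operator_simps fun_space.scale_right_diff_distrib)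

lemma commutator_scale_left:
  "linear_operator B \<Longrightarrow> commutator (operator_scale c A) B = operator_scale c (commutator A B)"
  by (auto simp: commutator_def operator_scale_def linear_operator_simps fun_space.scale_right_diff_distrib)

lemma commutator_zero_left: "linear_operator B \<Longrightarrow> commutator 0 B = 0"
  by (auto simp: commutator_def linear_operator_simps fun_eq_iff)

lemma commutator_zero_right: "linear_operator A \<Longrightarrow> commutator A 0 = 0"
  by (auto simp: commutator_def linear_operator_simps fun_eq_iff)

lemma commutator_self: "commutator A A = 0"
  by (auto simp: commutator_def fun_eq_iff)

lemma commutator_pow_zero: "linear_operator X \<Longrightarrow> (commutator X ^^ n) 0 = 0"
  by (induction n) (simp_all add: commutator_zero_right)

lemma operator_scale_0 [simp]: "operator_scale 0 A = 0" "operator_scale c 0 = 0"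
  by (auto simp: operator_scale_def fun_eq_iff)

lemma operator_scale_add: "operator_scale c A + operator_scale d A = operator_scale (c + d) A"
  by (auto simp: operator_scale_def fun_space.scale_left_distrib fun_eq_iff)

lemma operator_scale_scale: "operator_scale c (operator_scale d A) = operator_scale (c * d) A"
  by (auto simp: operator_scale_def)

text \<open>The computation of \<open>e_f_pow\<close> for the string of brackets with X through Y:
  the factor (n + 1)(c - n) vanishes at n = c. It is applied to X, Y, Z = f_i, f_j, e_i and, with H
  negated, to e_i, e_j, f_i; in both cases c = -a_ij.\<close>

lemma commutator_serre_same:
  assumes lin: "linear_operator X" "linear_operator Y" "linear_operator Z" "linear_operator H"
    and ZX: "commutator Z X = H" and HX: "commutator H X = operator_scale (- 2) X"
    and ZY: "commutator Z Y = 0" and HY: "commutator H Y = operator_scale (of_nat c) Y"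
  shows "commutator Z ((commutator X ^^ Suc c) Y) = 0"
proof -
  define y where "y n = (commutator X ^^ n) Y" for n
  have y_lin: "linear_operator (y n)" for n
    unfolding y_def by (rule commutator_pow_linear[OF lin(1,2)])
  have y_Suc: "y (Suc n) = commutator X (y n)" for n by (simp add: y_def)
  have Hy: "commutator H (y n) = operator_scale (of_nat c - 2 * of_nat n) (y n)" for n
  proof (induction n)
    case (Suc n)
    show ?case
      unfolding y_Suc commutator_commutator[OF lin(4,1) y_lin] Suc commutator_scale_right[OF lin(1)] HX
        commutator_scale_left[OF y_lin] operator_scale_add by (simp add: algebra_simps)
  qed (simp add: y_def HY)
  have "commutator Z (y (Suc n)) = operator_scale (of_nat (Suc n) * (of_nat c - of_nat n)) (y n)" for n
  proof (induction n)
    case 0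
    show ?case
      using commutator_commutator[OF lin(3,1) y_lin[of 0]] Hy[of 0] lin(1)
      by (simp add: y_Suc ZX) (simp add: y_def ZY commutator_zero_right)
  next
    case (Suc n)
    have "commutator Z (y (Suc (Suc n)))
        = operator_scale (of_nat (Suc n) * (of_nat c - of_nat n) + (of_nat c - 2 * of_nat (Suc n))) (y (Suc n))"
      unfolding y_Suc[of "Suc n"] commutator_commutator[OF lin(3,1) y_lin] Suc
        commutator_scale_right[OF lin(1)] ZX Hy operator_scale_add[symmetric] by (simp add: y_Suc)
    also have "of_nat (Suc n) * (of_nat c - of_nat n) + (of_nat c - 2 * of_nat (Suc n))
        = of_nat (Suc (Suc n)) * (of_nat c - of_nat (Suc n) :: complex)" by (simp add: algebra_simps)
    finally show ?case .
  qed
  from this[of c] show ?thesis unfolding y_def by simp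
qed

text \<open>As V commutes with X, it passes through to Y and leaves (ad X)^n applied to H = [V, Y].
  One bracket gives a multiple of X, a second one zero; for n = 1 the multiple itself has to
  vanish.\<close>

lemma commutator_serre_other:
  assumes lin: "linear_operator X" "linear_operator Y" "linear_operator V"
    and VX: "commutator V X = 0" and VY: "commutator V Y = H" and XH: "commutator X H = operator_scale d X"
    and n: "n \<ge> 1" "n = 1 \<Longrightarrow> d = 0"
  shows "commutator V ((commutator X ^^ n) Y) = 0"
proof -
  have "commutator V ((commutator X ^^ n) Y) = (commutator X ^^ n) H" for n
  proof (induction n)
    case (Suc n)
    show ?case
      using commutator_commutator[OF lin(3,1) commutator_pow_linear[OF lin(1,2)], of n] Suc
      by (simp add: VX commutator_zero_left commutator_pow_linear lin)
  qed (simp add: VY)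
  moreover have "(commutator X ^^ n) H = 0"
  proof (cases "n = 1")
    case True
    then show ?thesis using n XH by simp
  next
    case False
    then have m: "n = (n - 2) + 2" using n(1) by simp
    show ?thesis
      by (subst m) (simp add: XH commutator_scale_right lin commutator_self funpow_add commutator_pow_zero
          numeral_2_eq_2 funpow_swap1)
  qed
  ultimately show ?thesis by simp
qed

lemma commutator_swap: "commutator A B = - commutator B A"
  by (auto simp: commutator_def fun_eq_iff)

lemma span_linear_image:
  assumes "linear_operator A" "\<And>b. b \<in> B \<Longrightarrow> A b \<in> fun_space.span C" "x \<in> fun_space.span B"
  shows "A x \<in> fun_space.span C"
  using assms(3)
  by (induction rule: fun_space.span_induct_alt)
    (simp_all add: linear_operator_simps[OF assms(1)] assms(2) fun_space.span_zero fun_space.span_add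
      fun_space.span_scale del: plus_fun_apply zero_fun_apply)

lemma span_linear_zero:
  assumes "linear_operator A" "\<And>b. b \<in> B \<Longrightarrow> A b = 0" "x \<in> fun_space.span B"
  shows "A x = 0"
  using assms(3)
  by (induction rule: fun_space.span_induct_alt) (simp_all add: linear_operator_simps[OF assms(1)] assms(2) fun_space.scale_zero_right
      del: plus_fun_apply zero_fun_apply)

context kac_moody
begin

text \<open>
  Functions on words carry the module over the algebra without Serre relations that is coinduced
  from the character \<open>\<Lambda>\<close>: the value of \<open>\<phi>\<close> at the word \<open>[i\<^sub>1, \<dots>, i\<^sub>n]\<close> is the vacuum coefficient
  of \<open>e \<dots> e \<phi>\<close>, where \<open>e\<close> of \<open>i\<^sub>1\<close> acts first. The submodule generated by the vacuum is simple,
  which forces the Serre relations on it.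
\<close>

definition word_weight :: "('h \<Rightarrow> complex) \<Rightarrow> 'i list \<Rightarrow> 'h \<Rightarrow> complex" where
  "word_weight \<Lambda> u h = \<Lambda> h - (\<Sum>k\<leftarrow>u. if k \<in> I then \<alpha> k h else 0)"

definition mod_E :: "'i \<Rightarrow> 'i list operator" where
  "mod_E i \<phi> = (\<lambda>u. \<phi> (i # u))"

definition mod_H :: "('h \<Rightarrow> complex) \<Rightarrow> 'h \<Rightarrow> 'i list operator" where
  "mod_H \<Lambda> h \<phi> = (\<lambda>u. word_weight \<Lambda> u h * \<phi> u)"

text \<open>The recursion is forced by e_k f_i = f_i e_k + \<delta>_ki h_i: the value at
  \<open>k # u\<close> is that of e_k f_i \<phi> at u. The value 0 at the empty word says that the
  image of f_i has no vacuum component.\<close>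

primrec mod_F_at :: "('h \<Rightarrow> complex) \<Rightarrow> 'i \<Rightarrow> 'i list \<Rightarrow> ('i list \<Rightarrow> complex) \<Rightarrow> complex" where
  "mod_F_at \<Lambda> i [] \<phi> = 0"
| "mod_F_at \<Lambda> i (k # u) \<phi> =
     mod_F_at \<Lambda> i u (mod_E k \<phi>) + (if k = i then mod_H \<Lambda> (\<alpha>c i) \<phi> u else 0)"

definition mod_F :: "('h \<Rightarrow> complex) \<Rightarrow> 'i \<Rightarrow> 'i list operator" where
  "mod_F \<Lambda> i \<phi> = (\<lambda>u. mod_F_at \<Lambda> i u \<phi>)"

definition vacuum :: "'i list \<Rightarrow> complex" where
  "vacuum = (\<lambda>u. of_bool (u = []))"

abbreviation "mod_word \<Lambda> u \<equiv> foldr (mod_F \<Lambda>) u vacuum"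

abbreviation "mod_simple \<Lambda> \<equiv> fun_space.span (range (mod_word \<Lambda>))"

lemma mod_E_linear: "linear_operator (mod_E i)"
  and mod_H_linear: "linear_operator (mod_H \<Lambda> h)"
  by (auto simp: linear_operator_def mod_E_def mod_H_def fun_scale_def algebra_simps)

lemma mod_F_linear: "linear_operator (mod_F \<Lambda> i)"
proof -
  have "mod_F_at \<Lambda> i u (\<phi> + \<psi>) = mod_F_at \<Lambda> i u \<phi> + mod_F_at \<Lambda> i u \<psi>" for u \<phi> \<psi>
    by (induction u arbitrary: \<phi> \<psi>)
      (simp_all add: linear_operator_simps[OF mod_E_linear] linear_operator_simps[OF mod_H_linear])
  moreover have "mod_F_at \<Lambda> i u (fun_scale c \<phi>) = c * mod_F_at \<Lambda> i u \<phi>" for u c \<phi>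
  proof (induction u arbitrary: \<phi>)
    case (Cons k u)
    have "mod_H \<Lambda> h (fun_scale c \<phi>) u = c * mod_H \<Lambda> h \<phi> u" for h
      by (simp add: mod_H_def fun_scale_def)
    then show ?case by (simp add: Cons linear_operator_simps(2)[OF mod_E_linear] algebra_simps)
  qed simp
  ultimately show ?thesis by (auto simp: linear_operator_def mod_F_def fun_scale_def fun_eq_iff)
qed

lemma mod_E_F: "commutator (mod_E k) (mod_F \<Lambda> i) = (if k = i then mod_H \<Lambda> (\<alpha>c i) else 0)"
  by (auto simp: commutator_def mod_F_def mod_E_def[of k "\<lambda>u. mod_F_at \<Lambda> i u _"] fun_eq_iff)

lemma mod_H_E: "i \<in> I \<Longrightarrow> commutator (mod_H \<Lambda> h) (mod_E i) = operator_scale (\<alpha> i h) (mod_E i)"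
  by (auto simp: commutator_def mod_H_def mod_E_def operator_scale_def fun_scale_def word_weight_def
      fun_eq_iff algebra_simps)

lemma mod_H_H: "commutator (mod_H \<Lambda> h) (mod_H \<Lambda> h') = 0"
  by (auto simp: commutator_def mod_H_def fun_eq_iff)

lemma mod_H_F:
  "commutator (mod_H \<Lambda> h) (mod_F \<Lambda> i) = operator_scale (- (if i \<in> I then \<alpha> i h else 0)) (mod_F \<Lambda> i)"
proof -
  let ?a = "\<lambda>i. if i \<in> I then \<alpha> i h else 0"
  have "word_weight \<Lambda> u h * mod_F_at \<Lambda> i u \<phi> - mod_F_at \<Lambda> i u (mod_H \<Lambda> h \<phi>) = - ?a i * mod_F_at \<Lambda> i u \<phi>"
    for u \<phi>
  proof (induction u arbitrary: \<phi>)
    case (Cons k u)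
    have "mod_E k (mod_H \<Lambda> h \<phi>) = mod_H \<Lambda> h (mod_E k \<phi>) - fun_scale (?a k) (mod_E k \<phi>)"
      by (auto simp: mod_E_def mod_H_def fun_scale_def word_weight_def fun_eq_iff algebra_simps)
    moreover have "mod_F_at \<Lambda> i u (\<psi> - fun_scale c \<chi>) = mod_F_at \<Lambda> i u \<psi> - c * mod_F_at \<Lambda> i u \<chi>"
      for \<psi> \<chi> c
      using fun_cong[OF linear_operator_simps(4)[OF mod_F_linear, of \<Lambda> i \<psi> "fun_scale c \<chi>"], of u]
        fun_cong[OF linear_operator_simps(2)[OF mod_F_linear, of \<Lambda> i c \<chi>], of u]
      by (simp add: mod_F_def fun_scale_def)
    moreover have "word_weight \<Lambda> (k # u) h = word_weight \<Lambda> u h - ?a k" by (simp add: word_weight_def)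
    moreover have "mod_H \<Lambda> h' (mod_H \<Lambda> h \<phi>) u = word_weight \<Lambda> u h * mod_H \<Lambda> h' \<phi> u" for h'
      by (simp add: mod_H_def)
    moreover note Cons[of "mod_E k \<phi>"]
    ultimately show ?case
      by (simp only: mod_F_at.simps) (cases "k = i"; cases "i \<in> I"; simp add: algebra_simps)
  qed simp
  then show ?thesis by (simp add: commutator_def mod_F_def mod_H_def operator_scale_def fun_scale_def fun_eq_iff)
qed

lemma mod_E_vacuum: "mod_E i vacuum = 0"
  by (auto simp: mod_E_def vacuum_def fun_eq_iff)

lemma mod_H_vacuum: "mod_H \<Lambda> h vacuum = fun_scale (\<Lambda> h) vacuum"
  by (auto simp: mod_H_def vacuum_def fun_scale_def word_weight_def fun_eq_iff)

lemma mod_H_word: "\<exists>c. mod_H \<Lambda> h (mod_word \<Lambda> u) = fun_scale c (mod_word \<Lambda> u)"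
proof (induction u)
  case (Cons i u)
  then obtain c where "mod_H \<Lambda> h (mod_word \<Lambda> u) = fun_scale c (mod_word \<Lambda> u)" by blast
  then have "mod_H \<Lambda> h (mod_word \<Lambda> (i # u))
      = fun_scale (c - (if i \<in> I then \<alpha> i h else 0)) (mod_word \<Lambda> (i # u))"
    using fun_cong[OF mod_H_F, of \<Lambda> h i "mod_word \<Lambda> u"] linear_operator_simps(2)[OF mod_F_linear]
    by (simp add: commutator_def operator_scale_def fun_space.scale_left_diff_distrib algebra_simps
        split del: if_split)
  then show ?case by blast
qed (use mod_H_vacuum in auto)

text \<open>Moving e_k past the first letter leaves that letter applied to shorter words, or a
  multiple of the rest of the word. The strict bound on the length is what the induction in
  \<open>mod_lowering_zero\<close> runs on.\<close>

lemma mod_E_word: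
  "mod_E k (mod_word \<Lambda> u) \<in> fun_space.span (mod_word \<Lambda> ` {v. length v < length u})"
proof (induction u)
  case Nil
  show ?case using mod_E_vacuum[of k] fun_space.span_zero by (metis foldr_Nil id_apply)
next
  case (Cons i u)
  let ?B = "mod_word \<Lambda> ` {v. length v < length (i # u)}"
  have "mod_F \<Lambda> i (mod_E k (mod_word \<Lambda> u)) \<in> fun_space.span ?B"
  proof (rule span_linear_image[OF mod_F_linear _ Cons])
    fix b assume "b \<in> mod_word \<Lambda> ` {v. length v < length u}"
    then obtain v where "length v < length u" "b = mod_word \<Lambda> v" by blast
    then have "mod_F \<Lambda> i b = mod_word \<Lambda> (i # v)" "length (i # v) < length (i # u)" by auto
    then show "mod_F \<Lambda> i b \<in> fun_space.span ?B"
      by (metis (mono_tags, lifting) fun_space.span_base imageI mem_Collect_eq)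
  qed
  moreover have "mod_H \<Lambda> h (mod_word \<Lambda> u) \<in> fun_space.span ?B" for h
  proof -
    have "mod_word \<Lambda> u \<in> fun_space.span ?B" by (intro fun_space.span_base imageI) simp
    then show ?thesis using mod_H_word[of \<Lambda> h u] fun_space.span_scale by metis
  qed
  moreover have "mod_E k (mod_word \<Lambda> (i # u)) = mod_F \<Lambda> i (mod_E k (mod_word \<Lambda> u))
      + (if k = i then mod_H \<Lambda> (\<alpha>c i) (mod_word \<Lambda> u) else 0)"
    using fun_cong[OF mod_E_F, of k \<Lambda> i "mod_word \<Lambda> u"]
    by (simp add: commutator_def algebra_simps split: if_splits)
  ultimately show ?case
    by (auto intro: fun_space.span_add simp del: plus_fun_apply zero_fun_apply foldr.simps list.size
        split: if_splits)
qed

lemma mod_simple_E: "x \<in> mod_simple \<Lambda> \<Longrightarrow> mod_E k x \<in> mod_simple \<Lambda>"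
proof (erule span_linear_image[OF mod_E_linear, rotated])
  fix b assume "b \<in> range (mod_word \<Lambda>)"
  then obtain u where "b = mod_word \<Lambda> u" by blast
  then show "mod_E k b \<in> mod_simple \<Lambda>"
    using mod_E_word[of k \<Lambda> u] fun_space.span_mono[of "mod_word \<Lambda> ` {v. length v < length u}" "range (mod_word \<Lambda>)"]
    by blast
qed

lemma mod_simple_F: "x \<in> mod_simple \<Lambda> \<Longrightarrow> mod_F \<Lambda> k x \<in> mod_simple \<Lambda>"
proof (erule span_linear_image[OF mod_F_linear, rotated])
  fix b assume "b \<in> range (mod_word \<Lambda>)"
  then obtain u where "b = mod_word \<Lambda> u" by blast
  then have "mod_F \<Lambda> k b = mod_word \<Lambda> (k # u)" by simp
  then show "mod_F \<Lambda> k b \<in> mod_simple \<Lambda>" by (metis fun_space.span_base rangeI)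
qed

lemma mod_simple_H: "x \<in> mod_simple \<Lambda> \<Longrightarrow> mod_H \<Lambda> h x \<in> mod_simple \<Lambda>"
proof (erule span_linear_image[OF mod_H_linear, rotated])
  fix b assume "b \<in> range (mod_word \<Lambda>)"
  then obtain u where "b = mod_word \<Lambda> u" by blast
  then show "mod_H \<Lambda> h b \<in> mod_simple \<Lambda>"
    using mod_H_word[of \<Lambda> h u] fun_space.span_base[of b "range (mod_word \<Lambda>)"] fun_space.span_scale
    by (metis rangeI)
qed

text \<open>Values at nonempty words are values of some \<open>mod_E k \<phi>\<close>. This is the
  form in which simplicity of the module is used.\<close>

lemma mod_singular_zero:
  assumes "\<And>k. mod_E k \<phi> = 0" "\<phi> [] = 0"
  shows "\<phi> = 0"
proof
  fix u show "\<phi> u = 0 u"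
    using fun_cong[OF assms(1)] assms(2) by (cases u) (auto simp: mod_E_def)
qed

text \<open>Meant for the Serre elements in the \<open>F i\<close>. The image of a word under
  \<theta> is singular, since \<open>mod_E k\<close> can be moved onto the word, which it shortens;
  and it has no vacuum coefficient.\<close>

lemma mod_lowering_zero:
  assumes "linear_operator \<theta>" "\<And>k. commutator (mod_E k) \<theta> = 0" "\<And>\<phi>. \<theta> \<phi> [] = 0"
    and "x \<in> mod_simple \<Lambda>"
  shows "\<theta> x = 0"
proof -
  have "\<theta> (mod_word \<Lambda> u) = 0" for u
  proof (induction "length u" arbitrary: u rule: less_induct)
    case less
    have "\<theta> (mod_E k (mod_word \<Lambda> u)) = 0" for k
      by (rule span_linear_zero[OF assms(1) _ mod_E_word]) (use less in auto)
    then have "mod_E k (\<theta> (mod_word \<Lambda> u)) = 0" for k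
      using fun_cong[OF assms(2), of k "mod_word \<Lambda> u"] by (simp add: commutator_def)
    then show ?case using mod_singular_zero assms(3) by blast
  qed
  then show ?thesis using span_linear_zero[OF assms(1) _ assms(4)] by auto
qed

text \<open>The dual argument for the Serre elements in the \<open>E i\<close>: \<eta> moves past
  all letters of a word down to the vacuum.\<close>

lemma mod_raising_zero:
  assumes "linear_operator \<eta>" "\<And>k. commutator (mod_F \<Lambda> k) \<eta> = 0" "\<eta> vacuum = 0"
    and "x \<in> mod_simple \<Lambda>"
  shows "\<eta> x = 0"
proof -
  have "\<eta> (mod_word \<Lambda> u) = 0" for u
  proof (induction u)
    case (Cons i u)
    have "mod_F \<Lambda> i (\<eta> (mod_word \<Lambda> u)) = \<eta> (mod_F \<Lambda> i (mod_word \<Lambda> u))"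
      using fun_cong[OF assms(2), of i "mod_word \<Lambda> u"] by (simp add: commutator_apply)
    then show ?case
      using Cons linear_operator_simps(3)[OF mod_F_linear, of \<Lambda> i] by (metis comp_apply foldr_Cons)
  qed (simp add: assms(3))
  then show ?thesis using span_linear_zero[OF assms(1) _ assms(4)] by auto
qed

lemma mod_serre_F:
  assumes "i \<in> I" "j \<in> I" "i \<noteq> j" "x \<in> mod_simple \<Lambda>"
  shows "(commutator (mod_F \<Lambda> i) ^^ nat (1 - a i j)) (mod_F \<Lambda> j) x = 0"
proof (rule mod_lowering_zero[OF _ _ _ assms(4)])
  obtain c where c: "a i j = - int c" using cartan_nonpos[OF assms(1-3)] by (metis nonpos_int_cases)
  then have n: "nat (1 - a i j) = Suc c" by simp
  show "linear_operator ((commutator (mod_F \<Lambda> i) ^^ nat (1 - a i j)) (mod_F \<Lambda> j))"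
    by (intro commutator_pow_linear mod_F_linear)
  have "(commutator (mod_F \<Lambda> i) ^^ n) (mod_F \<Lambda> j) \<phi> [] = 0" for n \<phi>
  proof (induction n arbitrary: \<phi>)
    case (Suc n)
    then show ?case by (simp add: commutator_def mod_F_def)
  qed (simp add: mod_F_def)
  then show "(commutator (mod_F \<Lambda> i) ^^ nat (1 - a i j)) (mod_F \<Lambda> j) \<phi> [] = 0" for \<phi> .
  fix k
  show "commutator (mod_E k) ((commutator (mod_F \<Lambda> i) ^^ nat (1 - a i j)) (mod_F \<Lambda> j)) = 0"
  proof (cases "k = i")
    case True
    show ?thesis unfolding n True
      by (rule commutator_serre_same[where H = "mod_H \<Lambda> (\<alpha>c i)"])
        (use assms c in \<open>simp_all add: mod_F_linear mod_E_linear mod_H_linear mod_E_F mod_H_F pairing\<close>)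
  next
    case False
    \<comment> \<open>The exponent is 1 exactly if \<open>a i j\<close> is zero. The axioms of a
      Cartan matrix then give \<open>a j i = 0\<close>, which is the required
      \<open>d = 0\<close>.\<close>
    show ?thesis
      by (rule commutator_serre_other[where H = "if k = j then mod_H \<Lambda> (\<alpha>c j) else 0"
            and d = "if k = j then of_int (a j i) else 0"])
        (use assms False cartan_zero[of i j] c n commutator_swap[of "mod_F \<Lambda> i" "mod_H \<Lambda> (\<alpha>c j)"] in
          \<open>auto simp: mod_F_linear mod_E_linear mod_E_F mod_H_F pairing commutator_zero_right
            operator_scale_def fun_eq_iff fun_scale_def\<close>)
  qed
qed

lemma mod_serre_E:
  assumes "i \<in> I" "j \<in> I" "i \<noteq> j" "x \<in> mod_simple \<Lambda>"
  shows "(commutator (mod_E i) ^^ nat (1 - a i j)) (mod_E j) x = 0"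
proof (rule mod_raising_zero[OF _ _ _ assms(4)])
  obtain c where c: "a i j = - int c" using cartan_nonpos[OF assms(1-3)] by (metis nonpos_int_cases)
  then have n: "nat (1 - a i j) = Suc c" by simp
  show "linear_operator ((commutator (mod_E i) ^^ nat (1 - a i j)) (mod_E j))"
    by (intro commutator_pow_linear mod_E_linear)
  have "(commutator (mod_E i) ^^ n) (mod_E j) vacuum = 0" for n
  proof (induction n)
    case (Suc n)
    have "(commutator (mod_E i) ^^ n) (mod_E j) 0 = 0"
      using linear_operator_simps(3)[OF commutator_pow_linear[OF mod_E_linear[of i] mod_E_linear[of j]]] .
    moreover have "mod_E i 0 = 0" using linear_operator_simps(3)[OF mod_E_linear] .
    moreover have "(commutator (mod_E i) ^^ Suc n) (mod_E j) vacuum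
        = mod_E i ((commutator (mod_E i) ^^ n) (mod_E j) vacuum)
          - (commutator (mod_E i) ^^ n) (mod_E j) (mod_E i vacuum)"
      by (simp only: funpow.simps(2) comp_apply) (rule commutator_apply)
    ultimately show ?case unfolding Suc.IH mod_E_vacuum by (simp only: diff_zero)
  qed (simp add: mod_E_vacuum)
  then show "(commutator (mod_E i) ^^ nat (1 - a i j)) (mod_E j) vacuum = 0" .
  fix k
  have neg: "- mod_H \<Lambda> h = operator_scale (- 1) (mod_H \<Lambda> h)" for h
    by (auto simp: operator_scale_def fun_eq_iff)
  have HE: "commutator (- mod_H \<Lambda> h) (mod_E k) = operator_scale (- \<alpha> k h) (mod_E k)" if "k \<in> I" for h k
    unfolding neg by (simp add: commutator_scale_left mod_E_linear mod_H_E that operator_scale_scale)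
  have FE: "commutator (mod_F \<Lambda> k) (mod_E l) = (if k = l then - mod_H \<Lambda> (\<alpha>c l) else 0)" for k l
    by (subst commutator_swap) (simp add: mod_E_F)
  have Hlin: "linear_operator (- mod_H \<Lambda> h)" for h
    unfolding neg by (intro linear_operator_scale mod_H_linear)
  show "commutator (mod_F \<Lambda> k) ((commutator (mod_E i) ^^ nat (1 - a i j)) (mod_E j)) = 0"
  proof (cases "k = i")
    case True
    show ?thesis unfolding n True
      by (rule commutator_serre_same[where H = "- mod_H \<Lambda> (\<alpha>c i)"])
        (use assms c in \<open>simp_all add: mod_F_linear mod_E_linear Hlin FE HE pairing\<close>)
  next
    case False
    have EH: "commutator (mod_E i) (- mod_H \<Lambda> (\<alpha>c j)) = operator_scale (of_int (a j i)) (mod_E i)"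
      unfolding neg using assms
      by (simp add: commutator_scale_right mod_E_linear)
        (subst commutator_swap, simp add: mod_H_E pairing operator_scale_def fun_eq_iff)
    show ?thesis
      by (rule commutator_serre_other[where H = "if k = j then - mod_H \<Lambda> (\<alpha>c j) else 0"
            and d = "if k = j then of_int (a j i) else 0"])
        (use assms False cartan_zero[of i j] c n EH in
          \<open>auto simp: mod_F_linear mod_E_linear FE commutator_zero_right\<close>)
  qed
qed

section \<open>From the presentation to operators\<close>

primrec mod_gen :: "('h \<Rightarrow> complex) \<Rightarrow> ('i, 'h) km_generator \<Rightarrow> 'i list operator" where
  "mod_gen \<Lambda> (GenH h) = mod_H \<Lambda> h"
| "mod_gen \<Lambda> (GenE i) = mod_E i"
| "mod_gen \<Lambda> (GenF i) = mod_F \<Lambda> i"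

abbreviation "mod_eval \<Lambda> \<equiv> lie_eval operator_scale commutator (mod_gen \<Lambda>)"

lemma mod_eval_linear: "linear_operator (mod_eval \<Lambda> t)"
proof (induction t)
  case (LGen x)
  then show ?case by (cases x) (simp_all add: mod_E_linear mod_F_linear mod_H_linear)
qed (simp_all add: linear_operator_zero linear_operator_add linear_operator_scale linear_operator_commutator
    del: zero_fun_apply plus_fun_apply)

lemma mod_eval_simple: "x \<in> mod_simple \<Lambda> \<Longrightarrow> mod_eval \<Lambda> t x \<in> mod_simple \<Lambda>"
proof (induction t arbitrary: x)
  case (LGen g)
  then show ?case by (cases g) (simp_all add: mod_simple_E mod_simple_F mod_simple_H)
qed (simp_all add: fun_space.span_zero fun_space.span_add fun_space.span_scale fun_space.span_diff
    operator_scale_def commutator_def)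

text \<open>This transports nonvanishing: an expression that acts nontrivially on the module cannot
  be congruent to zero, hence is nonzero in the Lie algebra.\<close>

lemma mod_eval_cong:
  assumes "lie_cong (km_relations K) t u" "\<Lambda> \<in> hdual K" "x \<in> mod_simple \<Lambda>"
  shows "mod_eval \<Lambda> t x = mod_eval \<Lambda> u x"
  using assms(1,3)
proof (induction arbitrary: x rule: lie_cong.induct)
  case (rel t u)
  \<comment> \<open>All relations other than the Serre relations hold as identities of operators on
    all functions; only the Serre relations use that x lies in
    \<open>mod_simple \<Lambda>\<close>.\<close>
  have eqI: "A x = B x" if "A = B" for A B :: "'i list operator" using that by simp
  have weight: "word_weight \<Lambda> u (hscale K c h + h') = c * word_weight \<Lambda> u h + word_weight \<Lambda> u h'" for u c h h'
  proof (induction u)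
    case Nil
    then show ?case using assms(2) by (simp add: word_weight_def hdual_iff)
  next
    case (Cons k u)
    then show ?case using root_hdual[of k]
      by (simp add: word_weight_def hdual_iff algebra_simps)
  qed
  show ?case using rel.hyps
  proof cases
    case (H_linear c h h')
    show ?thesis unfolding H_linear by (simp add: mod_H_def weight operator_scale_def fun_scale_def fun_eq_iff) (simp add: algebra_simps)
  next
    case (serre_E i j)
    then show ?thesis using rel.prems by (simp add: lie_eval_bracket_pow mod_serre_E)
  next
    case (serre_F i j)
    then show ?thesis using rel.prems by (simp add: lie_eval_bracket_pow mod_serre_F)
  qed (auto intro!: eqI simp: mod_H_H mod_H_E mod_H_F mod_E_F)
next
  case (cong_br t t' u u')
  then have "mod_eval \<Lambda> t (mod_eval \<Lambda> u x) = mod_eval \<Lambda> t' (mod_eval \<Lambda> u' x)"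
    "mod_eval \<Lambda> u (mod_eval \<Lambda> t x) = mod_eval \<Lambda> u' (mod_eval \<Lambda> t' x)"
    using cong_br.prems cong_br.IH(1)[OF mod_eval_simple] cong_br.IH(2)[OF mod_eval_simple]
    unfolding cong_br.IH(1)[OF cong_br.prems] cong_br.IH(2)[OF cong_br.prems] by blast+
  then show ?case unfolding lie_eval.simps(5) by (simp only: commutator_apply)
qed (simp_all add: operator_scale_def commutator_def linear_operator_simps[OF mod_eval_linear]
    fun_space.scale_right_distrib fun_space.scale_left_distrib fun_space.scale_right_diff_distrib)

text \<open>The Weyl vector, available because the simple coroots are independent. It serves as the
  character of the module, where it gives e_i f_i vacuum = vacuum, and as the regular vector in the
  construction of longest elements.\<close>

lemma ex_rho: "\<exists>\<rho>\<in>hdual K. \<forall>i\<in>I. \<rho> (\<alpha>c i) = 1"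
proof -
  interpret C: vector_space "(*) :: complex \<Rightarrow> complex \<Rightarrow> complex"
    by unfold_locales (auto simp: algebra_simps)
  interpret p: vector_space_pair "hscale K" "(*) :: complex \<Rightarrow> complex \<Rightarrow> complex" ..
  have "hspace.independent (\<alpha>c ` I)" using real by (simp add: realization_def)
  from p.linear_independent_extend[OF this, of "\<lambda>_. 1"] show ?thesis
    by (auto simp: hdual_def)
qed

text \<open>The point is that \<open>E i\<close> is nonzero: otherwise the presentation would make
  its expression congruent to zero, whereas e_i f_i fixes the vacuum of the module for
  \<rho>.\<close>

lemma simple_root_is_root: "i \<in> I \<Longrightarrow> is_root K (\<alpha> i)"
proof -
  assume i: "i \<in> I"
  obtain \<rho> where \<rho>: "\<rho> \<in> hdual K" "\<forall>i\<in>I. \<rho> (\<alpha>c i) = 1" using ex_rho by blast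
  have "E i \<noteq> 0"
  proof
    assume "E i = 0"
    then have "lie_eval (gscale K) (bracket K) (km_gen K) (LGen (GenE i)) = lie_eval (gscale K) (bracket K) (km_gen K) LZero"
      by simp
    moreover have "lie_gens (LGen (GenE i)) \<subseteq> km_generators K" using i by (simp add: km_generators_def)
    ultimately have "lie_cong (km_relations K) (LGen (GenE i)) LZero"
      using presentation unfolding lie_presentation_def by (metis empty_subsetI lie_term.set(2))
    moreover have "mod_word \<rho> [i] \<in> mod_simple \<rho>" by (rule fun_space.span_base[OF rangeI])
    ultimately have "mod_E i (mod_word \<rho> [i]) = 0"
      using mod_eval_cong[OF _ \<rho>(1)] by fastforce
    then have "mod_E i (mod_word \<rho> [i]) [] = 0" by simp
    then show False using \<rho>(2) i by (simp add: mod_E_def mod_F_def mod_H_def word_weight_def vacuum_def)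
  qed
  moreover have "E i \<in> ad.wt (\<alpha> i)" using H_E[OF i] by (simp add: ad.wt_iff)
  ultimately show ?thesis using i root_nonzero by (auto simp: is_root_def root_space_eq)
qed

end

section \<open>The action of the Weyl group on the root lattice\<close>

context kac_moody
begin

abbreviation "word_act \<equiv> foldr s"

lemma word_act_add: "word_act w (\<mu> + \<nu>) = word_act w \<mu> + word_act w \<nu>"
  by (induction w) (simp_all add: s_add del: plus_fun_apply)

lemma word_act_diff: "word_act w (\<mu> - \<nu>) = word_act w \<mu> - word_act w \<nu>"
  by (induction w) (simp_all add: s_diff del: minus_apply)

lemma word_act_scale: "word_act w (fun_scale c \<mu>) = fun_scale c (word_act w \<mu>)"
  by (induction w) (simp_all add: s_scale)

lemma word_act_0: "word_act w 0 = 0"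
  using word_act_diff[of w 0 0] by (metis diff_self)

lemma word_act_minus: "word_act w (- \<mu>) = - word_act w \<mu>"
  using word_act_diff[of w 0 \<mu>] by (metis diff_0 word_act_0)

lemma word_act_sum: "word_act w (\<Sum>x\<in>A. f x) = (\<Sum>x\<in>A. word_act w (f x))"
  by (induction A rule: infinite_finite_induct) (simp_all add: word_act_0 word_act_add del: plus_fun_apply zero_fun_apply)

lemma word_act_root_comb:
  "word_act w (root_comb z) = (\<Sum>i\<in>I. fun_scale (of_int (z i)) (word_act w (\<alpha> i)))"
  by (simp add: root_comb_def word_act_sum word_act_scale)

lemma word_act_rev: "set w \<subseteq> I \<Longrightarrow> word_act (rev w) (word_act w \<mu>) = \<mu>"
  by (induction w arbitrary: \<mu>) auto

lemma word_act_rev': "set w \<subseteq> I \<Longrightarrow> word_act w (word_act (rev w) \<mu>) = \<mu>"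
  using word_act_rev[of "rev w" \<mu>] by simp

lemma word_act_hdual: "set w \<subseteq> I \<Longrightarrow> \<mu> \<in> hdual K \<Longrightarrow> word_act w \<mu> \<in> hdual K"
  by (induction w) (auto intro: s_hdual)

lemma s_root_comb:
  assumes "i \<in> I"
  shows "s i (root_comb z) = root_comb (\<lambda>k. z k - of_bool (k = i) * (\<Sum>j\<in>I. z j * a i j))"
proof -
  have "fun_scale (root_comb z (\<alpha>c i)) (\<alpha> i) = root_comb (\<lambda>k. (\<Sum>j\<in>I. z j * a i j) * of_bool (k = i))"
    by (simp only: root_comb_pairing[OF assms] root_comb_scale[symmetric] root_comb_unit[OF assms])
  then show ?thesis
    by (simp add: simple_reflection_def root_comb_diff mult.commute)
qed

lemma word_act_root_comb_ex: "set w \<subseteq> I \<Longrightarrow> \<exists>z'. word_act w (root_comb z) = root_comb z'"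
proof (induction w)
  case (Cons i w)
  then obtain z' where "word_act w (root_comb z) = root_comb z'" by auto
  then show ?case using s_root_comb[of i z'] Cons.prems by auto
qed auto

lemma word_act_root_ex: "set w \<subseteq> I \<Longrightarrow> k \<in> I \<Longrightarrow> \<exists>z. word_act w (\<alpha> k) = root_comb z"
  using word_act_root_comb_ex root_comb_unit by metis

lemma word_act_root: "set w \<subseteq> I \<Longrightarrow> k \<in> I \<Longrightarrow> is_root K (word_act w (\<alpha> k))"
proof (induction w)
  case (Cons i w)
  then obtain z where "word_act w (\<alpha> k) = root_comb z" using word_act_root_ex[of w k] by auto
  then show ?case using Cons root_reflect[of _ z i] by auto
qed (simp add: simple_root_is_root)

lemma word_act_root_pos_or_neg:
  "set w \<subseteq> I \<Longrightarrow> k \<in> I \<Longrightarrow> word_act w (\<alpha> k) \<in> pos_cone \<or> - word_act w (\<alpha> k) \<in> pos_cone"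
  using word_act_root root_pos_or_neg by blast

lemma word_act_root_nonzero: "set w \<subseteq> I \<Longrightarrow> k \<in> I \<Longrightarrow> word_act w (\<alpha> k) \<noteq> 0"
  using word_act_root by (auto simp: is_root_def)

lemma word_act_integral:
  assumes "set w \<subseteq> I" "\<And>i. i \<in> set w \<Longrightarrow> \<mu> (\<alpha>c i) \<in> \<int>"
  shows "\<exists>z. word_act w \<mu> = \<mu> - root_comb z"
  using assms
proof (induction w)
  case Nil
  then show ?case using root_comb_0 by (metis diff_zero foldr_Nil id_apply)
next
  case (Cons i w)
  from Cons.prems have "set w \<subseteq> I" "\<And>i. i \<in> set w \<Longrightarrow> \<mu> (\<alpha>c i) \<in> \<int>" by simp_all
  from Cons.IH[OF this] obtain z where z: "word_act w \<mu> = \<mu> - root_comb z" ..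
  obtain m where m: "\<mu> (\<alpha>c i) = of_int m" using Cons.prems(2)[of i] Ints_cases by auto
  have i: "i \<in> I" using Cons.prems by simp
  have "s i \<mu> = \<mu> - root_comb (\<lambda>k. m * of_bool (k = i))"
    by (simp only: simple_reflection_def m root_comb_scale[symmetric] root_comb_unit[OF i])
  then have "word_act (i # w) \<mu> = \<mu> - root_comb (\<lambda>k. m * of_bool (k = i)) - s i (root_comb z)"
    by (simp add: z s_diff del: minus_apply)
  then show ?case unfolding s_root_comb[OF i] diff_diff_eq root_comb_add by blast
qed

text \<open>\<open>s i\<close> changes only the coordinate at \<alpha> i, so a positive root made
  negative has no other coordinate and equals n \<alpha> i. As w^(-1) \<alpha> i is integral, n
  divides 1, the coordinate of \<alpha> k at k.\<close>

lemma reflect_positive_root: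
  assumes "set w \<subseteq> I" "k \<in> I" "i \<in> I"
    and pos: "word_act w (\<alpha> k) \<in> pos_cone" and ne: "word_act w (\<alpha> k) \<noteq> \<alpha> i"
  shows "s i (word_act w (\<alpha> k)) \<in> pos_cone"
proof (rule ccontr)
  assume neg: "s i (word_act w (\<alpha> k)) \<notin> pos_cone"
  obtain n where n: "word_act w (\<alpha> k) = root_comb n" using word_act_root_ex[OF assms(1,2)] by blast
  have n_nonneg: "\<forall>j\<in>I. n j \<ge> 0" using pos by (simp add: n root_comb_in_pos_cone)
  have "- s i (word_act w (\<alpha> k)) \<in> pos_cone"
    using word_act_root_pos_or_neg[of "i # w" k] assms neg by simp
  then have "n j = 0" if "j \<in> I" "j \<noteq> i" for j
    using n_nonneg that unfolding n s_root_comb[OF assms(3)] minus_root_comb_in_pos_cone by force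
  then have "root_comb n = root_comb (\<lambda>j. n i * of_bool (j = i))" by (intro root_comb_cong) auto
  then have n_i: "word_act w (\<alpha> k) = fun_scale (of_int (n i)) (\<alpha> i)"
    by (simp only: n root_comb_scale[symmetric] root_comb_unit[OF assms(3)])
  obtain z where z: "word_act (rev w) (\<alpha> i) = root_comb z"
    using word_act_root_ex[of "rev w" i] assms by auto
  have "root_comb (\<lambda>j. of_bool (j = k)) = word_act (rev w) (word_act w (\<alpha> k))"
    by (simp add: word_act_rev assms root_comb_unit)
  also have "\<dots> = root_comb (\<lambda>j. n i * z j)" by (simp add: n_i word_act_scale z root_comb_scale)
  finally have "n i * z k = 1" using assms(2) by (auto simp: root_comb_inject)
  then have "n i = 1" using n_nonneg assms(3) by (simp add: zmult_eq_1_iff) (auto dest: bspec)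
  then show False using ne n_i by simp
qed

text \<open>
  The composition \<open>s\<^sub>i u s\<^sub>j u\<inverse>\<close> moves every simple root by a multiple of \<open>\<alpha>\<^sub>i\<close>, and since it and
  its inverse preserve the signs of the simple roots other than \<open>\<alpha>\<^sub>i\<close>, these multiples vanish.
\<close>

lemma conjugate_reflection:
  assumes u: "set u \<subseteq> I" and ij: "i \<in> I" "j \<in> I" and eq: "word_act u (\<alpha> j) = \<alpha> i" and x: "x = root_comb z"
  shows "word_act u (s j x) = s i (word_act u x)"
proof -
  define c where "c x = word_act (rev u) x (\<alpha>c j) - x (\<alpha>c i)" for x
  define t where "t = [i] @ u @ [j] @ rev u"
  have t_I: "set t \<subseteq> I" "set (rev t) \<subseteq> I" using u ij by (auto simp: t_def)
  have t: "word_act t x = x + fun_scale (c x) (\<alpha> i)" for x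
  proof -
    let ?y = "word_act (rev u) x"
    have "word_act u (s j ?y) = x - fun_scale (?y (\<alpha>c j)) (\<alpha> i)"
      by (simp only: simple_reflection_def[of K j] word_act_diff word_act_scale word_act_rev'[OF u] eq)
    then have "word_act t x = s i (x - fun_scale (?y (\<alpha>c j)) (\<alpha> i))" by (simp add: t_def)
    also have "\<dots> = x + fun_scale (c x) (\<alpha> i)"
      using pairing_diag[OF ij(1)]
      by (simp add: simple_reflection_def c_def fun_scale_def fun_eq_iff algebra_simps)
    finally show ?thesis .
  qed
  have "word_act (rev u) (\<alpha> i) = \<alpha> j" using word_act_rev[OF u, of "\<alpha> j"] eq by simp
  then have ci: "c (\<alpha> i) = 0" using ij by (simp add: c_def)
  have "c (\<alpha> k) = 0" if k: "k \<in> I" for k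
  proof (cases "k = i")
    case False
    obtain z where "word_act (rev u) (\<alpha> k) = root_comb z" using word_act_root_ex[of "rev u" k] u k by auto
    then have "c (\<alpha> k) \<in> \<int>" using ij k by (simp add: c_def pairing root_comb_pairing del: of_int_sum)
    then obtain m where m: "c (\<alpha> k) = of_int m" by (elim Ints_cases)
    have comb: "\<alpha> k + fun_scale (of_int m) (\<alpha> i) = root_comb (\<lambda>l. of_bool (l = k) + m * of_bool (l = i))" for m
      by (simp only: root_comb_add[symmetric] root_comb_scale[symmetric] root_comb_unit[OF k] root_comb_unit[OF ij(1)])
    have sgn: "m \<ge> 0" if "word_act v (\<alpha> k) = \<alpha> k + fun_scale (of_int m) (\<alpha> i)" "set v \<subseteq> I" for v m
      using word_act_root_pos_or_neg[OF that(2) k] k ij False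
      unfolding that(1) comb root_comb_in_pos_cone minus_root_comb_in_pos_cone
      by (auto dest: bspec[of _ _ i] bspec[of _ _ k])
    have "m \<ge> 0" using sgn[OF _ t_I(1), of m] t[of "\<alpha> k"] m by simp
    moreover have "- m \<ge> 0"
    proof (rule sgn[OF _ t_I(2)])
      have "\<alpha> i = word_act (rev t) (word_act t (\<alpha> i))" by (simp only: word_act_rev[OF t_I(1)])
      then have ti: "word_act (rev t) (\<alpha> i) = \<alpha> i" by (simp only: t ci) (simp add: fun_scale_def plus_fun_def)
      have "\<alpha> k = word_act (rev t) (word_act t (\<alpha> k))" by (simp only: word_act_rev[OF t_I(1)])
      also have "\<dots> = word_act (rev t) (\<alpha> k) + fun_scale (of_int m) (\<alpha> i)"
        by (simp only: t[of "\<alpha> k"] m word_act_add word_act_scale ti)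
      finally show "word_act (rev t) (\<alpha> k) = \<alpha> k + fun_scale (of_int (- m)) (\<alpha> i)"
        by (simp add: fun_eq_iff fun_scale_def algebra_simps)
    qed
    ultimately show ?thesis using m by simp
  qed (simp add: ci)
  then have t_root: "word_act t (\<alpha> k) = \<alpha> k" if "k \<in> I" for k
    using t[of "\<alpha> k"] that by (simp add: fun_scale_def fun_eq_iff)
  obtain z' where z': "word_act u x = root_comb z'" using word_act_root_comb_ex[OF u] x by blast
  have "word_act t (word_act u x) = word_act u x"
    unfolding z' word_act_root_comb by (simp add: t_root root_comb_def)
  then have "s i (word_act u (s j x)) = word_act u x" by (simp add: t_def word_act_rev[OF u])
  then show ?thesis using s_s[OF ij(1)] by metis
qed

text \<open>
  Words are compared through their action on the roots: a priori, different elements of the Weyl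
  group might act in the same way on the root lattice.
\<close>

definition reduced :: "'i set \<Rightarrow> 'i list \<Rightarrow> bool" where
  "reduced J w \<longleftrightarrow> set w \<subseteq> J \<and>
     (\<forall>v. set v \<subseteq> J \<longrightarrow> (\<forall>k\<in>I. word_act v (\<alpha> k) = word_act w (\<alpha> k)) \<longrightarrow> length w \<le> length v)"

lemma word_act_eq_on_roots:
  "(\<And>k. k \<in> I \<Longrightarrow> word_act v (\<alpha> k) = word_act w (\<alpha> k)) \<Longrightarrow> word_act v (root_comb z) = word_act w (root_comb z)"
  unfolding word_act_root_comb by (intro sum.cong) auto

lemma ex_reduced:
  assumes "set w \<subseteq> J"
  shows "\<exists>v. reduced J v \<and> (\<forall>k\<in>I. word_act v (\<alpha> k) = word_act w (\<alpha> k))"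
proof -
  let ?P = "\<lambda>v. set v \<subseteq> J \<and> (\<forall>k\<in>I. word_act v (\<alpha> k) = word_act w (\<alpha> k))"
  have "?P w" using assms by simp
  from ex_has_least_nat[of ?P w length, OF this] show ?thesis unfolding reduced_def by metis
qed

lemma reduced_prefix:
  assumes "reduced J (w @ [i])" "i \<in> I"
  shows "reduced J w"
  unfolding reduced_def
proof (intro conjI allI impI)
  show "set w \<subseteq> J" using assms by (simp add: reduced_def)
  fix v assume v: "set v \<subseteq> J" "\<forall>k\<in>I. word_act v (\<alpha> k) = word_act w (\<alpha> k)"
  have "word_act (v @ [i]) (\<alpha> k) = word_act (w @ [i]) (\<alpha> k)" if "k \<in> I" for k
  proof -
    obtain z where "s i (\<alpha> k) = root_comb z" using word_act_root_ex[of "[i]" k] assms(2) \<open>k \<in> I\<close> by auto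
    then show ?thesis using word_act_eq_on_roots[of v w z] v(2) by simp
  qed
  then show "length w \<le> length v"
    using assms v(1) unfolding reduced_def by (auto dest!: spec[of _ "v @ [i]"])
qed

text \<open>The exchange argument. If w \<alpha> i were not positive, the sign would change at some
  letter t of w = x t y, which forces y \<alpha> i = \<alpha> t. Then s_t y = y s_i on the roots,
  and w s_i acts as x y, a word shorter by two letters.\<close>

lemma reduced_last_positive:
  assumes red: "reduced J (w @ [i])" and J: "J \<subseteq> I"
  shows "word_act w (\<alpha> i) \<in> pos_cone"
proof (rule ccontr)
  assume neg: "word_act w (\<alpha> i) \<notin> pos_cone"
  have wi: "set w \<subseteq> I" "i \<in> I" using red J by (auto simp: reduced_def)
  have "\<exists>x t y. w = x @ [t] @ y \<and> word_act y (\<alpha> i) \<in> pos_cone \<and> s t (word_act y (\<alpha> i)) \<notin> pos_cone"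
    using neg
  proof (induction w)
    case Nil
    then show ?case using root_in_pos_cone wi by simp
  next
    case (Cons t w)
    show ?case
    proof (cases "word_act w (\<alpha> i) \<in> pos_cone")
      case True
      then show ?thesis using Cons.prems by (intro exI[of _ "[]"]) auto
    next
      case False
      then obtain x t' y where "w = x @ [t'] @ y" "word_act y (\<alpha> i) \<in> pos_cone"
        "s t' (word_act y (\<alpha> i)) \<notin> pos_cone" using Cons.IH by blast
      then show ?thesis by (intro exI[of _ "t # x"]) auto
    qed
  qed
  then obtain x t y where w: "w = x @ [t] @ y" and y: "word_act y (\<alpha> i) \<in> pos_cone"
    "s t (word_act y (\<alpha> i)) \<notin> pos_cone" by blast
  have I: "set y \<subseteq> I" "t \<in> I" using wi w by auto
  have eq: "word_act y (\<alpha> i) = \<alpha> t" using reflect_positive_root[OF I(1) wi(2) I(2)] y by blast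
  have "word_act (x @ y) (\<alpha> k) = word_act (w @ [i]) (\<alpha> k)" if "k \<in> I" for k
    using conjugate_reflection[OF I wi(2) eq root_comb_unit[OF that, symmetric]] I(2) by (simp add: w)
  moreover have "set (x @ y) \<subseteq> J" using red by (simp add: w reduced_def)
  ultimately have "length (w @ [i]) \<le> length (x @ y)" using red unfolding reduced_def by blast
  then show False by (simp add: w)
qed

text \<open>The last letter i of a reduced word v s_i contributes a nonnegative multiple of v
  \<alpha> i, which is positive by \<open>reduced_last_positive\<close>. Passing from w to a reduced
  word is harmless, as the element lies in the root lattice.\<close>

lemma antidominant_minimal:
  assumes J: "J \<subseteq> I" and w: "set w \<subseteq> J" and z: "\<And>i. i \<in> J \<Longrightarrow> (\<Sum>k\<in>I. z k * a i k) \<le> 0"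
  shows "word_act w (root_comb z) - root_comb z \<in> pos_cone"
proof -
  obtain v where v: "reduced J v" "\<forall>k\<in>I. word_act v (\<alpha> k) = word_act w (\<alpha> k)"
    using ex_reduced[OF w] by blast
  have "word_act v (root_comb z) - root_comb z \<in> pos_cone"
    using v(1)
  proof (induction v rule: rev_induct)
    case (snoc i v)
    have i: "i \<in> J" "i \<in> I" using snoc.prems J by (auto simp: reduced_def)
    let ?m = "nat (- (\<Sum>k\<in>I. z k * a i k))"
    have "root_comb z (\<alpha>c i) = - of_nat ?m" using z[OF i(1)] by (simp add: root_comb_pairing[OF i(2)])
    then have "word_act (v @ [i]) (root_comb z) = word_act v (root_comb z) + fun_scale (of_nat ?m) (word_act v (\<alpha> i))"
      by (simp add: simple_reflection_def word_act_add word_act_scale del: plus_fun_apply of_nat_nat)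
    moreover have "fun_scale (of_nat ?m) (word_act v (\<alpha> i)) \<in> pos_cone"
      using reduced_last_positive[OF snoc.prems J] by (rule pos_cone_scale)
    moreover have "x + y - z = (x - z) + y" for x y z :: "'h \<Rightarrow> complex" by simp
    moreover note pos_cone_add[OF snoc.IH[OF reduced_prefix[OF snoc.prems i(2)]]]
    ultimately show ?case by (simp only:)
  qed simp
  then show ?thesis using word_act_eq_on_roots[of v w] v(2) by simp
qed

text \<open>
  An antidominant nonnegative combination does not decrease under \<open>w\<close>, so \<open>w\<close> cannot make all its
  terms negative.
\<close>

lemma antidominant_negated:
  assumes J: "J \<subseteq> I" and w: "set w \<subseteq> J" and z: "\<And>i. i \<in> J \<Longrightarrow> (\<Sum>k\<in>I. z k * a i k) \<le> 0"
    and nonneg: "\<And>k. k \<in> I \<Longrightarrow> z k \<ge> 0"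
    and neg: "\<And>k. k \<in> I \<Longrightarrow> z k \<noteq> 0 \<Longrightarrow> - word_act w (\<alpha> k) \<in> pos_cone"
    and k: "k \<in> I"
  shows "z k = 0"
proof -
  have le: "word_act w (root_comb z) - root_comb z \<in> pos_cone"
    by (rule antidominant_minimal[OF J w z])
  have zp: "root_comb z \<in> pos_cone" using nonneg by (simp add: root_comb_in_pos_cone)
  have pos: "word_act w (root_comb z) \<in> pos_cone"
    using pos_cone_add[OF le zp] by simp
  have "- word_act w (root_comb z) = (\<Sum>i\<in>I. fun_scale (of_nat (nat (z i))) (- word_act w (\<alpha> i)))"
    unfolding word_act_root_comb using nonneg by (simp add: sum_negf[symmetric] del: sum_negf)
  also have "\<dots> \<in> pos_cone"
  proof (rule pos_cone_sum)
    fix i assume i: "i \<in> I"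
    show "fun_scale (of_nat (nat (z i))) (- word_act w (\<alpha> i)) \<in> pos_cone"
    proof (cases "z i = 0")
      case True
      then have "fun_scale (of_nat (nat (z i))) (- word_act w (\<alpha> i)) = 0"
        by (simp add: fun_scale_def fun_eq_iff)
      then show ?thesis by (simp only: zero_in_pos_cone)
    next
      case False
      then show ?thesis using neg[OF i] by (intro pos_cone_scale)
    qed
  qed
  finally have "word_act w (root_comb z) = 0" using pos_cone_antisym[OF pos] by simp
  then have "root_comb z = 0" using le pos_cone_antisym[OF zp] by simp
  then show ?thesis using k by (simp add: root_comb_eq_0)
qed

text \<open>A nonempty reduced word makes the simple root of its last letter negative.\<close>

lemma positive_imp_trivial:
  assumes J: "J \<subseteq> I" and w: "set w \<subseteq> J" and pos: "\<And>i. i \<in> J \<Longrightarrow> word_act w (\<alpha> i) \<in> pos_cone"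
    and k: "k \<in> I"
  shows "word_act w (\<alpha> k) = \<alpha> k"
proof -
  obtain v where v: "reduced J v" "\<forall>k\<in>I. word_act v (\<alpha> k) = word_act w (\<alpha> k)"
    using ex_reduced[OF w] by blast
  have "v = []"
  proof (rule ccontr)
    assume "v \<noteq> []"
    then obtain u i where u: "v = u @ [i]" by (meson rev_exhaust)
    have i: "i \<in> J" "i \<in> I" "set u \<subseteq> I" using v(1) J by (auto simp: u reduced_def)
    have "s i (\<alpha> i) = - \<alpha> i"
      using pairing_diag[OF i(2)] by (simp add: simple_reflection_def fun_scale_def fun_eq_iff)
    then have "word_act v (\<alpha> i) = - word_act u (\<alpha> i)" by (simp add: u word_act_minus del: uminus_apply)
    moreover have "word_act u (\<alpha> i) \<in> pos_cone" using reduced_last_positive v(1) J by (simp add: u)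
    moreover have "word_act v (\<alpha> i) \<in> pos_cone" using v(2) pos i by simp
    ultimately have "word_act u (\<alpha> i) = 0" using pos_cone_antisym by metis
    then show False using word_act_root_nonzero i by blast
  qed
  then show ?thesis using v(2) k by auto
qed

text \<open>
  In a finite parabolic subgroup, an element \<open>w\<close> that minimizes \<open>w \<rho>\<close>, where \<open>\<rho>\<close> takes the
  value 1 at the simple coroots, makes all simple roots of the subgroup negative.
\<close>

lemma finite_parabolic_longest:
  assumes R: "R \<subseteq> I" and fin: "finite ((\<lambda>w. restrict (word_act w) (hdual K)) ` {w. set w \<subseteq> R})"
  shows "\<exists>w. set w \<subseteq> R \<and> (\<forall>i\<in>R. - word_act w (\<alpha> i) \<in> pos_cone)"
proof -
  obtain \<rho> where \<rho>: "\<rho> \<in> hdual K" "\<forall>i\<in>I. \<rho> (\<alpha>c i) = 1" using ex_rho by blast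
  \<comment> \<open>\<open>ht x\<close> is the height of \<rho> - x, so the lowest w \<rho> has the
    largest \<open>ht\<close>. The chosen coordinates are unique on I.\<close>
  define ht where "ht x = (\<Sum>i\<in>I. (SOME z. x = \<rho> - root_comb z) i)" for x
  have ht: "ht (\<rho> - root_comb z) = (\<Sum>i\<in>I. z i)" for z
  proof -
    have "\<rho> - root_comb z = \<rho> - root_comb (SOME z'. \<rho> - root_comb z = \<rho> - root_comb z')"
      by (rule someI[where P = "\<lambda>z'. \<rho> - root_comb z = \<rho> - root_comb z'"]) (rule HOL.refl)
    then have "root_comb z = root_comb (SOME z'. \<rho> - root_comb z = \<rho> - root_comb z')"
      using diff_left_imp_eq by blast
    then show ?thesis unfolding ht_def root_comb_inject by (intro sum.cong) auto
  qed
  have "(\<lambda>w. ht (word_act w \<rho>)) ` {w. set w \<subseteq> R}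
      = (\<lambda>f. ht (f \<rho>)) ` (\<lambda>w. restrict (word_act w) (hdual K)) ` {w. set w \<subseteq> R}"
    unfolding image_image using \<rho>(1) by simp
  then have fin': "finite ((\<lambda>w. ht (word_act w \<rho>)) ` {w. set w \<subseteq> R})" using fin by simp
  define m where "m = Max ((\<lambda>w. ht (word_act w \<rho>)) ` {w. set w \<subseteq> R})"
  have "m \<in> (\<lambda>w. ht (word_act w \<rho>)) ` {w. set w \<subseteq> R}"
    unfolding m_def using fin' by (intro Max_in) (auto intro: exI[of _ "[]"])
  then obtain w where w: "set w \<subseteq> R" "ht (word_act w \<rho>) = m" by blast
  have max: "ht (word_act v \<rho>) \<le> m" if "set v \<subseteq> R" for v
    unfolding m_def using fin' that by (intro Max_ge) auto
  have "- word_act w (\<alpha> i) \<in> pos_cone" if i: "i \<in> R" for i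
  proof (rule ccontr)
    assume neg: "- word_act w (\<alpha> i) \<notin> pos_cone"
    have wI: "set w \<subseteq> I" and iI: "i \<in> I" using w R i by auto
    have "\<rho> (\<alpha>c k) \<in> \<int>" if "k \<in> set w" for k using \<rho>(2) wI that by auto
    then obtain z where z: "word_act w \<rho> = \<rho> - root_comb z" using word_act_integral[OF wI, of \<rho>] by blast
    obtain n where n: "word_act w (\<alpha> i) = root_comb n" using word_act_root_ex[OF wI iI] by blast
    have pos: "\<forall>k\<in>I. n k \<ge> 0"
      using word_act_root_pos_or_neg[OF wI iI] neg by (simp add: n root_comb_in_pos_cone)
    \<comment> \<open>Appending i would lower w \<rho> further by the positive root w \<alpha> i,
      against the maximality of \<open>m\<close>.\<close>
    have "s i \<rho> = \<rho> - \<alpha> i"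
      using \<rho>(2) iI by (simp add: simple_reflection_def fun_scale_def fun_eq_iff)
    then have "word_act (w @ [i]) \<rho> = \<rho> - root_comb z - root_comb n"
      by (simp add: word_act_diff z n del: minus_apply)
    then have "word_act (w @ [i]) \<rho> = \<rho> - root_comb (\<lambda>k. z k + n k)"
      by (simp only: diff_diff_eq root_comb_add)
    then have "(\<Sum>k\<in>I. z k + n k) \<le> (\<Sum>k\<in>I. z k)"
      using max[of "w @ [i]"] w i by (simp only: z ht) simp
    then have "(\<Sum>k\<in>I. n k) \<le> 0" by (simp add: sum.distrib)
    moreover have "(\<Sum>k\<in>I. n k) \<ge> 0" using pos by (intro sum_nonneg) simp
    ultimately have "\<forall>k\<in>I. n k = 0" using pos sum_nonneg_eq_0_iff[of I n] by simp
    then have "word_act w (\<alpha> i) = 0" by (simp add: n root_comb_eq_0)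
    then show False using word_act_root_nonzero[OF wI iI] by simp
  qed
  then show ?thesis using w(1) by blast
qed

end

text \<open>
  \<open>R\<close> is the set where the ratio \<open>c k / \<delta> k\<close> attains its minimum \<open>t\<close>: there \<open>c - t \<delta>\<close> vanishes,
  so its product with a row of the matrix is both nonpositive and nonnegative.
\<close>

lemma minimal_ratio_subset:
  fixes a :: "'i \<Rightarrow> 'i \<Rightarrow> int" and c \<delta> l :: "'i \<Rightarrow> int"
  assumes U: "finite U" "U \<noteq> {}" and a: "\<And>i k. i \<in> U \<Longrightarrow> k \<in> U \<Longrightarrow> i \<noteq> k \<Longrightarrow> a i k \<le> 0"
    and \<delta>: "\<And>i. i \<in> U \<Longrightarrow> \<delta> i > 0" "\<And>i. i \<in> U \<Longrightarrow> (\<Sum>k\<in>U. \<delta> k * a i k) \<le> 0"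
    and c: "\<And>i. i \<in> U \<Longrightarrow> c i \<ge> 0" "\<And>i. i \<in> U \<Longrightarrow> (\<Sum>k\<in>U. c k * a i k) \<ge> l i"
    and l: "\<And>i. i \<in> U \<Longrightarrow> l i \<ge> 0"
  shows "\<exists>R\<subseteq>U. R \<noteq> {} \<and> (\<forall>i\<in>R. l i = 0 \<and> (\<forall>k\<in>U - R. a i k = 0))"
proof -
  define t where "t = Min ((\<lambda>i. real_of_int (c i) / real_of_int (\<delta> i)) ` U)"
  define z where "z i = real_of_int (c i) - t * real_of_int (\<delta> i)" for i
  define R where "R = {i \<in> U. z i = 0}"
  have t_le: "t \<le> real_of_int (c i) / real_of_int (\<delta> i)" if "i \<in> U" for i
    unfolding t_def using U that by (intro Min_le) auto
  have t_in: "t \<in> (\<lambda>i. real_of_int (c i) / real_of_int (\<delta> i)) ` U"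
    unfolding t_def using U by (intro Min_in) auto
  have z_nonneg: "z i \<ge> 0" if "i \<in> U" for i
    using t_le[OF that] \<delta>(1)[OF that] by (simp add: z_def pos_le_divide_eq)
  have t_nonneg: "t \<ge> 0" using t_in c(1) \<delta>(1) by (force intro!: divide_nonneg_nonneg simp: less_imp_le)
  have "R \<noteq> {}" using t_in \<delta>(1) by (force simp: R_def z_def)
  moreover have "l i = 0 \<and> (\<forall>k\<in>U - R. a i k = 0)" if i: "i \<in> R" for i
  proof -
    have iU: "i \<in> U" and zi: "z i = 0" using i by (auto simp: R_def)
    have terms: "z k * real_of_int (a i k) \<le> 0" if "k \<in> U" for k
      using z_nonneg[OF that] a[OF iU that] zi by (cases "k = i") (auto simp: mult_le_0_iff)
    have "(\<Sum>k\<in>U. z k * real_of_int (a i k))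
        = real_of_int (\<Sum>k\<in>U. c k * a i k) - t * real_of_int (\<Sum>k\<in>U. \<delta> k * a i k)"
      by (simp add: z_def algebra_simps sum_subtractf sum_distrib_left)
    moreover have "t * real_of_int (\<Sum>k\<in>U. \<delta> k * a i k) \<le> 0"
      using t_nonneg \<delta>(2)[OF iU] by (simp add: mult_le_0_iff flip: of_int_sum of_int_mult)
    moreover have "real_of_int (l i) \<le> real_of_int (\<Sum>k\<in>U. c k * a i k)" using c(2)[OF iU] by linarith
    ultimately have ge: "(\<Sum>k\<in>U. z k * real_of_int (a i k)) \<ge> real_of_int (l i)" by linarith
    have le: "(\<Sum>k\<in>U. z k * real_of_int (a i k)) \<le> 0" using terms by (intro sum_nonpos) auto
    have "l i = 0" using ge le l[OF iU] by linarith
    moreover have "(\<Sum>k\<in>U. - (z k * real_of_int (a i k))) = 0"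
      using ge le l[OF iU] by (simp add: sum_negf)
    then have "\<forall>k\<in>U. - (z k * real_of_int (a i k)) = 0"
      using terms U(1) by (subst (asm) sum_nonneg_eq_0_iff) auto
    then have "\<forall>k\<in>U - R. a i k = 0" by (auto simp: R_def)
    ultimately show ?thesis by blast
  qed
  ultimately show ?thesis by (intro exI[of _ R]) (auto simp: R_def)
qed

section \<open>Weights of simple highest weight modules\<close>

context km_module
begin

abbreviation "F_word w v \<equiv> foldr (\<lambda>i. act (F i)) w v"

lemma F_word_weight:
  "set w \<subseteq> I \<Longrightarrow> v \<in> wt \<mu> \<Longrightarrow> \<exists>\<beta>\<in>pos_cone. F_word w v \<in> wt (\<mu> - \<beta>)"
proof (induction w)
  case Nil
  have "\<mu> - 0 = \<mu>" by simp
  then show ?case using Nil zero_in_pos_cone by (metis foldr_Nil id_apply)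
next
  case (Cons i w)
  have "\<exists>\<beta>\<in>pos_cone. F_word w v \<in> wt (\<mu> - \<beta>)" by (rule Cons.IH) (use Cons.prems in auto)
  then obtain \<beta> where \<beta>: "\<beta> \<in> pos_cone" "F_word w v \<in> wt (\<mu> - \<beta>)" ..
  have i: "i \<in> I" using Cons.prems by simp
  have "F_word (i # w) v \<in> wt (\<mu> - (\<beta> + \<alpha> i))"
    using wt_F[OF i \<beta>(2)] by (simp add: diff_diff_eq del: plus_fun_apply minus_apply)
  then show ?case using pos_cone_add[OF \<beta>(1) root_in_pos_cone[OF i]] by blast
qed

lemma singular_submodule:
  assumes v: "v \<in> wt \<mu>" "\<And>i. i \<in> I \<Longrightarrow> act (E i) v = 0"
  shows "lie_submodule vscale act (V.span ((\<lambda>w. F_word w v) ` {w. set w \<subseteq> I}))" (is "lie_submodule _ _ (V.span ?B)")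
proof (rule submoduleI)
  have step: "act x y \<in> V.span ?B" if "\<And>b. b \<in> ?B \<Longrightarrow> act x b \<in> V.span ?B" "y \<in> V.span ?B" for x y
    using that(2)
    by (induction rule: V.span_induct_alt) (auto simp: that(1) V.span_zero V.span_add V.span_scale)
  have H: "act (H h) (F_word w v) \<in> V.span ?B" if w: "set w \<subseteq> I" for h w
  proof -
    obtain \<beta> where "F_word w v \<in> wt (\<mu> - \<beta>)" using F_word_weight[OF w v(1)] by blast
    then have "act (H h) (F_word w v) = vscale ((\<mu> - \<beta>) h) (F_word w v)" by (simp add: wt_iff)
    then show ?thesis using w by (metis (mono_tags, lifting) V.span_base V.span_scale imageI mem_Collect_eq)
  qed
  have F: "act (F i) b \<in> V.span ?B" if "i \<in> I" "b \<in> ?B" for i b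
  proof -
    from that(2) obtain w where "set w \<subseteq> I" "b = F_word w v" by blast
    then have "act (F i) b = F_word (i # w) v" "set (i # w) \<subseteq> I" using that by auto
    then show ?thesis by (metis (mono_tags, lifting) V.span_base imageI mem_Collect_eq)
  qed
  have E: "act (E i) (F_word w v) \<in> V.span ?B" if i: "i \<in> I" and "set w \<subseteq> I" for i w
    using that(2)
  proof (induction w)
    case (Cons k w)
    then have k: "k \<in> I" "set w \<subseteq> I" by auto
    have "act (E i) (F_word (k # w) v)
        = act (F k) (act (E i) (F_word w v)) + act (if i = k then H (\<alpha>c i) else 0) (F_word w v)"
      using act_commute[of "E i" "F k" "F_word w v"] E_F[OF i k(1)] by simp
    then show ?case
      using step[OF F[OF k(1)] Cons.IH[OF k(2)]] H[OF k(2)] by (auto simp: V.span_add)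
  qed (simp add: v(2)[OF i] V.span_zero)
  show "V.subspace (V.span ?B)" by (rule V.subspace_span)
  show "act (H h) y \<in> V.span ?B" if "y \<in> V.span ?B" for h y using step[OF _ that] H by blast
  show "act (F i) y \<in> V.span ?B" if "i \<in> I" "y \<in> V.span ?B" for i y using step[OF F[OF that(1)] that(2)] .
  show "act (E i) y \<in> V.span ?B" if "i \<in> I" "y \<in> V.span ?B" for i y using step[OF _ that(2)] E[OF that(1)] by blast
qed

text \<open>v generates the simple module, so words in the \<open>F i\<close> applied to v span it.
  As v is an arbitrary singular vector, two singular vectors can be compared in both directions;
  this gives \<open>singular_weight\<close>.\<close>

lemma weights_below_singular:
  assumes v: "v \<in> wt \<mu>" "\<And>i. i \<in> I \<Longrightarrow> act (E i) v = 0" "v \<noteq> 0"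
    and simple: "\<And>N. lie_submodule vscale act N \<Longrightarrow> N = {0} \<or> N = UNIV"
    and x: "x \<in> wt \<nu>" "x \<noteq> 0"
  shows "\<mu> - \<nu> \<in> pos_cone"
proof -
  let ?B = "(\<lambda>w. F_word w v) ` {w. set w \<subseteq> I}"
  have "v = F_word [] v" by simp
  then have "v \<in> V.span ?B" by (intro V.span_base image_eqI[of _ _ "[]"]) auto
  then have "V.span ?B = UNIV" using simple[OF singular_submodule[OF v(1,2)]] v(3) by blast
  then have span: "x \<in> V.span ?B" by simp
  have "\<nu> \<in> {\<mu> - \<beta> |\<beta>. \<beta> \<in> pos_cone}"
  proof (rule weight_in_spanning_set[where T = "\<lambda>h. act (H h)", OF act_linear_right _ span x(2)])
    fix b assume "b \<in> ?B"
    then obtain w where "set w \<subseteq> I" "b = F_word w v" by blast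
    then show "\<exists>\<gamma>\<in>{\<mu> - \<beta> |\<beta>. \<beta> \<in> pos_cone}. \<forall>h. act (H h) b = vscale (\<gamma> h) b"
      using F_word_weight[OF _ v(1), of w] unfolding wt_iff by blast
  qed (use x(1) in \<open>simp add: wt_iff\<close>)
  then show ?thesis by auto
qed

end

locale simple_hw_module = km_module K vscale act
  for K :: "('i, 'h::ab_group_add, 'g::ab_group_add) kac_moody_data"
    and vscale :: "complex \<Rightarrow> 'v::ab_group_add \<Rightarrow> 'v" and act +
  fixes lam :: "'h \<Rightarrow> complex" and v0 :: 'v
  assumes lam: "lam \<in> hdual K"
    and simple: "\<And>N. lie_submodule vscale act N \<Longrightarrow> N = {0} \<or> N = UNIV"
    and v0: "v0 \<in> wt lam" "v0 \<noteq> 0" "\<And>i. i \<in> I \<Longrightarrow> act (E i) v0 = 0"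
begin

abbreviation "J \<equiv> integral_idx K lam"

lemma J_subset: "J \<subseteq> I"
  by (auto simp: integral_idx_def)

lemma J_pairing: "i \<in> J \<Longrightarrow> \<exists>m. lam (\<alpha>c i) = of_nat m"
  by (auto simp: integral_idx_def elim: Nats_cases)

lemma weight_le: "x \<in> wt \<mu> \<Longrightarrow> x \<noteq> 0 \<Longrightarrow> lam - \<mu> \<in> pos_cone"
  using weights_below_singular[OF v0(1,3,2) simple] by blast

lemma singular_weight:
  assumes "v \<in> wt \<mu>" "\<And>i. i \<in> I \<Longrightarrow> act (E i) v = 0" "v \<noteq> 0"
  shows "\<mu> = lam"
proof -
  have "\<mu> - lam \<in> pos_cone" using weights_below_singular[OF assms simple v0(1,2)] by blast
  moreover have "- (\<mu> - lam) \<in> pos_cone" using weight_le[OF assms(1,3)] by simp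
  ultimately show ?thesis using pos_cone_antisym[of "\<mu> - lam"] by simp
qed

lemma E_nilpotent: "i \<in> I \<Longrightarrow> \<exists>n. (act (E i) ^^ n) v = 0"
proof -
  assume i: "i \<in> I"
  have "(act (E i) ^^ 1) v0 = 0" using v0(3)[OF i] by simp
  then have "v0 \<in> {v. \<exists>n. (act (E i) ^^ n) v = 0}" by blast
  then have "{v. \<exists>n. (act (E i) ^^ n) v = 0} = UNIV"
    using simple[OF nilpotent_submodule[OF E_ad_nilpotent[OF i]]] v0(2) by blast
  then show ?thesis by blast
qed

text \<open>With m the value of lam at the coroot, F_i^(m+1) v0 is singular of a weight other than
  lam, hence zero. Simplicity spreads the nilpotency from v0 to all vectors.\<close>

lemma F_nilpotent: "i \<in> J \<Longrightarrow> \<exists>n. (act (F i) ^^ n) v = 0"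
proof -
  assume iJ: "i \<in> J"
  then have i: "i \<in> I" using J_subset by blast
  obtain m where m: "lam (\<alpha>c i) = of_nat m" using J_pairing[OF iJ] by blast
  let ?v = "(act (F i) ^^ Suc m) v0"
  interpret sl2: sl2_triple vscale "act (E i)" "act (F i)" "act (H (\<alpha>c i))" by (rule sl2[OF i])
  have "act (E k) ?v = 0" if k: "k \<in> I" for k
  proof (cases "k = i")
    case True
    have "act (H (\<alpha>c i)) v0 = vscale (of_nat m) v0" using v0(1) m by (simp add: wt_iff)
    from sl2.e_f_pow[OF this, of m] show ?thesis
      unfolding True using v0(3)[OF i] sl2.f_pow_zero[of "Suc m"] by (simp del: funpow.simps)
  next
    case False
    have "act (E k) ((act (F i) ^^ n) v0) = (act (F i) ^^ n) (act (E k) v0)" for n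
      by (induction n) (use False in \<open>simp_all add: act_commute[of "E k" "F i"] E_F[OF k i]\<close>)
    from this[of "Suc m"] show ?thesis using v0(3)[OF k] sl2.f_pow_zero[of "Suc m"] by (simp del: funpow.simps)
  qed
  moreover have "?v \<in> wt (lam - fun_scale (of_nat (Suc m)) (\<alpha> i))" by (rule wt_F_pow[OF i v0(1)])
  moreover have "lam - fun_scale (of_nat (Suc m)) (\<alpha> i) \<noteq> lam"
  proof
    assume "lam - fun_scale (of_nat (Suc m)) (\<alpha> i) = lam"
    then have "fun_scale (of_nat (Suc m)) (\<alpha> i) (\<alpha>c i) = 0"
      by (simp only: diff_eq_eq add_cancel_right_right zero_fun_apply)
    then show False using pairing_diag[OF i] by (simp add: fun_scale_def del: of_nat_Suc)
  qed
  ultimately have "?v = 0" using singular_weight by blast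
  then have "v0 \<in> {v. \<exists>n. (act (F i) ^^ n) v = 0}" by blast
  then have "{v. \<exists>n. (act (F i) ^^ n) v = 0} = UNIV"
    using simple[OF nilpotent_submodule[OF F_ad_nilpotent[OF i]]] v0(2) by blast
  then show ?thesis by blast
qed

text \<open>If \<open>F i\<close> were locally nilpotent everywhere,
  \<open>highest_weight_nat\<close> at v0 would make lam natural at the coroot; so by simplicity it
  is nilpotent at no nonzero vector.\<close>

lemma F_injective:
  assumes i: "i \<in> I" "i \<notin> J" and v: "act (F i) v = 0"
  shows "v = 0"
proof -
  let ?N = "{v. \<exists>n. (act (F i) ^^ n) v = 0}"
  have "?N \<noteq> UNIV"
  proof
    assume "?N = UNIV"
    then obtain n where n: "(act (F i) ^^ n) v0 = 0" by blast
    have "act (H (\<alpha>c i)) v0 = vscale (lam (\<alpha>c i)) v0" using v0(1) by (simp add: wt_iff)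
    from sl2_triple.highest_weight_nat[OF sl2[OF i(1)] v0(3)[OF i(1)] this n v0(2)]
    show False using i by (auto simp: integral_idx_def)
  qed
  then have "?N = {0}" using simple[OF nilpotent_submodule[OF F_ad_nilpotent[OF i(1)]]] by blast
  moreover have "(act (F i) ^^ 1) v = 0" using v by simp
  ultimately show ?thesis by blast
qed

lemma weight_integral: "lam - \<mu> = root_comb z \<Longrightarrow> i \<in> J \<Longrightarrow> \<exists>m. \<mu> (\<alpha>c i) = of_int m"
proof -
  assume z: "lam - \<mu> = root_comb z" and i: "i \<in> J"
  obtain m where "lam (\<alpha>c i) = of_nat m" using J_pairing[OF i] by blast
  moreover have "\<mu> (\<alpha>c i) = lam (\<alpha>c i) - root_comb z (\<alpha>c i)" unfolding z[symmetric] by simp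
  ultimately have "\<mu> (\<alpha>c i) = of_int (int m - (\<Sum>k\<in>I. z k * a i k))"
    using i J_subset by (auto simp: root_comb_pairing)
  then show ?thesis by blast
qed

lemma wt_reflect_iff:
  assumes i: "i \<in> J"
  shows "wt (s i \<mu>) \<noteq> {0} \<longleftrightarrow> wt \<mu> \<noteq> {0}"
proof -
  have *: "wt (s i \<mu>) \<noteq> {0}" if "wt \<mu> \<noteq> {0}" for \<mu>
  proof -
    have iI: "i \<in> I" using i J_subset by blast
    obtain v where v: "v \<in> wt \<mu>" "v \<noteq> 0" using \<open>wt \<mu> \<noteq> {0}\<close> zero_in_wt[of \<mu>] by blast
    obtain z where "lam - \<mu> = root_comb z" using weight_le[OF v] by (auto simp: pos_cone_def)
    then obtain m where "\<mu> (\<alpha>c i) = of_int m" using weight_integral i by blast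
    then show ?thesis using wt_reflect[OF iI v] E_nilpotent[OF iI] F_nilpotent[OF i] by blast
  qed
  have "s i (s i \<mu>) = \<mu>" using i J_subset by auto
  then show ?thesis using *[of \<mu>] *[of "s i \<mu>"] by metis
qed

lemma wt_word_act_iff: "set w \<subseteq> J \<Longrightarrow> wt (word_act w \<mu>) \<noteq> {0} \<longleftrightarrow> wt \<mu> \<noteq> {0}"
  by (induction w) (simp_all add: wt_reflect_iff)

text \<open>Since lam is a weight of the module, so is w lam.\<close>

lemma word_act_lam_le: "set w \<subseteq> J \<Longrightarrow> lam - word_act w lam \<in> pos_cone"
proof -
  assume "set w \<subseteq> J"
  then have "wt (word_act w lam) \<noteq> {0}" using wt_word_act_iff v0 by blast
  then obtain v where "v \<in> wt (word_act w lam)" "v \<noteq> 0" using zero_in_wt by blast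
  then show ?thesis by (rule weight_le)
qed

text \<open>
  If \<open>lam - n\<close> is not a weight, take a weight \<open>lam - m\<close> above it that is as low as possible. On the
  set \<open>U\<close> where \<open>m < n\<close>, all \<open>F i\<close> kill its weight vectors, hence \<open>U \<subseteq> J\<close> and the weight is
  nonpositive there. A subset \<open>R\<close> of \<open>U\<close> is then orthogonal to \<open>lam\<close> and thus generates a finite group,
  although \<open>n - m\<close> is antidominant and positive on \<open>R\<close>.
\<close>

lemma dominant_weight:
  assumes fin: "finite ((\<lambda>w. restrict (word_act w) (hdual K)) ` {w. set w \<subseteq> J \<and> word_act w lam = lam})"
    and n: "\<And>i. i \<in> I \<Longrightarrow> n i \<ge> 0"
    and dom: "\<And>i. i \<in> J \<Longrightarrow> \<exists>m. (lam - root_comb n) (\<alpha>c i) = of_nat m"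
  shows "wt (lam - root_comb n) \<noteq> {0}"
proof -
  define G where "G m \<longleftrightarrow> (\<forall>i\<in>I. 0 \<le> m i \<and> m i \<le> n i) \<and> wt (lam - root_comb m) \<noteq> {0}" for m
  define size where "size m = nat (\<Sum>i\<in>I. m i)" for m
  have "lam - root_comb (\<lambda>i. 0) = lam" by simp
  then have "G (\<lambda>i. 0)" using n v0 unfolding G_def by auto
  moreover have "\<forall>m. G m \<longrightarrow> size m < Suc (size n)"
    unfolding G_def size_def using sum_mono[of I _ n] by (auto simp: less_Suc_eq_le intro!: nat_mono)
  ultimately obtain m where m: "G m" and max: "\<And>m'. G m' \<Longrightarrow> size m' \<le> size m"
    using ex_has_greatest_nat[of G "\<lambda>i. 0" size "Suc (size n)"] by (metis less_imp_le)
  have m_bounds: "\<And>i. i \<in> I \<Longrightarrow> 0 \<le> m i" "\<And>i. i \<in> I \<Longrightarrow> m i \<le> n i" using m by (auto simp: G_def)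
  obtain v where v: "v \<in> wt (lam - root_comb m)" "v \<noteq> 0" using m zero_in_wt unfolding G_def by blast
  define U where "U = {i \<in> I. m i < n i}"
  have UI: "U \<subseteq> I" and fin_U: "finite U" by (auto simp: U_def)
  have Fv: "act (F i) v = 0" if i: "i \<in> U" for i
  proof (rule ccontr)
    assume nz: "act (F i) v \<noteq> 0"
    have iI: "i \<in> I" using i UI by blast
    have eq: "lam - root_comb m - \<alpha> i = lam - root_comb (\<lambda>k. m k + of_bool (k = i))"
      by (simp only: diff_diff_eq root_comb_add[symmetric] root_comb_unit[OF iI])
    have "act (F i) v \<in> wt (lam - root_comb (\<lambda>k. m k + of_bool (k = i)))"
      using wt_F[OF iI v(1)] by (simp only: eq)
    then have "wt (lam - root_comb (\<lambda>k. m k + of_bool (k = i))) \<noteq> {0}" using nz by blast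
    then have "G (\<lambda>k. m k + of_bool (k = i))"
      using m_bounds i unfolding G_def U_def by auto
    then have "size (\<lambda>k. m k + of_bool (k = i)) \<le> size m" by (rule max)
    moreover have "(\<Sum>k\<in>I. m k) \<ge> 0" using m_bounds by (intro sum_nonneg) auto
    moreover have "(\<Sum>k\<in>I. of_bool (k = i) :: int) = 1"
      using iI by (simp add: of_bool_def)
    ultimately show False by (simp add: size_def sum.distrib)
  qed
  have UJ: "U \<subseteq> J" using Fv F_injective v(2) UI by blast
  have "U = {}"
  proof (rule ccontr)
    assume U_ne: "U \<noteq> {}"
    have "\<forall>i\<in>J. \<exists>l. lam (\<alpha>c i) = of_nat l" using J_pairing by blast
    then obtain l where l: "\<And>i. i \<in> J \<Longrightarrow> lam (\<alpha>c i) = of_nat (l i)" by metis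
    have n_le: "(\<Sum>k\<in>I. n k * a i k) \<le> int (l i)" if i: "i \<in> J" for i
    proof -
      obtain p where "(lam - root_comb n) (\<alpha>c i) = of_nat p" using dom[OF i] by blast
      then have "of_int (int (l i) - (\<Sum>k\<in>I. n k * a i k)) = (of_int (int p) :: complex)"
        using l[OF i] root_comb_pairing[of i n] i J_subset by (auto simp del: of_int_sum)
      then have "int (l i) - (\<Sum>k\<in>I. n k * a i k) = int p" by (simp only: of_int_eq_iff)
      then show ?thesis by linarith
    qed
    \<comment> \<open>A positive pairing p of lam - m with the coroot would give F_i^p v nonzero,
      although F_i v = 0.\<close>
    have m_ge: "(\<Sum>k\<in>I. m k * a i k) \<ge> int (l i)" if i: "i \<in> U" for i
    proof (rule ccontr)
      assume less: "\<not> ?thesis"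
      have iI: "i \<in> I" and iJ: "i \<in> J" using i UI UJ by auto
      define p where "p = nat (int (l i) - (\<Sum>k\<in>I. m k * a i k))"
      have p: "p > 0" "int p = int (l i) - (\<Sum>k\<in>I. m k * a i k)" using less by (auto simp: p_def)
      have "(lam - root_comb m) (\<alpha>c i) = of_int (int p)"
        unfolding p(2) using l[OF iJ] root_comb_pairing[OF iI, of m] by (simp del: of_int_sum)
      then have p': "(lam - root_comb m) (\<alpha>c i) = of_nat p" by simp
      obtain N where "(act (E i) ^^ N) v = 0" using E_nilpotent[OF iI] by blast
      then have "(act (F i) ^^ p) v \<noteq> 0" using F_pow_nonzero[OF iI v p'] by blast
      moreover have "(act (F i) ^^ p) v = 0"
        using act_pow_mono[of 1 "F i" v p] Fv[OF i] p(1) by simp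
      ultimately show False by simp
    qed
    define \<delta> where "\<delta> k = n k - m k" for k
    have \<delta>0: "\<delta> k = 0" if "k \<in> I - U" for k using that m_bounds(2)[of k] by (auto simp: U_def \<delta>_def)
    have sum_\<delta>: "(\<Sum>k\<in>U. \<delta> k * a i k) = (\<Sum>k\<in>I. n k * a i k) - (\<Sum>k\<in>I. m k * a i k)" for i
    proof -
      have "(\<Sum>k\<in>U. \<delta> k * a i k) = (\<Sum>k\<in>I. \<delta> k * a i k)"
        using \<delta>0 UI by (intro sum.mono_neutral_left) auto
      then show ?thesis by (simp add: \<delta>_def algebra_simps sum_subtractf)
    qed
    \<comment> \<open>On the rows in U the products with \<delta> are at most 0 and those with m at
      least the values of lam, so the set where m / \<delta> is minimal qualifies as R.\<close>
    have "\<exists>R\<subseteq>U. R \<noteq> {} \<and> (\<forall>i\<in>R. int (l i) = 0 \<and> (\<forall>k\<in>U - R. a i k = 0))"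
    proof (rule minimal_ratio_subset[OF fin_U U_ne, where \<delta> = \<delta> and c = m])
      show "a i k \<le> 0" if "i \<in> U" "k \<in> U" "i \<noteq> k" for i k using cartan_nonpos that UI by blast
      show "\<delta> i > 0" if "i \<in> U" for i using that by (simp add: U_def \<delta>_def)
      show "(\<Sum>k\<in>U. \<delta> k * a i k) \<le> 0" if "i \<in> U" for i
        using n_le[of i] m_ge[OF that] that UJ unfolding sum_\<delta> by auto
      show "m i \<ge> 0" if "i \<in> U" for i using m_bounds(1) that UI by blast
      show "(\<Sum>k\<in>U. m k * a i k) \<ge> int (l i)" if i: "i \<in> U" for i
      proof -
        have "(\<Sum>k\<in>I. m k * a i k) = (\<Sum>k\<in>U. m k * a i k) + (\<Sum>k\<in>I - U. m k * a i k)"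
          using UI by (metis add.commute finite_I sum.subset_diff)
        moreover have "(\<Sum>k\<in>I - U. m k * a i k) \<le> 0"
          using i UI m_bounds(1) cartan_nonpos by (intro sum_nonpos) (auto simp: mult_le_0_iff)
        ultimately show ?thesis using m_ge[OF i] by linarith
      qed
    qed simp
    then obtain R where R: "R \<subseteq> U" "R \<noteq> {}" "\<And>i. i \<in> R \<Longrightarrow> l i = 0"
      "\<And>i k. i \<in> R \<Longrightarrow> k \<in> U - R \<Longrightarrow> a i k = 0" by auto
    have RJ: "R \<subseteq> J" and RI: "R \<subseteq> I" using R UJ UI by auto
    have stab: "word_act w lam = lam" if "set w \<subseteq> R" for w
      using that
    proof (induction w)
      case (Cons i w)
      then have "i \<in> R" "i \<in> J" using RJ by auto
      then have "lam (\<alpha>c i) = 0" using l R(3) by simp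
      then show ?case using Cons by (simp add: simple_reflection_def fun_scale_def fun_eq_iff)
    qed simp
    have "finite ((\<lambda>w. restrict (word_act w) (hdual K)) ` {w. set w \<subseteq> R})"
      by (rule finite_subset[OF _ fin]) (use stab RJ in auto)
    then obtain w where w: "set w \<subseteq> R" "\<forall>i\<in>R. - word_act w (\<alpha> i) \<in> pos_cone"
      using finite_parabolic_longest[OF RI] by blast
    define z where "z k = (if k \<in> R then \<delta> k else 0)" for k
    have z_pos: "z k > 0" if "k \<in> R" for k using that R(1) by (auto simp: z_def \<delta>_def U_def)
    have z_nonneg: "z k \<ge> 0" for k using z_pos[of k] by (cases "k \<in> R") (auto simp: z_def)
    have sum_z: "(\<Sum>k\<in>I. z k * a i k) = (\<Sum>k\<in>R. \<delta> k * a i k)" for i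
    proof -
      have "(\<Sum>k\<in>I. z k * a i k) = (\<Sum>k\<in>R. z k * a i k)"
        using RI by (intro sum.mono_neutral_right) (auto simp: z_def)
      then show ?thesis by (simp add: z_def)
    qed
    \<comment> \<open>For i in R the row vanishes on U - R, so restricting \<delta> to R does not
      change the product; for the other i in J every term is nonpositive.\<close>
    have anti: "(\<Sum>k\<in>I. z k * a i k) \<le> 0" if i: "i \<in> J" for i
    proof (cases "i \<in> R")
      case True
      then have "(\<Sum>k\<in>R. \<delta> k * a i k) = (\<Sum>k\<in>U. \<delta> k * a i k)"
        using R by (intro sum.mono_neutral_left fin_U) auto
      then show ?thesis using n_le[OF i] m_ge[of i] True R(1) unfolding sum_z sum_\<delta> by auto
    next
      case False
      have "z k * a i k \<le> 0" if "k \<in> I" for k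
        using cartan_nonpos[of i k] False i J_subset that z_nonneg[of k]
        by (cases "k \<in> R") (auto simp: mult_le_0_iff z_def)
      then show ?thesis by (intro sum_nonpos) auto
    qed
    have "z k = 0" if "k \<in> I" for k
      by (rule antidominant_negated[OF J_subset _ anti _ _ that])
        (use w RJ z_nonneg in \<open>auto simp: z_def split: if_splits\<close>)
    then show False using z_pos R(2) RI by fastforce
  qed
  then have "root_comb m = root_comb n" using m_bounds(2) by (intro root_comb_cong) (force simp: U_def)
  then show ?thesis using m by (simp add: G_def)
qed

end

section \<open>Expansions of the summands\<close>

lemma infsum_single:
  fixes f :: "'b \<Rightarrow> int"
  assumes "\<And>x. x \<in> A \<Longrightarrow> x \<noteq> a \<Longrightarrow> f x = 0"
  shows "infsum f A = (if a \<in> A then f a else 0)" and "f summable_on A"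
proof -
  have "(f has_sum (if a \<in> A then f a else 0)) A"
    by (rule has_sum_finite_neutralI[where B = "A \<inter> {a}"]) (use assms in auto)
  then show "infsum f A = (if a \<in> A then f a else 0)" "f summable_on A"
    by (rule infsumI, rule has_sum_imp_summable)
qed

lemma fprod_cong:
  assumes "\<And>i. i \<in> I \<Longrightarrow> g i = g' i"
  shows "fprod I g = fprod I g'" and "fprod_defined I g \<longleftrightarrow> fprod_defined I g'"
  using assms by (simp_all add: fprod_def fprod_defined_def cong: prod.cong)

text \<open>\<open>c i\<close> enumerates the exponents that can occur in the factor of i. By
  \<open>inj\<close> an exponent has at most one decomposition with nonzero product, so each of the
  infinite sums reduces to a single term.\<close>

lemma fprod_lattice:
  fixes g :: "'i \<Rightarrow> 'm::ab_group_add formal_sum" and c :: "'i \<Rightarrow> int \<Rightarrow> 'm" and \<theta> :: "'i \<Rightarrow> int \<Rightarrow> int"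
  assumes I: "finite I"
    and inj: "\<And>z z'. (\<Sum>i\<in>I. c i (z i)) = (\<Sum>i\<in>I. c i (z' i)) \<Longrightarrow> \<forall>i\<in>I. z i = z' i"
    and g: "\<And>i z. i \<in> I \<Longrightarrow> g i (c i z) = \<theta> i z"
    and g0: "\<And>i \<nu>. i \<in> I \<Longrightarrow> \<nu> \<notin> range (c i) \<Longrightarrow> g i \<nu> = 0"
  shows "fprod_defined I g"
    and "fprod I g (\<Sum>i\<in>I. c i (z i)) = (\<Prod>i\<in>I. \<theta> i (z i))"
    and "(\<nexists>z. \<mu> = (\<Sum>i\<in>I. c i (z i))) \<Longrightarrow> fprod I g \<mu> = 0"
proof -
  have nz: "\<exists>z. \<nu> = restrict (\<lambda>i. c i (z i)) I \<and> \<mu> = (\<Sum>i\<in>I. c i (z i))"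
    if \<nu>: "\<nu> \<in> decompositions I \<mu>" and "(\<Prod>i\<in>I. g i (\<nu> i)) \<noteq> 0" for \<mu> \<nu>
  proof -
    have "\<forall>i\<in>I. \<nu> i \<in> range (c i)" using that(2) g0 I by (metis prod_zero_iff)
    then have "\<forall>i\<in>I. \<exists>z. \<nu> i = c i z" by blast
    then obtain z where z: "\<And>i. i \<in> I \<Longrightarrow> \<nu> i = c i (z i)" by metis
    have "\<nu> \<in> extensional I" "\<mu> = (\<Sum>i\<in>I. \<nu> i)"
      using \<nu> by (auto simp: decompositions_def PiE_def)
    then show ?thesis using z by (intro exI[of _ z]) (auto simp: extensional_def fun_eq_iff intro: sum.cong)
  qed
  have unique: "(\<Prod>i\<in>I. g i (\<nu> i)) = 0"
    if dec: "\<nu> \<in> decompositions I (\<Sum>i\<in>I. c i (z i))" and ne: "\<nu> \<noteq> restrict (\<lambda>i. c i (z i)) I" for \<nu> z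
  proof (rule ccontr)
    assume "\<not> ?thesis"
    then obtain z' where z': "\<nu> = restrict (\<lambda>i. c i (z' i)) I" "(\<Sum>i\<in>I. c i (z i)) = (\<Sum>i\<in>I. c i (z' i))"
      using nz[OF dec] by blast
    then have "\<forall>i\<in>I. z i = z' i" using inj by blast
    then have "\<nu> = restrict (\<lambda>i. c i (z i)) I" using z'(1) by (auto simp: fun_eq_iff)
    then show False using ne by blast
  qed
  show "fprod_defined I g"
    unfolding fprod_defined_def
  proof
    fix \<mu>
    show "(\<lambda>\<nu>. \<Prod>i\<in>I. g i (\<nu> i)) summable_on decompositions I \<mu>"
    proof (cases "\<exists>z. \<mu> = (\<Sum>i\<in>I. c i (z i))")
      case True
      then obtain z where \<mu>: "\<mu> = (\<Sum>i\<in>I. c i (z i))" by blast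
      show ?thesis unfolding \<mu> by (rule infsum_single(2)[OF unique[of _ z]])
    next
      case False
      then have "(\<Prod>i\<in>I. g i (\<nu> i)) = 0" if "\<nu> \<in> decompositions I \<mu>" for \<nu> using nz[OF that] by blast
      then show ?thesis by (rule infsum_single(2))
    qed
  qed
  show "fprod I g (\<Sum>i\<in>I. c i (z i)) = (\<Prod>i\<in>I. \<theta> i (z i))"
  proof -
    have "restrict (\<lambda>i. c i (z i)) I \<in> decompositions I (\<Sum>i\<in>I. c i (z i))"
      by (simp add: decompositions_def)
    then have "fprod I g (\<Sum>i\<in>I. c i (z i)) = (\<Prod>i\<in>I. g i (restrict (\<lambda>i. c i (z i)) I i))"
      unfolding fprod_def
      by (subst infsum_single(1)[where a = "restrict (\<lambda>i. c i (z i)) I"]) (use unique in auto)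
    also have "\<dots> = (\<Prod>i\<in>I. \<theta> i (z i))" by (intro prod.cong) (auto simp: g)
    finally show ?thesis .
  qed
  show "fprod I g \<mu> = 0" if "\<nexists>z. \<mu> = (\<Sum>i\<in>I. c i (z i))"
    unfolding fprod_def by (rule infsum_0) (use nz that in blast)
qed

text \<open>The coefficient of e^(-z\<beta>) in the expansion of 1/(1 - e^(-\<beta>)), where
  \<open>b\<close> tells whether \<beta> is positive. With one index z for both directions, the two
  expansions differ by the constant 1 at every z.\<close>

definition expansion_coeff :: "bool \<Rightarrow> int \<Rightarrow> int" where
  "expansion_coeff b z = (if b then of_bool (z \<ge> 0) else - of_bool (z < 0))"

context kac_moody
begin

lemma positive_root_iff: "positive_root K \<beta> \<longleftrightarrow> is_root K \<beta> \<and> \<beta> \<in> pos_cone"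
proof -
  have "\<beta> \<in> pos_cone \<longleftrightarrow> (\<exists>n :: 'i \<Rightarrow> nat. \<beta> = (\<Sum>i\<in>I. fun_scale (of_nat (n i)) (\<alpha> i)))"
  proof
    assume "\<beta> \<in> pos_cone"
    then obtain z where z: "\<beta> = root_comb z" "\<forall>i\<in>I. z i \<ge> 0" by (auto simp: pos_cone_def)
    then have "\<beta> = (\<Sum>i\<in>I. fun_scale (of_nat (nat (z i))) (\<alpha> i))"
      by (auto simp: root_comb_def intro!: sum.cong)
    then show "\<exists>n :: 'i \<Rightarrow> nat. \<beta> = (\<Sum>i\<in>I. fun_scale (of_nat (n i)) (\<alpha> i))"
      by (intro exI[of _ "\<lambda>i. nat (z i)"])
  next
    assume "\<exists>n :: 'i \<Rightarrow> nat. \<beta> = (\<Sum>i\<in>I. fun_scale (of_nat (n i)) (\<alpha> i))"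
    then obtain n :: "'i \<Rightarrow> nat" where "\<beta> = root_comb (\<lambda>i. int (n i))" by (auto simp: root_comb_def)
    then show "\<beta> \<in> pos_cone" by (simp add: root_comb_in_pos_cone)
  qed
  then show ?thesis by (simp add: positive_root_def)
qed

lemma negative_root_iff: "negative_root K \<beta> \<longleftrightarrow> is_root K \<beta> \<and> - \<beta> \<in> pos_cone"
proof -
  have "- \<beta> \<in> pos_cone \<longleftrightarrow> (\<exists>n :: 'i \<Rightarrow> nat. \<beta> = - (\<Sum>i\<in>I. fun_scale (of_nat (n i)) (\<alpha> i)))"
  proof
    assume "- \<beta> \<in> pos_cone"
    then obtain z where z: "- \<beta> = root_comb z" "\<forall>i\<in>I. z i \<ge> 0" by (auto simp: pos_cone_def)
    then have "- \<beta> = (\<Sum>i\<in>I. fun_scale (of_nat (nat (z i))) (\<alpha> i))"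
      by (auto simp: root_comb_def intro!: sum.cong)
    then have "\<beta> = - (\<Sum>i\<in>I. fun_scale (of_nat (nat (z i))) (\<alpha> i))" by (metis minus_minus)
    then show "\<exists>n :: 'i \<Rightarrow> nat. \<beta> = - (\<Sum>i\<in>I. fun_scale (of_nat (n i)) (\<alpha> i))"
      by (intro exI[of _ "\<lambda>i. nat (z i)"])
  next
    assume "\<exists>n :: 'i \<Rightarrow> nat. \<beta> = - (\<Sum>i\<in>I. fun_scale (of_nat (n i)) (\<alpha> i))"
    then obtain n :: "'i \<Rightarrow> nat" where "\<beta> = - root_comb (\<lambda>i. int (n i))" by (auto simp: root_comb_def)
    then have "- \<beta> = root_comb (\<lambda>i. int (n i))" by simp
    then show "- \<beta> \<in> pos_cone" by (simp only: root_comb_in_pos_cone) simp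
  qed
  then show ?thesis by (simp add: negative_root_def)
qed

lemma hw_expansion_eq:
  assumes "is_root K \<beta>"
  shows "hw_expansion K \<beta> (fun_scale (of_int (- z)) \<beta>) = expansion_coeff (\<beta> \<in> pos_cone) z"
    and "\<nu> \<notin> range (\<lambda>z. fun_scale (of_int (- z)) \<beta>) \<Longrightarrow> hw_expansion K \<beta> \<nu> = 0"
proof -
  obtain h where h: "\<beta> h \<noteq> 0" using assms by (auto simp: is_root_def fun_eq_iff)
  have inj: "fun_scale c \<beta> = fun_scale d \<beta> \<longleftrightarrow> c = d" for c d
    using h by (auto simp: fun_scale_def fun_eq_iff)
  have minus: "- fun_scale (of_nat n) \<beta> = fun_scale (of_int (- int n)) \<beta>" for n
    by (simp add: fun_scale_def fun_eq_iff)
  have neg: "negative_root K \<beta> \<longleftrightarrow> \<beta> \<notin> pos_cone"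
    using root_pos_or_neg[OF assms] pos_cone_antisym[of \<beta>] assms
    by (auto simp: negative_root_iff is_root_def)
  have hw: "hw_expansion K \<beta> \<nu> = (if \<beta> \<in> pos_cone then (\<Sum>\<^sub>\<infinity>n::nat. of_bool (\<nu> = fun_scale (of_int (- int n)) \<beta>))
      else - (\<Sum>\<^sub>\<infinity>n\<in>{1::nat..}. of_bool (\<nu> = fun_scale (of_int (int n)) \<beta>)))" for \<nu>
    unfolding hw_expansion_def fexp_def minus of_int_of_nat_eq using assms neg by (simp add: positive_root_iff)
  show "hw_expansion K \<beta> (fun_scale (of_int (- z)) \<beta>) = expansion_coeff (\<beta> \<in> pos_cone) z"
  proof (cases "\<beta> \<in> pos_cone")
    case True
    have "(\<Sum>\<^sub>\<infinity>n::nat. of_bool (fun_scale (of_int (- z)) \<beta> = fun_scale (of_int (- int n)) \<beta>))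
        = (of_bool (z \<ge> 0) :: int)"
      unfolding inj of_int_eq_iff by (subst infsum_single(1)[where a = "nat z"]) auto
    then show ?thesis using True by (simp only: hw expansion_coeff_def if_True)
  next
    case False
    have "(\<Sum>\<^sub>\<infinity>n\<in>{1::nat..}. of_bool (fun_scale (of_int (- z)) \<beta> = fun_scale (of_int (int n)) \<beta>))
        = (of_bool (z < 0) :: int)"
      unfolding inj of_int_eq_iff by (subst infsum_single(1)[where a = "nat (- z)"]) auto
    then show ?thesis using False by (simp only: hw expansion_coeff_def if_False)
  qed
  assume \<nu>: "\<nu> \<notin> range (\<lambda>z. fun_scale (of_int (- z)) \<beta>)"
  have "\<nu> \<noteq> fun_scale (of_int (- int n)) \<beta>" for n using \<nu> by blast
  moreover have "\<nu> \<noteq> fun_scale (of_int (int n)) \<beta>" for n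
  proof
    assume "\<nu> = fun_scale (of_int (int n)) \<beta>"
    then have "\<nu> = fun_scale (of_int (- (- int n))) \<beta>" by (simp only: minus_minus)
    then show False using \<nu> by blast
  qed
  ultimately show "hw_expansion K \<beta> \<nu> = 0" by (simp only: hw) simp
qed

section \<open>The Weyl subgroup as a set of words\<close>

abbreviation "word_perm w \<equiv> restrict (word_act w) (hdual K)"

lemma word_perm_Bij: "set w \<subseteq> I \<Longrightarrow> word_perm w \<in> Bij (hdual K)"
proof -
  assume w: "set w \<subseteq> I"
  have "bij_betw (word_act w) (hdual K) (hdual K)"
    by (rule bij_betw_byWitness[where f' = "word_act (rev w)"])
      (use w word_act_rev word_act_rev' word_act_hdual[of w] word_act_hdual[of "rev w"] in auto)
  then show ?thesis by (simp add: Bij_def)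
qed

lemma word_perm_mult:
  "set v \<subseteq> I \<Longrightarrow> set w \<subseteq> I \<Longrightarrow> word_perm v \<otimes>\<^bsub>BijGroup (hdual K)\<^esub> word_perm w = word_perm (v @ w)"
  using word_perm_Bij word_act_hdual[of w] by (auto simp: BijGroup_def compose_def fun_eq_iff)

text \<open>Simple reflections are involutions, so inverses of generators yield no further
  elements.\<close>

lemma weyl_subgroup_eq:
  assumes J: "J \<subseteq> I"
  shows "weyl_subgroup K J = word_perm ` {w. set w \<subseteq> J}"
proof -
  let ?G = "BijGroup (hdual K)" and ?S = "(\<lambda>i. restrict (s i) (hdual K)) ` J"
  interpret G: group ?G by (rule group_BijGroup)
  have one: "\<one>\<^bsub>?G\<^esub> = word_perm []" by (simp add: BijGroup_def id_def)
  have single: "restrict (s i) (hdual K) = word_perm [i]" for i by (simp add: comp_def)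
  show ?thesis
    unfolding weyl_subgroup_def
  proof (intro equalityI subsetI)
    fix f assume "f \<in> generate ?G ?S"
    then show "f \<in> word_perm ` {w. set w \<subseteq> J}"
    proof (induction rule: generate.induct)
      case one
      then show ?case unfolding \<open>\<one>\<^bsub>?G\<^esub> = word_perm []\<close> by (intro imageI) simp
    next
      case (incl f)
      then obtain i where "i \<in> J" "f = word_perm [i]" using single by blast
      then show ?case by (intro image_eqI[of _ _ "[i]"]) auto
    next
      case (inv f)
      then obtain i where i: "i \<in> J" "f = word_perm [i]" using single by blast
      have iI: "set [i] \<subseteq> I" using i J by auto
      have "f \<otimes>\<^bsub>?G\<^esub> f = word_perm ([i] @ [i])" unfolding i by (rule word_perm_mult[OF iI iI])
      also have "\<dots> = \<one>\<^bsub>?G\<^esub>" unfolding one using iI by (auto simp: fun_eq_iff)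
      finally have "inv\<^bsub>?G\<^esub> f = f"
        using word_perm_Bij[OF iI] i by (intro G.inv_equality) (auto simp: BijGroup_def)
      then show ?case using i by (intro image_eqI[of _ _ "[i]"]) auto
    next
      case (eng f g)
      then obtain v w where "set v \<subseteq> J" "f = word_perm v" "set w \<subseteq> J" "g = word_perm w" by blast
      then show ?case using J word_perm_mult[of v w] by (intro image_eqI[of _ _ "v @ w"]) auto
    qed
  next
    fix f assume "f \<in> word_perm ` {w. set w \<subseteq> J}"
    then obtain w where w: "set w \<subseteq> J" "f = word_perm w" by blast
    have "word_perm w \<in> generate ?G ?S"
      using w(1)
    proof (induction w)
      case Nil
      then show ?case using generate.one[of ?G ?S] by (simp only: one)
    next
      case (Cons i w)
      have "word_perm (i # w) = word_perm [i] \<otimes>\<^bsub>?G\<^esub> word_perm w"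
        using word_perm_mult[of "[i]" w] Cons.prems J by (simp add: subset_iff)
      moreover have "word_perm [i] \<in> generate ?G ?S"
        using Cons.prems by (intro generate.incl) (simp add: comp_def)
      moreover have "word_perm w \<in> generate ?G ?S" using Cons.prems by (intro Cons.IH) simp
      ultimately show ?case using generate.eng by metis
    qed
    then show "f \<in> generate ?G ?S" using w(2) by simp
  qed
qed

lemma word_roots_independent:
  assumes w: "set w \<subseteq> I"
    and "(\<Sum>i\<in>I. fun_scale (of_int (- z i)) (word_act w (\<alpha> i))) = (\<Sum>i\<in>I. fun_scale (of_int (- z' i)) (word_act w (\<alpha> i)))"
  shows "\<forall>i\<in>I. z i = z' i"
proof -
  have "word_act w (root_comb (\<lambda>i. - z i)) = word_act w (root_comb (\<lambda>i. - z' i))"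
    using assms(2) by (simp only: word_act_root_comb)
  then have "root_comb (\<lambda>i. - z i) = root_comb (\<lambda>i. - z' i)" using word_act_rev[OF w] by metis
  then show ?thesis by (simp add: root_comb_inject)
qed

lemma fprod_word:
  fixes g
  assumes w: "set w \<subseteq> I"
  defines "g \<equiv> \<lambda>i. hw_expansion K (word_act w (\<alpha> i))"
  shows "fprod_defined I g"
    and "fprod I g (- word_act w (root_comb z)) = (\<Prod>i\<in>I. expansion_coeff (word_act w (\<alpha> i) \<in> pos_cone) (z i))"
    and "(\<nexists>z. \<mu> = - word_act w (root_comb z)) \<Longrightarrow> fprod I g \<mu> = 0"
proof -
  let ?c = "\<lambda>i z. fun_scale (of_int (- z)) (word_act w (\<alpha> i))"
  have sum: "(\<Sum>i\<in>I. ?c i (z i)) = - word_act w (root_comb z)" for z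
    by (simp add: word_act_root_comb sum_negf[symmetric] del: sum_negf)
  have g: "g i (?c i z) = expansion_coeff (word_act w (\<alpha> i) \<in> pos_cone) z" if "i \<in> I" for i z
    unfolding g_def by (rule hw_expansion_eq(1)[OF word_act_root[OF w that]])
  have g0: "g i \<nu> = 0" if "i \<in> I" "\<nu> \<notin> range (?c i)" for i \<nu>
    unfolding g_def by (rule hw_expansion_eq(2)[OF word_act_root[OF w that(1)] that(2)])
  note * = fprod_lattice[where c = ?c and g = g and \<theta> = "\<lambda>i. expansion_coeff (word_act w (\<alpha> i) \<in> pos_cone)",
      OF finite_I word_roots_independent[OF w] g g0]
  show "fprod_defined I g" by (rule *(1))
  show "fprod I g (- word_act w (root_comb z)) = (\<Prod>i\<in>I. expansion_coeff (word_act w (\<alpha> i) \<in> pos_cone) (z i))"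
    using *(2)[of z] unfolding sum .
  show "(\<nexists>z. \<mu> = - word_act w (root_comb z)) \<Longrightarrow> fprod I g \<mu> = 0"
    using *(3)[of \<mu>] unfolding sum .
qed

text \<open>For arbitrary \<mu> the pairings with coroots are complex numbers, hence complex
  coefficients. \<open>trivial_on_roots\<close> uses this to treat the whole dual space.\<close>

lemma word_act_complex_comb:
  "set w \<subseteq> I \<Longrightarrow> \<exists>d. word_act w \<mu> = \<mu> + (\<Sum>i\<in>I. fun_scale (d i) (\<alpha> i))"
proof (induction w)
  case Nil
  have "word_act [] \<mu> = \<mu> + (\<Sum>i\<in>I. fun_scale ((\<lambda>_. 0) i) (\<alpha> i))"
    by (simp add: fun_scale_def fun_eq_iff sum_fun_apply)
  then show ?case by (intro exI[of _ "\<lambda>_. 0"])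
next
  case (Cons i w)
  have "\<exists>d. word_act w \<mu> = \<mu> + (\<Sum>i\<in>I. fun_scale (d i) (\<alpha> i))"
    by (rule Cons.IH) (use Cons.prems in simp)
  then obtain d where d: "word_act w \<mu> = \<mu> + (\<Sum>i\<in>I. fun_scale (d i) (\<alpha> i))" ..
  let ?p = "word_act w \<mu> (\<alpha>c i)"
  have i: "i \<in> I" using Cons.prems by simp
  have "fun_scale ?p (\<alpha> i) = (\<Sum>k\<in>I. fun_scale (of_bool (k = i) * ?p) (\<alpha> k))"
    using i by (simp add: fun_scale_def fun_eq_iff sum_fun_apply of_bool_def if_distrib if_distribR cong: if_cong)
  then have "word_act (i # w) \<mu>
      = \<mu> + (\<Sum>k\<in>I. fun_scale (d k) (\<alpha> k)) - (\<Sum>k\<in>I. fun_scale (of_bool (k = i) * ?p) (\<alpha> k))"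
    by (simp add: simple_reflection_def d)
  also have "\<dots> = \<mu> + (\<Sum>k\<in>I. fun_scale (d k - of_bool (k = i) * ?p) (\<alpha> k))"
    by (simp add: fun_space.scale_left_diff_distrib sum_subtractf add_diff_eq)
  finally show ?case by (intro exI[of _ "\<lambda>k. d k - of_bool (k = i) * ?p"])
qed

end

section \<open>The sum over the Weyl group\<close>

locale finite_stabilizer_module = simple_hw_module K vscale act lam v0
  for K :: "('i, 'h::ab_group_add, 'g::ab_group_add) kac_moody_data"
    and vscale :: "complex \<Rightarrow> 'v::ab_group_add \<Rightarrow> 'v" and act lam v0 +
  assumes finite_stabilizer: "finite (word_perm ` {w. set w \<subseteq> J \<and> word_act w lam = lam})"
begin

abbreviation "W \<equiv> word_perm ` {w. set w \<subseteq> J}"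
abbreviation "summand w \<equiv> weyl_summand K lam (word_perm w)"
abbreviation "positive w i \<equiv> word_act w (\<alpha> i) \<in> pos_cone"

lemma word_J_I: "set w \<subseteq> J \<Longrightarrow> set w \<subseteq> I"
  using J_subset by blast

lemma word_act_lattice:
  assumes w: "set w \<subseteq> J"
  shows "\<exists>z'. word_act w (lam - root_comb z) = lam - root_comb z'"
proof -
  have "lam (\<alpha>c i) \<in> \<int>" if i: "i \<in> set w" for i
  proof -
    obtain m where "lam (\<alpha>c i) = of_nat m" using J_pairing[of i] w i by blast
    then show ?thesis by simp
  qed
  then obtain z1 where "word_act w lam = lam - root_comb z1"
    using word_act_integral[OF word_J_I[OF w]] by blast
  moreover obtain z2 where "word_act w (root_comb z) = root_comb z2"
    using word_act_root_comb_ex[OF word_J_I[OF w]] by blast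
  ultimately have "word_act w (lam - root_comb z) = lam - root_comb (\<lambda>i. z1 i + z2 i)"
    by (simp only: word_act_diff diff_diff_eq root_comb_add)
  then show ?thesis by blast
qed

lemma word_act_lattice_iff:
  assumes w: "set w \<subseteq> J"
  shows "(\<exists>z. word_act w \<mu> = lam - root_comb z) \<longleftrightarrow> (\<exists>z. \<mu> = lam - root_comb z)"
proof
  assume "\<exists>z. word_act w \<mu> = lam - root_comb z"
  then obtain z where "word_act w \<mu> = lam - root_comb z" ..
  then have "\<mu> = word_act (rev w) (lam - root_comb z)" using word_act_rev[OF word_J_I[OF w]] by metis
  then show "\<exists>z. \<mu> = lam - root_comb z" using word_act_lattice[of "rev w" z] w by simp
next
  assume "\<exists>z. \<mu> = lam - root_comb z"
  then show "\<exists>z. word_act w \<mu> = lam - root_comb z" using word_act_lattice[OF w] by metis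
qed

lemma summand_fprod:
  assumes "set w \<subseteq> I"
  shows "summand w \<mu> = fprod I (\<lambda>i. hw_expansion K (word_act w (\<alpha> i))) (\<mu> - word_act w lam)"
proof -
  have "fprod I (\<lambda>i. hw_expansion K (word_perm w (\<alpha> i))) = fprod I (\<lambda>i. hw_expansion K (word_act w (\<alpha> i)))"
    by (rule fprod_cong(1)) simp
  then show ?thesis using lam by (simp add: weyl_summand_def)
qed

lemma summand_eq:
  assumes w: "set w \<subseteq> I" and z: "word_act (rev w) \<mu> = lam - root_comb z"
  shows "summand w \<mu> = (\<Prod>i\<in>I. expansion_coeff (positive w i) (z i))"
proof -
  have "\<mu> = word_act w (lam - root_comb z)" using z word_act_rev'[OF w] by metis
  then have "\<mu> - word_act w lam = - word_act w (root_comb z)" by (simp add: word_act_diff)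
  then show ?thesis by (simp only: summand_fprod[OF w] fprod_word(2)[OF w])
qed

lemma summand_eq_0:
  assumes w: "set w \<subseteq> J" and z: "\<nexists>z. \<mu> = lam - root_comb z"
  shows "summand w \<mu> = 0"
proof -
  note wI = word_J_I[OF w]
  have "\<nexists>z. \<mu> - word_act w lam = - word_act w (root_comb z)"
  proof
    assume "\<exists>z. \<mu> - word_act w lam = - word_act w (root_comb z)"
    then obtain z where "\<mu> - word_act w lam = - word_act w (root_comb z)" ..
    then have "\<mu> = word_act w (lam - root_comb z)" by (simp only: word_act_diff) (simp add: algebra_simps)
    then show False using word_act_lattice[OF w] assms(2) by metis
  qed
  then show ?thesis unfolding summand_fprod[OF wI] by (rule fprod_word(3)[OF wI])
qed

lemma rev_word_act_ex:
  "set w \<subseteq> J \<Longrightarrow> \<exists>z. \<mu> = lam - root_comb z \<Longrightarrow> \<exists>z. word_act (rev w) \<mu> = lam - root_comb z"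
  using word_act_lattice_iff[of "rev w" \<mu>] by simp

text \<open>The coordinates z of w at \<mu> and of s_i w at s_i \<mu> coincide, and by
  \<open>sgn\<close> all factors are expanded in the same directions.\<close>

lemma summand_reflect_generic:
  assumes i: "i \<in> J" and w: "set w \<subseteq> J" and sgn: "\<And>k. k \<in> I \<Longrightarrow> positive (i # w) k \<longleftrightarrow> positive w k"
  shows "summand (i # w) (s i \<mu>) = summand w \<mu>"
proof (cases "\<exists>z. \<mu> = lam - root_comb z")
  case True
  then obtain z where z: "word_act (rev w) \<mu> = lam - root_comb z" using rev_word_act_ex[OF w] by blast
  have "i \<in> I" using i J_subset by blast
  then have "word_act (rev (i # w)) (s i \<mu>) = lam - root_comb z" using z by simp
  then have "summand (i # w) (s i \<mu>) = (\<Prod>k\<in>I. expansion_coeff (positive (i # w) k) (z k))"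
    using i w word_J_I[of "i # w"] by (intro summand_eq) auto
  also have "\<dots> = (\<Prod>k\<in>I. expansion_coeff (positive w k) (z k))"
    by (intro prod.cong HOL.refl) (simp only: sgn)
  also have "\<dots> = summand w \<mu>" using summand_eq[OF word_J_I[OF w] z] by simp
  finally show ?thesis .
next
  case False
  moreover have "\<nexists>z. s i \<mu> = lam - root_comb z"
    using False word_act_lattice_iff[of "[i]" \<mu>] i by simp
  ultimately show ?thesis using summand_eq_0[of "i # w" "s i \<mu>"] summand_eq_0[of w \<mu>] i w by simp
qed

text \<open>
  If \<open>w \<alpha>\<^sub>j = \<alpha>\<^sub>i\<close>, then the summands of \<open>w\<close> and \<open>s\<^sub>i w\<close> expand the same factor in opposite
  directions, and the difference is the expansion of the product of the remaining factors.
\<close>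

lemma summand_reflect_special:
  assumes i: "i \<in> J" and w: "set w \<subseteq> J" and j: "j \<in> I" "word_act w (\<alpha> j) = \<alpha> i"
    and z: "word_act (rev w) \<mu> = lam - root_comb z"
  shows "summand w \<mu> - summand (i # w) (s i \<mu>) = (\<Prod>k\<in>I - {j}. expansion_coeff (positive w k) (z k))"
proof -
  have iI: "i \<in> I" using i J_subset by blast
  note wI = word_J_I[OF w]
  have s_i: "s i (\<alpha> i) = - \<alpha> i"
    using pairing_diag[OF iI] by (simp add: simple_reflection_def fun_scale_def fun_eq_iff)
  have inj: "inj_on \<alpha> I" using real by (simp add: realization_def)
  have sgn: "positive (i # w) k \<longleftrightarrow> positive w k" if k: "k \<in> I - {j}" for k
  proof -
    have "\<alpha> k \<noteq> \<alpha> j" using inj k j(1) by (auto simp: inj_on_def)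
    then have 1: "word_act w (\<alpha> k) \<noteq> \<alpha> i" using word_act_rev[OF wI] j(2) by metis
    \<comment> \<open>Otherwise w \<alpha> k = - w \<alpha> j, and one simple root would be the
      negative of another.\<close>
    have 2: "s i (word_act w (\<alpha> k)) \<noteq> \<alpha> i"
    proof
      assume "s i (word_act w (\<alpha> k)) = \<alpha> i"
      then have "word_act w (\<alpha> k) = - word_act w (\<alpha> j)" using s_s[OF iI] s_i j(2) by metis
      then have "\<alpha> k = - \<alpha> j" using word_act_rev[OF wI] word_act_minus by metis
      then have "- \<alpha> k = \<alpha> j" by simp
      then have "- \<alpha> k \<in> pos_cone" using root_in_pos_cone[OF j(1)] by (simp only:)
      then have "\<alpha> k = 0" using pos_cone_antisym[of "\<alpha> k"] root_in_pos_cone k by blast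
      then show False using root_nonzero k by blast
    qed
    show ?thesis
      using reflect_positive_root[OF wI _ iI _ 1] reflect_positive_root[of "i # w" k i] 2 wI iI k by auto
  qed
  have pos_j: "positive w j" "\<not> positive (i # w) j"
    using root_in_pos_cone[OF iI] root_nonzero[OF iI] pos_cone_antisym[of "\<alpha> i"] j(2) s_i by auto
  have split: "(\<Prod>k\<in>I. f k) = f j * (\<Prod>k\<in>I - {j}. f k)" for f :: "'i \<Rightarrow> int"
    using j(1) by (simp add: prod.remove)
  have "summand w \<mu> = expansion_coeff True (z j) * (\<Prod>k\<in>I - {j}. expansion_coeff (positive w k) (z k))"
    using summand_eq[OF wI z] pos_j by (simp only: split)
  moreover have "word_act (rev (i # w)) (s i \<mu>) = lam - root_comb z" using z iI by simp
  then have "summand (i # w) (s i \<mu>) = (\<Prod>k\<in>I. expansion_coeff (positive (i # w) k) (z k))"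
    using iI wI by (intro summand_eq) auto
  then have "summand (i # w) (s i \<mu>)
      = expansion_coeff False (z j) * (\<Prod>k\<in>I - {j}. expansion_coeff (positive (i # w) k) (z k))"
    using pos_j by (simp only: split)
  moreover have "(\<Prod>k\<in>I - {j}. expansion_coeff (positive (i # w) k) (z k))
      = (\<Prod>k\<in>I - {j}. expansion_coeff (positive w k) (z k))"
    by (intro prod.cong HOL.refl) (simp only: sgn)
  ultimately show ?thesis by (simp add: expansion_coeff_def)
qed

text \<open>Replacing \<mu> by s_i \<mu> shifts only the coordinate z_j, on which the difference
  computed in \<open>summand_reflect_special\<close> does not depend. Equating the differences at
  \<mu> and s_i \<mu> gives the identity.\<close>

lemma summand_reflect_pair_special:
  assumes i: "i \<in> J" and w: "set w \<subseteq> J" and j: "j \<in> I" "word_act w (\<alpha> j) = \<alpha> i"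
  shows "summand w (s i \<mu>) + summand (i # w) (s i \<mu>) = summand w \<mu> + summand (i # w) \<mu>"
proof (cases "\<exists>z. \<mu> = lam - root_comb z")
  case True
  have iI: "i \<in> I" using i J_subset by blast
  from True obtain y where y: "\<mu> = lam - root_comb y" ..
  then obtain m where m: "\<mu> (\<alpha>c i) = of_int m" using weight_integral[of \<mu> y i] i by auto
  obtain z where z: "word_act (rev w) \<mu> = lam - root_comb z" using rev_word_act_ex[OF w True] by blast
  have ij: "word_act (rev w) (\<alpha> i) = \<alpha> j" using word_act_rev[OF word_J_I[OF w]] j(2) by metis
  have "word_act (rev w) (s i \<mu>) = lam - root_comb z - fun_scale (of_int m) (\<alpha> j)"
    by (simp only: simple_reflection_def m word_act_diff word_act_scale z ij)
  also have "fun_scale (of_int m) (\<alpha> j) = root_comb (\<lambda>k. m * of_bool (k = j))"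
    by (simp only: root_comb_scale[symmetric] root_comb_unit[OF j(1)])
  finally have z': "word_act (rev w) (s i \<mu>) = lam - root_comb (\<lambda>k. z k + m * of_bool (k = j))"
    by (simp only: diff_diff_eq root_comb_add)
  have "summand w \<mu> - summand (i # w) (s i \<mu>) = summand w (s i \<mu>) - summand (i # w) (s i (s i \<mu>))"
    unfolding summand_reflect_special[OF assms z] summand_reflect_special[OF assms z']
    by (intro prod.cong) auto
  then show ?thesis using iI by simp
next
  case False
  moreover have "\<nexists>z. s i \<mu> = lam - root_comb z"
    using False word_act_lattice_iff[of "[i]" \<mu>] i by simp
  ultimately show ?thesis using i w by (simp add: summand_eq_0 del: foldr.simps)
qed

lemma word_perm_cancel: "i \<in> I \<Longrightarrow> word_perm (i # i # w) = word_perm w"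
  by (simp add: fun_eq_iff)

text \<open>If s_i w \<alpha>_j = \<alpha>_i, the special case applies to s_i w, whose partner is w
  again. If neither word sends a simple root to \<alpha>_i, no sign changes under s_i, and the two
  summands are interchanged.\<close>

lemma summand_reflect_pair:
  assumes i: "i \<in> J" and w: "set w \<subseteq> J"
  shows "summand w (s i \<mu>) + summand (i # w) (s i \<mu>) = summand w \<mu> + summand (i # w) \<mu>"
proof -
  have iI: "i \<in> I" and wI: "set w \<subseteq> I" using i w J_subset by auto
  consider j where "j \<in> I" "word_act w (\<alpha> j) = \<alpha> i"
    | j where "j \<in> I" "word_act (i # w) (\<alpha> j) = \<alpha> i"
    | "\<And>k. k \<in> I \<Longrightarrow> word_act w (\<alpha> k) \<noteq> \<alpha> i \<and> word_act (i # w) (\<alpha> k) \<noteq> \<alpha> i"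
    by blast
  then show ?thesis
  proof cases
    case 1
    then show ?thesis using summand_reflect_pair_special[OF i w] by blast
  next
    case 2
    have "summand (i # w) (s i \<mu>) + summand (i # i # w) (s i \<mu>) = summand (i # w) \<mu> + summand (i # i # w) \<mu>"
      by (rule summand_reflect_pair_special[OF i _ 2]) (use i w in auto)
    then show ?thesis unfolding word_perm_cancel[OF iI] by (simp only: add.commute)
  next
    case 3
    have sgn: "positive (i # w) k \<longleftrightarrow> positive w k" if "k \<in> I" for k
      using reflect_positive_root[OF wI that iI] reflect_positive_root[of "i # w" k i] 3[OF that] wI iI that
      by auto
    have "summand (i # w) (s i \<nu>) = summand w \<nu>" for \<nu> by (rule summand_reflect_generic[OF i w sgn])
    from this[of \<mu>] this[of "s i \<mu>"] show ?thesis using iI by simp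
  qed
qed

text \<open>Where the coefficient is nonzero, the sign of z_i agrees with that of w \<alpha>_i, so
  every z_i w \<alpha>_i lies in the positive cone.\<close>

lemma summand_nonzero:
  assumes w: "set w \<subseteq> J" and nz: "summand w \<mu> \<noteq> 0"
  shows "word_act w lam - \<mu> \<in> pos_cone"
proof -
  note wI = word_J_I[OF w]
  have "\<exists>z. \<mu> = lam - root_comb z" using summand_eq_0[OF w] nz by blast
  then obtain z where z: "word_act (rev w) \<mu> = lam - root_comb z" using rev_word_act_ex[OF w] by blast
  then have coeff: "expansion_coeff (positive w i) (z i) \<noteq> 0" if "i \<in> I" for i
    using nz that unfolding summand_eq[OF wI z] by simp
  have "\<mu> = word_act w (lam - root_comb z)" using z word_act_rev'[OF wI] by metis
  then have "word_act w lam - \<mu> = word_act w (root_comb z)" by (simp add: word_act_diff)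
  also have "\<dots> = (\<Sum>i\<in>I. fun_scale (of_int (z i)) (word_act w (\<alpha> i)))" by (rule word_act_root_comb)
  also have "\<dots> \<in> pos_cone"
  proof (rule pos_cone_sum)
    fix i assume i: "i \<in> I"
    show "fun_scale (of_int (z i)) (word_act w (\<alpha> i)) \<in> pos_cone"
    proof (cases "positive w i")
      case True
      then have "z i \<ge> 0" using coeff[OF i] by (simp add: expansion_coeff_def split: if_splits)
      then show ?thesis using pos_cone_scale[OF True, of "nat (z i)"] by simp
    next
      case False
      then have "z i < 0" "- word_act w (\<alpha> i) \<in> pos_cone"
        using coeff[OF i] word_act_root_pos_or_neg[OF wI i]
        by (auto simp: expansion_coeff_def split: if_splits)
      moreover from this have "fun_scale (of_int (z i)) (word_act w (\<alpha> i))
          = fun_scale (of_nat (nat (- z i))) (- word_act w (\<alpha> i))"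
        by (simp add: fun_scale_def fun_eq_iff)
      ultimately show ?thesis by (simp only: pos_cone_scale)
    qed
  qed
  finally show ?thesis .
qed

lemma summand_nonzero_le: "set w \<subseteq> J \<Longrightarrow> summand w \<mu> \<noteq> 0 \<Longrightarrow> lam - \<mu> \<in> pos_cone"
  using pos_cone_diff_trans word_act_lam_le summand_nonzero by blast

section \<open>Convergence of the sum and its invariance\<close>

definition support :: "('h \<Rightarrow> complex) \<Rightarrow> (('h \<Rightarrow> complex) \<Rightarrow> 'h \<Rightarrow> complex) set" where
  "support \<mu> = {f \<in> W. weyl_summand K lam f \<mu> \<noteq> 0}"

text \<open>The fibre is empty or a coset of the stabilizer of lam.\<close>

lemma finite_fibre: "finite {f \<in> W. f lam = \<nu>}"
proof (cases "{f \<in> W. f lam = \<nu>} = {}")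
  case False
  then obtain w0 where w0: "set w0 \<subseteq> J" "word_act w0 lam = \<nu>" using lam by auto
  note w0I = word_J_I[OF w0(1)]
  have "{f \<in> W. f lam = \<nu>}
      \<subseteq> (\<lambda>g. restrict (\<lambda>\<mu>. word_act w0 (g \<mu>)) (hdual K)) ` word_perm ` {w. set w \<subseteq> J \<and> word_act w lam = lam}"
  proof
    fix f assume "f \<in> {f \<in> W. f lam = \<nu>}"
    then obtain w where w: "set w \<subseteq> J" "f = word_perm w" "word_act w lam = \<nu>" using lam by auto
    let ?v = "rev w0 @ w"
    have "word_act ?v lam = lam" using word_act_rev[OF w0I, of lam] w(3) w0(2) by simp
    moreover have "set ?v \<subseteq> J" using w0 w by simp
    moreover have "f = restrict (\<lambda>\<mu>. word_act w0 (word_perm ?v \<mu>)) (hdual K)"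
      using w(2) word_act_rev'[OF w0I] by (auto simp: fun_eq_iff)
    ultimately show "f \<in> (\<lambda>g. restrict (\<lambda>\<mu>. word_act w0 (g \<mu>)) (hdual K)) `
        word_perm ` {w. set w \<subseteq> J \<and> word_act w lam = lam}" by blast
  qed
  then show ?thesis by (rule finite_subset) (use finite_stabilizer in blast)
next
  case True
  show ?thesis unfolding True by (rule finite.emptyI)
qed

lemma finite_interval: "finite {\<nu>. lam - \<nu> \<in> pos_cone \<and> \<nu> - \<mu> \<in> pos_cone}"
proof (cases "lam - \<mu> \<in> pos_cone")
  case True
  then obtain n where n: "lam - \<mu> = root_comb n" "\<forall>i\<in>I. n i \<ge> 0" by (auto simp: pos_cone_def)
  have "{\<nu>. lam - \<nu> \<in> pos_cone \<and> \<nu> - \<mu> \<in> pos_cone} \<subseteq> (\<lambda>m. lam - root_comb m) ` (PiE I (\<lambda>i. {0..n i}))"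
  proof
    fix \<nu> assume "\<nu> \<in> {\<nu>. lam - \<nu> \<in> pos_cone \<and> \<nu> - \<mu> \<in> pos_cone}"
    then obtain m m' where m: "lam - \<nu> = root_comb m" "\<forall>i\<in>I. m i \<ge> 0"
      and m': "\<nu> - \<mu> = root_comb m'" "\<forall>i\<in>I. m' i \<ge> 0" by (auto simp: pos_cone_def)
    have "lam - \<mu> = (lam - \<nu>) + (\<nu> - \<mu>)" by simp
    then have "root_comb n = root_comb (\<lambda>i. m i + m' i)" by (simp only: n m m' root_comb_add)
    then have "\<forall>i\<in>I. m i \<le> n i" using m'(2) by (simp add: root_comb_inject)
    then have "restrict m I \<in> PiE I (\<lambda>i. {0..n i})" using m(2) by auto
    moreover have "\<nu> = lam - (lam - \<nu>)" by simp
    then have "\<nu> = lam - root_comb (restrict m I)"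
      using root_comb_cong[of m "restrict m I"] by (simp only: m) simp
    ultimately show "\<nu> \<in> (\<lambda>m. lam - root_comb m) ` (PiE I (\<lambda>i. {0..n i}))" by blast
  qed
  then show ?thesis by (rule finite_subset) (intro finite_imageI finite_PiE; simp)
next
  case False
  then have empty: "{\<nu>. lam - \<nu> \<in> pos_cone \<and> \<nu> - \<mu> \<in> pos_cone} = {}" using pos_cone_diff_trans by blast
  show ?thesis unfolding empty by (rule finite.emptyI)
qed

text \<open>A summand contributing at \<mu> satisfies \<mu> \<le> w lam \<le> lam. This leaves
  finitely many values of w lam, each with a finite fibre.\<close>

lemma finite_support: "finite (support \<mu>)"
proof (rule finite_subset)
  show "support \<mu> \<subseteq> (\<Union>\<nu>\<in>{\<nu>. lam - \<nu> \<in> pos_cone \<and> \<nu> - \<mu> \<in> pos_cone}. {f \<in> W. f lam = \<nu>})"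
    using summand_nonzero word_act_lam_le lam by (auto simp: support_def)
  show "finite \<dots>" using finite_interval finite_fibre by blast
qed

definition total :: "('h \<Rightarrow> complex) \<Rightarrow> int" where
  "total \<mu> = (\<Sum>f\<in>support \<mu>. weyl_summand K lam f \<mu>)"

lemma total_has_sum: "((\<lambda>f. weyl_summand K lam f \<mu>) has_sum total \<mu>) W"
  by (rule has_sum_finite_neutralI[OF finite_support[of \<mu>]]) (auto simp: support_def total_def)

lemma total_superset:
  "finite X \<Longrightarrow> support \<mu> \<subseteq> X \<Longrightarrow> X \<subseteq> W \<Longrightarrow> total \<mu> = (\<Sum>f\<in>X. weyl_summand K lam f \<mu>)"
  unfolding total_def by (rule sum.mono_neutral_left) (auto simp: support_def)

text \<open>The involution \<open>T\<close> pairs f with s_i f. Summing the pairs over all f counts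
  each summand twice, which avoids choosing a representative of each pair.\<close>

lemma total_reflect:
  assumes i: "i \<in> J"
  shows "total (s i \<mu>) = total \<mu>"
proof -
  have iI: "i \<in> I" using i J_subset by blast
  define T where "T f = restrict (\<lambda>\<mu>. s i (f \<mu>)) (hdual K)" for f
  have T: "T (word_perm w) = word_perm (i # w)" for w by (simp add: T_def fun_eq_iff)
  have TW: "T f \<in> W" if "f \<in> W" for f
  proof -
    from that obtain w where w: "set w \<subseteq> J" "f = word_perm w" by blast
    then show ?thesis using T i by (intro image_eqI[of _ _ "i # w"]) auto
  qed
  have TT: "T (T f) = f" if "f \<in> W" for f
  proof -
    from that obtain w where f: "f = word_perm w" by blast
    show ?thesis unfolding f T by (rule word_perm_cancel[OF iI])
  qed
  \<comment> \<open>The supports need not be stable under \<open>T\<close>; X is a finite stable set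
    containing both.\<close>
  define Y where "Y = support \<mu> \<union> support (s i \<mu>)"
  define X where "X = Y \<union> T ` Y"
  have Y: "finite Y" "Y \<subseteq> W" using finite_support by (auto simp: Y_def support_def)
  have X: "finite X" "X \<subseteq> W" using Y TW by (auto simp: X_def)
  have bij: "bij_betw T X X"
    by (rule bij_betw_byWitness[where f' = T]) (use X TT Y in \<open>auto simp: X_def subset_iff\<close>)
  have pair: "weyl_summand K lam f (s i \<mu>) + weyl_summand K lam (T f) (s i \<mu>)
      = weyl_summand K lam f \<mu> + weyl_summand K lam (T f) \<mu>" if "f \<in> X" for f
  proof -
    from that X(2) obtain w where "set w \<subseteq> J" "f = word_perm w" by blast
    then show ?thesis using summand_reflect_pair[OF i] T by simp
  qed
  have double: "(\<Sum>f\<in>X. weyl_summand K lam f \<nu> + weyl_summand K lam (T f) \<nu>) = 2 * total \<nu>"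
    if "support \<nu> \<subseteq> X" for \<nu>
    using total_superset[OF X(1) that X(2)] sum.reindex_bij_betw[OF bij, of "\<lambda>f. weyl_summand K lam f \<nu>"]
    by (simp add: sum.distrib)
  have "(\<Sum>f\<in>X. weyl_summand K lam f (s i \<mu>) + weyl_summand K lam (T f) (s i \<mu>))
      = (\<Sum>f\<in>X. weyl_summand K lam f \<mu> + weyl_summand K lam (T f) \<mu>)"
    by (intro sum.cong HOL.refl pair)
  moreover have "support \<mu> \<subseteq> X" "support (s i \<mu>) \<subseteq> X" by (auto simp: X_def Y_def)
  ultimately have "2 * total (s i \<mu>) = 2 * total \<mu>" using double by simp
  then show ?thesis by simp
qed

text \<open>
  An element that fixes all roots acts on the dual space by a unipotent map, which has to be the
  identity since it belongs to the finite stabilizer of \<open>lam\<close>.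
\<close>

lemma trivial_on_roots:
  assumes w: "set w \<subseteq> J" and triv: "\<And>k. k \<in> I \<Longrightarrow> word_act w (\<alpha> k) = \<alpha> k" and \<mu>: "\<mu> \<in> hdual K"
  shows "word_act w \<mu> = \<mu>"
proof -
  note wI = word_J_I[OF w]
  have comb: "word_act w (\<Sum>i\<in>I. fun_scale (d i) (\<alpha> i)) = (\<Sum>i\<in>I. fun_scale (d i) (\<alpha> i))" for d
    by (simp add: word_act_sum word_act_scale triv)
  have "\<exists>z. word_act w lam = lam - root_comb z"
    using word_act_lattice_iff[OF w, of lam] root_comb_0 by (metis diff_zero)
  \<comment> \<open>w moves lam by -z and its inverse moves it by +z; as both images lie below lam,
    the combination vanishes.\<close>
  then obtain z where z: "word_act w lam = lam - root_comb z" ..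
  have "word_act w (lam + root_comb z) = lam - root_comb z + root_comb z"
    using comb[of "\<lambda>i. of_int (z i)"] by (simp only: word_act_add z root_comb_def)
  then have "word_act w (lam + root_comb z) = lam" by simp
  then have "word_act (rev w) lam = lam + root_comb z" using word_act_rev[OF wI] by metis
  then have "lam - (lam + root_comb z) \<in> pos_cone" using word_act_lam_le[of "rev w"] w by simp
  then have "- root_comb z \<in> pos_cone" by simp
  moreover have "root_comb z \<in> pos_cone" using word_act_lam_le[OF w] z by simp
  ultimately have "root_comb z = 0" using pos_cone_antisym by blast
  then have stab: "word_act w lam = lam" using z by simp
  define p where "p n = concat (replicate n w)" for n
  have p_Suc: "p (Suc n) = w @ p n" for n by (simp add: p_def)
  obtain d where "word_act w \<mu> = \<mu> + (\<Sum>i\<in>I. fun_scale (d i) (\<alpha> i))"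
    using word_act_complex_comb[OF wI] by blast
  then obtain c where c: "word_act w \<mu> = \<mu> + c" "word_act w c = c" using comb by blast
  have p: "set (p n) \<subseteq> J" "word_act (p n) lam = lam" for n
    using w stab by (induction n) (auto simp: p_def)
  have p_act: "word_act (p n) \<mu> = \<mu> + fun_scale (of_nat n) c" for n
  proof (induction n)
    case (Suc n)
    have "word_act (p (Suc n)) \<mu> = word_act w (\<mu> + fun_scale (of_nat n) c)"
      using Suc by (simp only: p_Suc foldr_append comp_apply)
    also have "\<dots> = \<mu> + c + fun_scale (of_nat n) c" by (simp only: word_act_add word_act_scale c)
    finally show ?case by (simp add: fun_scale_def fun_eq_iff algebra_simps)
  qed (simp add: p_def fun_scale_def fun_eq_iff)
  have "(\<lambda>n. word_perm (p n)) ` UNIV \<subseteq> word_perm ` {w. set w \<subseteq> J \<and> word_act w lam = lam}"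
    using p by blast
  then have "finite (range (\<lambda>n. word_perm (p n)))" using finite_stabilizer finite_subset by blast
  then have "\<not> inj (\<lambda>n. word_perm (p n))" using finite_imageD infinite_UNIV_nat by blast
  then obtain n m where nm: "n \<noteq> m" "word_perm (p n) = word_perm (p m)" by (auto simp: inj_on_def)
  then have "word_perm (p n) \<mu> = word_perm (p m) \<mu>" by simp
  then have "\<mu> + fun_scale (of_nat n) c = \<mu> + fun_scale (of_nat m) c" using \<mu> p_act by simp
  then have "fun_scale (of_nat n) c h = fun_scale (of_nat m) c h" for h
    by (metis add_left_cancel)
  then have "c h = 0" for h using nm(1) by (simp add: fun_scale_def)
  then show ?thesis using c(1) by (simp add: fun_eq_iff)
qed

section \<open>The sum at dominant exponents\<close>

lemma word_act_eq_if_eq_on_roots: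
  assumes vw: "set v \<subseteq> J" "set w \<subseteq> J" and eq: "\<And>k. k \<in> I \<Longrightarrow> word_act v (\<alpha> k) = word_act w (\<alpha> k)"
    and \<mu>: "\<mu> \<in> hdual K"
  shows "word_act v \<mu> = word_act w \<mu>"
proof -
  have "word_act (rev w @ v) \<mu> = \<mu>"
    by (rule trivial_on_roots) (use vw eq \<mu> word_act_rev[OF word_J_I[OF vw(2)]] in auto)
  then have "word_act (rev w) (word_act v \<mu>) = \<mu>" by simp
  then show ?thesis using word_act_rev'[OF word_J_I[OF vw(2)]] by metis
qed

text \<open>The counterpart of \<open>antidominant_minimal\<close> outside the root lattice. That w
  may be replaced by a reduced word with the same action on roots is due to
  \<open>word_act_eq_if_eq_on_roots\<close>, and thus to the finite stabilizer.\<close>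

lemma dominant_maximal:
  assumes \<mu>: "\<mu> \<in> hdual K" and dom: "\<And>i. i \<in> J \<Longrightarrow> \<exists>m. \<mu> (\<alpha>c i) = of_nat m" and w: "set w \<subseteq> J"
  shows "\<mu> - word_act w \<mu> \<in> pos_cone"
proof -
  obtain v where v: "reduced J v" "\<forall>k\<in>I. word_act v (\<alpha> k) = word_act w (\<alpha> k)"
    using ex_reduced[OF w] by blast
  have "\<mu> - word_act v \<mu> \<in> pos_cone"
    using v(1)
  proof (induction v rule: rev_induct)
    case (snoc i v)
    have i: "i \<in> J" "i \<in> I" using snoc.prems J_subset by (auto simp: reduced_def)
    obtain m where m: "\<mu> (\<alpha>c i) = of_nat m" using dom[OF i(1)] by blast
    have "word_act (v @ [i]) \<mu> = word_act v (s i \<mu>)" by simp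
    also have "\<dots> = word_act v \<mu> - fun_scale (of_nat m) (word_act v (\<alpha> i))"
      by (simp only: simple_reflection_def m word_act_diff word_act_scale)
    finally have eq: "word_act (v @ [i]) \<mu> = \<dots>" .
    have "word_act v \<mu> - word_act (v @ [i]) \<mu> = fun_scale (of_nat m) (word_act v (\<alpha> i))"
      unfolding eq by simp
    moreover have "fun_scale (of_nat m) (word_act v (\<alpha> i)) \<in> pos_cone"
      using reduced_last_positive[OF snoc.prems J_subset] by (rule pos_cone_scale)
    ultimately show ?case
      using pos_cone_diff_trans[OF snoc.IH[OF reduced_prefix[OF snoc.prems i(2)]]] by (simp only:)
  qed simp
  moreover have "word_act v \<mu> = word_act w \<mu>"
    using word_act_eq_if_eq_on_roots[of v w] v w \<mu> by (simp add: reduced_def)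
  ultimately show ?thesis by simp
qed

text \<open>Reflections in J leave the coordinate at k untouched, so it stays 1 and determines the
  sign.\<close>

lemma word_act_outside:
  assumes w: "set w \<subseteq> J" and k: "k \<in> I" "k \<notin> J"
  shows "positive w k"
proof -
  have "\<exists>z. word_act w (\<alpha> k) = root_comb z \<and> z k = 1"
    using w
  proof (induction w)
    case Nil
    show ?case using root_comb_unit[OF k(1)] by (intro exI[of _ "\<lambda>i. of_bool (i = k)"]) simp
  next
    case (Cons i w)
    then obtain z where "word_act w (\<alpha> k) = root_comb z" "z k = 1" by auto
    moreover have "i \<in> I" "i \<noteq> k" using Cons.prems J_subset k by auto
    ultimately show ?case
      using s_root_comb[of i z]
      by (intro exI[of _ "\<lambda>l. z l - of_bool (l = i) * (\<Sum>j\<in>I. z j * a i j)"]) simp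
  qed
  then obtain z where z: "word_act w (\<alpha> k) = root_comb z" "z k = 1" by blast
  have "- root_comb z \<notin> pos_cone" using z(2) k(1) by (force simp: minus_root_comb_in_pos_cone)
  then show ?thesis using word_act_root_pos_or_neg[OF word_J_I[OF w] k(1)] z(1) by auto
qed

text \<open>
  If \<open>w\<close> makes some simple roots negative, then the part of the exponent along these roots is
  positive and antidominant, but \<open>w\<close> makes it negative.
\<close>

lemma summand_dominant_trivial:
  assumes \<mu>: "\<mu> \<in> hdual K" and dom: "\<And>i. i \<in> J \<Longrightarrow> \<exists>m. \<mu> (\<alpha>c i) = of_nat m"
    and w: "set w \<subseteq> J" and nz: "summand w \<mu> \<noteq> 0"
  shows "word_perm w = word_perm []"
proof -
  note wI = word_J_I[OF w]
  have "\<exists>z. \<mu> = lam - root_comb z" using summand_eq_0[OF w] nz by blast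
  then obtain z where z: "word_act (rev w) \<mu> = lam - root_comb z" using rev_word_act_ex[OF w] by blast
  have \<mu>_eq: "word_act w (word_act (rev w) \<mu>) = \<mu>" by (rule word_act_rev'[OF wI])
  have coeff: "expansion_coeff (positive w i) (z i) \<noteq> 0" if "i \<in> I" for i
    using nz that unfolding summand_eq[OF wI z] by simp
  define D where "D = {i \<in> I. \<not> positive w i}"
  have DJ: "D \<subseteq> J" using word_act_outside[OF w] by (auto simp: D_def)
  have D_neg: "- word_act w (\<alpha> i) \<in> pos_cone" "z i < 0" if "i \<in> D" for i
    using that word_act_root_pos_or_neg[OF wI, of i] coeff[of i]
    by (auto simp: D_def expansion_coeff_def)
  have z_nonneg: "z i \<ge> 0" if "i \<in> I - D" for i
    using that coeff[of i] by (auto simp: D_def expansion_coeff_def split: if_splits)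
  define y where "y k = (if k \<in> D then - z k else 0)" for k
  have y_nonneg: "y k \<ge> 0" for k using D_neg(2)[of k] by (auto simp: y_def)
  have anti: "(\<Sum>k\<in>I. y k * a i k) \<le> 0" if i: "i \<in> J" for i
  proof (cases "i \<in> D")
    case True
    have iI: "i \<in> I" using i J_subset by blast
    obtain l where l: "lam (\<alpha>c i) = of_nat l" using J_pairing[OF i] by blast
    define p where "p = int l - (\<Sum>k\<in>I. z k * a i k)"
    have p: "word_act (rev w) \<mu> (\<alpha>c i) = of_int p"
      unfolding z p_def using l root_comb_pairing[OF iI, of z] by (simp del: of_int_sum)
    \<comment> \<open>The conjugate w s_i w^(-1) moves the dominant \<mu> by -p w \<alpha>_i, which
      must be a move downwards; as w \<alpha>_i is negative, p \<le> 0.\<close>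
    have "word_act (w @ [i] @ rev w) \<mu> = word_act w (s i (word_act (rev w) \<mu>))" by simp
    also have "\<dots> = \<mu> - fun_scale (of_int p) (word_act w (\<alpha> i))"
      by (simp only: simple_reflection_def p word_act_diff word_act_scale \<mu>_eq)
    finally have "\<mu> - word_act (w @ [i] @ rev w) \<mu> = fun_scale (of_int p) (word_act w (\<alpha> i))"
      by (simp only:) simp
    moreover have "\<mu> - word_act (w @ [i] @ rev w) \<mu> \<in> pos_cone"
      by (rule dominant_maximal[OF \<mu> dom]) (use w i in auto)
    ultimately have pos: "fun_scale (of_int p) (word_act w (\<alpha> i)) \<in> pos_cone" by (simp only:)
    have "p \<le> 0"
    proof (rule ccontr)
      assume "\<not> p \<le> 0"
      then have p0: "of_nat (nat p) = (of_int p :: complex)" "p \<noteq> 0" by auto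
      have "- fun_scale (of_int p) (word_act w (\<alpha> i)) = fun_scale (of_nat (nat p)) (- word_act w (\<alpha> i))"
        by (simp add: p0(1) fun_scale_def fun_eq_iff)
      then have "- fun_scale (of_int p) (word_act w (\<alpha> i)) \<in> pos_cone"
        using pos_cone_scale[OF D_neg(1)[OF True]] by (simp only:)
      then have "fun_scale (of_int p) (word_act w (\<alpha> i)) = 0" using pos_cone_antisym pos by blast
      then have "word_act w (\<alpha> i) = 0" using p0(2) by (simp add: fun_scale_def fun_eq_iff)
      then show False using word_act_root_nonzero[OF wI iI] by simp
    qed
    have DI: "D \<subseteq> I" by (auto simp: D_def)
    \<comment> \<open>From p \<le> 0 the row product of z is at least \<open>l\<close>, hence
      nonnegative. Its part outside D is nonpositive, so its part on D, the negative of the product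
      for y, is nonnegative.\<close>
    have "(\<Sum>k\<in>I. z k * a i k) = (\<Sum>k\<in>D. z k * a i k) + (\<Sum>k\<in>I - D. z k * a i k)"
      using DI by (metis add.commute finite_I sum.subset_diff)
    moreover have "(\<Sum>k\<in>I - D. z k * a i k) \<le> 0"
      using z_nonneg cartan_nonpos[OF iI] True by (intro sum_nonpos) (auto simp: mult_le_0_iff)
    moreover have "(\<Sum>k\<in>I. y k * a i k) = (\<Sum>k\<in>D. y k * a i k)"
      using DI by (intro sum.mono_neutral_right) (auto simp: y_def)
    moreover have "(\<Sum>k\<in>D. y k * a i k) = - (\<Sum>k\<in>D. z k * a i k)"
      by (simp add: y_def sum_negf[symmetric] del: sum_negf)
    ultimately show ?thesis using \<open>p \<le> 0\<close> by (simp add: p_def)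
  next
    case False
    have "y k * a i k \<le> 0" if k: "k \<in> I" for k
    proof (cases "k \<in> D")
      case True
      then have "a i k \<le> 0" using cartan_nonpos[of i k] False i J_subset k by blast
      then show ?thesis using y_nonneg[of k] by (simp add: mult_le_0_iff)
    qed (simp add: y_def)
    then show ?thesis by (intro sum_nonpos) auto
  qed
  have y0: "y k = 0" if "k \<in> I" for k
    by (rule antidominant_negated[OF J_subset w anti _ _ that])
      (use D_neg y_nonneg in \<open>auto simp: y_def split: if_splits\<close>)
  have "k \<notin> D" for k
  proof
    assume k: "k \<in> D"
    then have "k \<in> I" by (simp add: D_def)
    then show False using y0[of k] D_neg(2)[OF k] k by (simp add: y_def)
  qed
  then have "D = {}" by blast
  then have "positive w i" if "i \<in> J" for i using that J_subset by (auto simp: D_def)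
  then have "word_act w (\<alpha> k) = \<alpha> k" if "k \<in> I" for k
    using positive_imp_trivial[OF J_subset w _ that] by blast
  then have "word_act w \<nu> = \<nu>" if "\<nu> \<in> hdual K" for \<nu> using trivial_on_roots[OF w _ that] by blast
  then show ?thesis by (auto simp: fun_eq_iff)
qed

lemma total_dominant:
  assumes \<mu>: "\<mu> \<in> hdual K" and dom: "\<And>i. i \<in> J \<Longrightarrow> \<exists>m. \<mu> (\<alpha>c i) = of_nat m"
    and n: "\<mu> = lam - root_comb n" "\<And>i. i \<in> I \<Longrightarrow> n i \<ge> 0"
  shows "total \<mu> = 1"
proof -
  have "support \<mu> \<subseteq> {word_perm []}"
    using summand_dominant_trivial[OF \<mu> dom] by (auto simp: support_def simp del: foldr.simps)
  then have "total \<mu> = (\<Sum>f\<in>{word_perm []}. weyl_summand K lam f \<mu>)"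
    by (intro total_superset) (auto simp del: foldr.simps intro!: imageI)
  also have "\<dots> = summand [] \<mu>" by (simp del: foldr.simps)
  also have "\<dots> = (\<Prod>i\<in>I. expansion_coeff (positive [] i) (n i))"
    by (rule summand_eq) (use n in auto)
  also have "\<dots> = 1" using root_in_pos_cone n(2) by (intro prod.neutral) (simp add: expansion_coeff_def)
  finally show ?thesis .
qed

lemma total_outside: "lam - \<mu> \<notin> pos_cone \<Longrightarrow> total \<mu> = 0"
proof -
  assume "lam - \<mu> \<notin> pos_cone"
  then have "support \<mu> = {}" using summand_nonzero_le by (auto simp: support_def)
  then show ?thesis by (simp add: total_def)
qed

lemma weight_outside: "lam - \<mu> \<notin> pos_cone \<Longrightarrow> wt \<mu> = {0}"
  using weight_le zero_in_wt by blast

text \<open>Induction on the height of lam - \<mu>. At a nondominant \<mu>, the reflection in an i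
  with negative pairing raises \<mu> and changes neither side.\<close>

lemma total_eq:
  assumes "\<mu> \<in> hdual K"
  shows "total \<mu> = of_bool (wt \<mu> \<noteq> {0})"
proof (cases "lam - \<mu> \<in> pos_cone")
  case False
  then show ?thesis by (simp add: total_outside weight_outside)
next
  case True
  then obtain n where "lam - \<mu> = root_comb n" "\<forall>i\<in>I. n i \<ge> 0" by (auto simp: pos_cone_def)
  then show ?thesis
    using assms
  proof (induction "nat (\<Sum>i\<in>I. n i)" arbitrary: \<mu> n rule: less_induct)
    case less
    have \<mu>: "\<mu> = lam - root_comb n" using less.prems(1) by (metis diff_diff_eq2 add_diff_cancel_left')
    show ?case
    proof (cases "\<forall>i\<in>J. \<exists>m. \<mu> (\<alpha>c i) = of_nat m")
      case True
      then have "total \<mu> = 1" using total_dominant[OF less.prems(3) _ \<mu>] less.prems(2) by blast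
      moreover have "wt \<mu> \<noteq> {0}"
        unfolding \<mu> by (rule dominant_weight[OF finite_stabilizer]) (use True \<mu> less.prems in auto)
      ultimately show ?thesis by simp
    next
      case False
      then obtain i where i: "i \<in> J" and not_nat: "\<nexists>m. \<mu> (\<alpha>c i) = of_nat m" by blast
      have iI: "i \<in> I" using i J_subset by blast
      obtain m where m: "\<mu> (\<alpha>c i) = of_int m" using weight_integral less.prems(1) i by blast
      have "m < 0"
      proof (rule ccontr)
        assume "\<not> m < 0"
        then have "\<mu> (\<alpha>c i) = of_nat (nat m)" using m by simp
        then show False using not_nat by blast
      qed
      define n' where "n' = (\<lambda>k. n k + m * of_bool (k = i))"
      have "fun_scale (of_int m) (\<alpha> i) = root_comb (\<lambda>k. m * of_bool (k = i))"
        by (simp only: root_comb_scale[symmetric] root_comb_unit[OF iI])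
      then have "s i \<mu> = lam - root_comb n'"
        by (simp only: simple_reflection_def m \<mu>[symmetric] n'_def root_comb_add[symmetric] diff_diff_eq[symmetric])
      then have n': "lam - s i \<mu> = root_comb n'" by simp
      \<comment> \<open>If the raised exponent is no longer below lam, both sides vanish
        there.\<close>
      have "total (s i \<mu>) = of_bool (wt (s i \<mu>) \<noteq> {0})"
      proof (cases "\<forall>k\<in>I. n' k \<ge> 0")
        case True
        have "(\<Sum>k\<in>I. n' k) = (\<Sum>k\<in>I. n k) + m"
          using iI by (simp add: n'_def sum.distrib of_bool_def sum_distrib_left[symmetric])
        moreover have "(\<Sum>k\<in>I. n' k) \<ge> 0" using True by (intro sum_nonneg) auto
        ultimately have "nat (\<Sum>k\<in>I. n' k) < nat (\<Sum>k\<in>I. n k)" using \<open>m < 0\<close> by linarith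
        then show ?thesis using less.hyps n' True s_hdual[OF iI less.prems(3)] by blast
      next
        case False
        then have "lam - s i \<mu> \<notin> pos_cone" unfolding n' root_comb_in_pos_cone .
        then show ?thesis by (simp add: total_outside weight_outside)
      qed
      then show ?thesis using total_reflect[OF i] wt_reflect_iff[OF i] by simp
    qed
  qed
qed

lemma weyl_sum:
  "\<mu> \<in> hdual K \<Longrightarrow> ((\<lambda>f. weyl_summand K lam f \<mu>) has_sum of_bool (wt \<mu> \<noteq> {0})) W"
  using total_has_sum[of \<mu>] total_eq[of \<mu>] by simp

lemma weyl_summand_defined: "f \<in> W \<Longrightarrow> fprod_defined I (\<lambda>i. hw_expansion K (f (\<alpha> i)))"
proof -
  assume "f \<in> W"
  then obtain w where w: "set w \<subseteq> I" "f = word_perm w" using word_J_I by blast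
  have "fprod_defined I (\<lambda>i. hw_expansion K (f (\<alpha> i))) \<longleftrightarrow> fprod_defined I (\<lambda>i. hw_expansion K (word_act w (\<alpha> i)))"
    unfolding w(2) by (rule fprod_cong(2)) simp
  then show ?thesis using fprod_word(1)[OF w(1)] by simp
qed

end

theorem theorem2p11:
  fixes K :: "('i, 'h::ab_group_add, 'g::ab_group_add) kac_moody_data"
    and vscale :: "complex \<Rightarrow> 'v::ab_group_add \<Rightarrow> 'v"
    and act :: "'g \<Rightarrow> 'v \<Rightarrow> 'v"
    and lam :: "'h \<Rightarrow> complex"
  defines "W \<equiv> weyl_subgroup K (integral_idx K lam)"
  assumes "kac_moody_algebra K"
    and "lam \<in> hdual K"
    and "simple_highest_weight_module K vscale act lam"
    and "finite {w \<in> W. w lam = lam}"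
  shows "(\<forall>w\<in>W. fprod_defined (idx K) (\<lambda>i. hw_expansion K (w (sroot K i)))) \<and>
         (\<forall>\<mu>\<in>hdual K.
            ((\<lambda>w. weyl_summand K lam w \<mu>) has_sum of_bool (weight_space K vscale act \<mu> \<noteq> {0})) W)"
proof -
  interpret kac_moody K by unfold_locales fact
  have module: "lie_module (gscale K) (bracket K) vscale act" and simple: "simple_lie_module vscale act"
    and highest: "highest_weight_module K vscale act lam"
    using assms(4) by (simp_all add: simple_highest_weight_module_def)
  obtain v0 where v0: "v0 \<noteq> 0" "v0 \<in> weight_space K vscale act lam" "\<forall>i\<in>idx K. act (km_gen K (GenE i)) v0 = 0"
    using highest by (auto simp: highest_weight_module_def)
  have "integral_idx K lam \<subseteq> idx K" by (auto simp: integral_idx_def)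
  then have W: "W = word_perm ` {w. set w \<subseteq> integral_idx K lam}"
    unfolding W_def by (rule weyl_subgroup_eq)
  have "word_perm ` {w. set w \<subseteq> integral_idx K lam \<and> word_act w lam = lam} \<subseteq> {w \<in> W. w lam = lam}"
    using W assms(3) by auto
  then have fin: "finite (word_perm ` {w. set w \<subseteq> integral_idx K lam \<and> word_act w lam = lam})"
    using assms(5) finite_subset by blast
  interpret km_module K vscale act by (intro km_module.intro kac_moody_axioms module)
  interpret finite_stabilizer_module K vscale act lam v0
    by unfold_locales (use assms(3) simple v0 fin in \<open>auto simp: simple_lie_module_def\<close>)
  show ?thesis unfolding W using weyl_sum weyl_summand_defined by blast
qed

end
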